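(* Let $A$ be a Lie algebroid. Symplectic pairs on $A$ are in one-to-one correspondence with non-degenerate Poisson pairs on $A$.
   Context: $[~,~]$ denotes the Lie algebroid bracket on $\Gamma A$, and also the Schouten--Nijenhuis bracket on $\Gamma(\wedge^\bullet A)$; $\mathrm d$ is the Lie algebroid differential. A bivector $\pi\in\Gamma(\wedge^2A)$ is identified with the map $\pi:A^*\to A$, $\pi\xi=i_\xi\pi$; a $2$-form $\omega\in\Gamma(\wedge^2A^* )$ is identified with the map $\omega:A\to A^*$, $\omega x=-i_x\omega$; both are also identified with the induced maps on sections. They are non-degenerate if these bundle maps are invertible. $\pi$ is a Poisson bivector if $[\pi,\pi]=0$; $\omega$ is a presymplectic structure if $\mathrm d\omega=0$. The graph of $\omega$ is $\{(x,\omega x)\mid x\in A\}\subset A\oplus A^*$. A Dirac structure on $A$ is a maximally isotropic subbundle of $A\oplus A^*$ (for the pairing $\langle X+\xi,Y+\eta\rangle=\langle\xi,Y\rangle+\langle\eta,X\rangle$) whose space of sections is closed under the Dorfman bracket $[X+\xi,Y+\eta]=[X,Y]+\mathcal L_X\eta-i_Y(\mathrm d\xi)$. A $2$-form is closed if and only if its graph is a Dirac structure (known fact). Relations are taken at the level of sections. For a relation $\mathbf N\subset\Gamma A\times\Gamma A$, the dual relation is $\mathbf N^*=\{(\beta,\alpha)\in\Gamma(A^* )\times\Gamma(A^* )\mid\langle\alpha,u\rangle=\langle\beta,v\rangle\ \forall(u,v)\in\mathbf N\}$. $\mathbf N$ is a Nijenhuis relation if $\langle\alpha,[v_1,v_2]\rangle-\langle\alpha',[v_1,u_2]+[u_1,v_2]\rangle+\langle\alpha'',[u_1,u_2]\rangle=0$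 for all $(u_1,v_1),(u_2,v_2)\in\mathbf N$ and all $(\alpha,\alpha'),(\alpha',\alpha'')\in\mathbf N^*$. A Dirac pair is a pair $(L,L')$ of Dirac structures on $A$ such that $\mathbf N_{L,L'}=\{(x,y)\in\Gamma A\times\Gamma A\mid\exists\,\xi\in\Gamma(A^* ),\ (x,\xi)\in\Gamma L',\ (y,\xi)\in\Gamma L\}$ is a Nijenhuis relation. A presymplectic pair is a pair of presymplectic structures whose graphs constitute a Dirac pair; it is a symplectic pair if both $2$-forms are non-degenerate. A non-degenerate Poisson pair is a pair $(\pi,\pi')$ of non-degenerate Poisson bivectors such that $\mathbf N(\pi,\pi')=\{(\pi'\xi,\pi\xi)\mid\xi\in\Gamma(A^* )\}$ is a Nijenhuis relation. *)

theory Defs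
  imports "HOL-Analysis.Analysis"
begin

section \<open>Smooth functions\<close>

text \<open>Functions of class \<open>C\<^sup>k\<close> on an open set \<open>S\<close> (the definition is only meant for open \<open>S\<close>): a
  \<open>C\<^sup>k\<^sup>+\<^sup>1\<close> function is a differentiable function all of whose directional derivatives are \<open>C\<^sup>k\<close>.\<close>

primrec Ck_on :: "nat \<Rightarrow> 'e::real_normed_vector set \<Rightarrow> ('e \<Rightarrow> 'b::real_normed_vector) \<Rightarrow> bool" where
  "Ck_on 0 S f = continuous_on S f"
| "Ck_on (Suc k) S f =
     (\<exists>f'. (\<forall>x\<in>S. (f has_derivative f' x) (at x)) \<and> (\<forall>v. Ck_on k S (\<lambda>x. f' x v)))"

definition smooth_map_on :: "'e::real_normed_vector set \<Rightarrow> ('e \<Rightarrow> 'b::real_normed_vector) \<Rightarrow> bool" where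
  "smooth_map_on S f \<longleftrightarrow> (\<forall>k. Ck_on k S f)"


section \<open>Smooth manifolds, vector bundles, Lie algebroids\<close>

text \<open>
  The base manifold \<open>M\<close> is the type \<open>'m\<close>.  The charts take values in a finite-dimensional inner
  product space \<open>'e\<close>; the class \<open>real_inner\<close> is used instead of \<open>euclidean_space\<close> because the latter
  excludes dimension 0, i.e. Lie algebras regarded as Lie algebroids over a point.

  The fibre of \<open>A\<close> over \<open>p\<close> is a linear subspace of an arbitrary real vector space \<open>'v\<close> (no relation
  between the fibres over different points, and no topology on \<open>'v\<close>, is used: one may always take
  for \<open>'v\<close> the direct sum of all fibres).  The smooth structure of the bundle is given by an atlas
  of local trivializations, written as local frames \<open>e 0, \<dots>, e (k - 1)\<close> over open sets.

  Tangent vectors at \<open>p\<close> are the derivations at \<open>p\<close> of the algebra of smooth functions on \<open>M\<close>, so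
  that \<open>anchor A p v f\<close> is the derivative at \<open>p\<close> of the function \<open>f\<close> along the anchor of \<open>v\<close>.
  The bracket is relevant on smooth sections only.
\<close>

record ('m, 'e, 'v) algebroid_data =
  atlas :: "('m set \<times> ('m \<Rightarrow> 'e)) set"
  rnk :: nat
  fibre :: "'m \<Rightarrow> 'v set"
  frames :: "('m set \<times> (nat \<Rightarrow> 'm \<Rightarrow> 'v)) set"
  anchor :: "'m \<Rightarrow> 'v \<Rightarrow> ('m \<Rightarrow> real) \<Rightarrow> real"
  bracket :: "('m \<Rightarrow> 'v) \<Rightarrow> ('m \<Rightarrow> 'v) \<Rightarrow> ('m \<Rightarrow> 'v)"

type_synonym ('m, 'v) covector_field = "'m \<Rightarrow> 'v \<Rightarrow> real"
type_synonym ('m, 'v) two_form = "'m \<Rightarrow> 'v \<Rightarrow> 'v \<Rightarrow> real"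
type_synonym ('m, 'v) bivector = "'m \<Rightarrow> ('v \<Rightarrow> real) \<Rightarrow> ('v \<Rightarrow> real) \<Rightarrow> real"
type_synonym ('m, 'v) trivector =
  "'m \<Rightarrow> ('v \<Rightarrow> real) \<Rightarrow> ('v \<Rightarrow> real) \<Rightarrow> ('v \<Rightarrow> real) \<Rightarrow> real"

definition smooth_atlas ::
  "('m::{t2_space, second_countable_topology} set \<times> ('m \<Rightarrow> 'e::real_inner)) set \<Rightarrow> bool" where
  "smooth_atlas \<A> \<longleftrightarrow>
     (\<exists>B :: 'e set. finite B \<and> span B = UNIV) \<and>
     (\<Union>(U, \<phi>)\<in>\<A>. U) = UNIV \<and>
     (\<forall>(U, \<phi>)\<in>\<A>. open U \<and> open (\<phi> ` U) \<and> inj_on \<phi> U \<and>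
        homeomorphism U (\<phi> ` U) \<phi> (inv_into U \<phi>)) \<and>
     (\<forall>(U, \<phi>)\<in>\<A>. \<forall>(V, \<psi>)\<in>\<A>. smooth_map_on (\<phi> ` (U \<inter> V)) (\<psi> \<circ> inv_into U \<phi>))"

definition smooth_fun_on ::
  "('m::{t2_space, second_countable_topology}, 'e::real_inner, 'v::real_vector) algebroid_data
   \<Rightarrow> 'm set \<Rightarrow> ('m \<Rightarrow> real) \<Rightarrow> bool" where
  "smooth_fun_on A W f \<longleftrightarrow>
     (\<forall>(U, \<phi>)\<in>atlas A. smooth_map_on (\<phi> ` (U \<inter> W)) (f \<circ> inv_into U \<phi>))"

definition smooth_funs ::
  "('m::{t2_space, second_countable_topology}, 'e::real_inner, 'v::real_vector) algebroid_data
   \<Rightarrow> ('m \<Rightarrow> real) set" where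
  "smooth_funs A = {f. smooth_fun_on A UNIV f}"

definition smooth_section_on ::
  "('m::{t2_space, second_countable_topology}, 'e::real_inner, 'v::real_vector) algebroid_data
   \<Rightarrow> 'm set \<Rightarrow> ('m \<Rightarrow> 'v) \<Rightarrow> bool" where
  "smooth_section_on A W s \<longleftrightarrow>
     (\<forall>p\<in>W. s p \<in> fibre A p) \<and>
     (\<forall>(U, e)\<in>frames A. \<exists>c. (\<forall>i<rnk A. smooth_fun_on A (U \<inter> W) (c i)) \<and>
        (\<forall>q\<in>U \<inter> W. s q = (\<Sum>i<rnk A. c i q *\<^sub>R e i q)))"

definition sections ::
  "('m::{t2_space, second_countable_topology}, 'e::real_inner, 'v::real_vector) algebroid_data
   \<Rightarrow> ('m \<Rightarrow> 'v) set" where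
  "sections A = {s. smooth_section_on A UNIV s}"

definition vector_bundle ::
  "('m::{t2_space, second_countable_topology}, 'e::real_inner, 'v::real_vector) algebroid_data
   \<Rightarrow> bool" where
  "vector_bundle A \<longleftrightarrow>
     smooth_atlas (atlas A) \<and>
     (\<Union>(U, e)\<in>frames A. U) = UNIV \<and>
     (\<forall>(U, e)\<in>frames A. open U \<and>
        (\<forall>p\<in>U. inj_on (\<lambda>i. e i p) {..<rnk A} \<and> independent ((\<lambda>i. e i p) ` {..<rnk A}) \<and>
           span ((\<lambda>i. e i p) ` {..<rnk A}) = fibre A p) \<and>
        (\<forall>i<rnk A. smooth_section_on A U (e i)))"

definition tangent_space ::
  "('m::{t2_space, second_countable_topology}, 'e::real_inner, 'v::real_vector) algebroid_data
   \<Rightarrow> 'm \<Rightarrow> (('m \<Rightarrow> real) \<Rightarrow> real) set" where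
  "tangent_space A p = {D. \<forall>f\<in>smooth_funs A. \<forall>g\<in>smooth_funs A.
     D (\<lambda>q. f q + g q) = D f + D g \<and> (\<forall>c. D (\<lambda>q. c * f q) = c * D f) \<and>
     D (\<lambda>q. f q * g q) = f p * D g + g p * D f}"

definition lie_algebroid ::
  "('m::{t2_space, second_countable_topology}, 'e::real_inner, 'v::real_vector) algebroid_data
   \<Rightarrow> bool" where
  "lie_algebroid A \<longleftrightarrow>
     vector_bundle A \<and>
     \<comment> \<open>the anchor is a morphism of vector bundles from \<open>A\<close> to \<open>TM\<close>\<close>
     (\<forall>p. \<forall>u\<in>fibre A p. \<forall>v\<in>fibre A p. anchor A p u \<in> tangent_space A p \<and>
        (\<forall>f\<in>smooth_funs A. anchor A p (u + v) f = anchor A p u f + anchor A p v f \<and>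
           (\<forall>c. anchor A p (c *\<^sub>R u) f = c * anchor A p u f))) \<and>
     (\<forall>X\<in>sections A. \<forall>f\<in>smooth_funs A. (\<lambda>p. anchor A p (X p) f) \<in> smooth_funs A) \<and>
     (\<forall>X\<in>sections A. \<forall>Y\<in>sections A. bracket A X Y \<in> sections A) \<and>
     (\<forall>X\<in>sections A. \<forall>Y\<in>sections A. \<forall>Z\<in>sections A.
        bracket A (\<lambda>p. X p + Y p) Z = (\<lambda>p. bracket A X Z p + bracket A Y Z p)) \<and>
     (\<forall>X\<in>sections A. \<forall>Y\<in>sections A. \<forall>c.
        bracket A (\<lambda>p. c *\<^sub>R X p) Y = (\<lambda>p. c *\<^sub>R bracket A X Y p)) \<and>
     (\<forall>X\<in>sections A. \<forall>Y\<in>sections A. bracket A X Y = (\<lambda>p. - bracket A Y X p)) \<and>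
     (\<forall>X\<in>sections A. \<forall>Y\<in>sections A. \<forall>Z\<in>sections A. \<forall>p.
        bracket A X (bracket A Y Z) p + bracket A Y (bracket A Z X) p
          + bracket A Z (bracket A X Y) p = 0) \<and>
     (\<forall>X\<in>sections A. \<forall>Y\<in>sections A. \<forall>f\<in>smooth_funs A.
        bracket A X (\<lambda>p. f p *\<^sub>R Y p)
          = (\<lambda>p. f p *\<^sub>R bracket A X Y p + anchor A p (X p) f *\<^sub>R Y p))"


section \<open>Forms and bivectors\<close>

text \<open>Linear functionals on a subspace \<open>V\<close> are extended by 0 outside \<open>V\<close>, so that equality of
  functions is equality of functionals; the same convention is used for bilinear forms.\<close>

definition dual_space :: "'v::real_vector set \<Rightarrow> ('v \<Rightarrow> real) set" where
  "dual_space V = {\<xi>. (\<forall>x\<in>V. \<forall>y\<in>V. \<xi> (x + y) = \<xi> x + \<xi> y) \<and>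
     (\<forall>c. \<forall>x\<in>V. \<xi> (c *\<^sub>R x) = c * \<xi> x) \<and> (\<forall>x. x \<notin> V \<longrightarrow> \<xi> x = 0)}"

definition alternating_forms :: "'v::real_vector set \<Rightarrow> ('v \<Rightarrow> 'v \<Rightarrow> real) set" where
  "alternating_forms V = {\<omega>. (\<forall>x. \<omega> x \<in> dual_space V) \<and>
     (\<forall>y. (\<lambda>x. \<omega> x y) \<in> dual_space V) \<and> (\<forall>x. \<omega> x x = 0)}"

abbreviation dual_fibre ::
  "('m::{t2_space, second_countable_topology}, 'e::real_inner, 'v::real_vector) algebroid_data
   \<Rightarrow> 'm \<Rightarrow> ('v \<Rightarrow> real) set" where
  "dual_fibre A p \<equiv> dual_space (fibre A p)"

definition smooth_cosection_on ::
  "('m::{t2_space, second_countable_topology}, 'e::real_inner, 'v::real_vector) algebroid_data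
   \<Rightarrow> 'm set \<Rightarrow> ('m, 'v) covector_field \<Rightarrow> bool" where
  "smooth_cosection_on A W \<alpha> \<longleftrightarrow>
     (\<forall>p\<in>W. \<alpha> p \<in> dual_fibre A p) \<and>
     (\<forall>(U, e)\<in>frames A. \<forall>i<rnk A. smooth_fun_on A (U \<inter> W) (\<lambda>p. \<alpha> p (e i p)))"

definition cosections ::
  "('m::{t2_space, second_countable_topology}, 'e::real_inner, 'v::real_vector) algebroid_data
   \<Rightarrow> ('m, 'v) covector_field set" where
  "cosections A = {\<alpha>. smooth_cosection_on A UNIV \<alpha>}"

definition two_forms ::
  "('m::{t2_space, second_countable_topology}, 'e::real_inner, 'v::real_vector) algebroid_data
   \<Rightarrow> ('m, 'v) two_form set" where
  "two_forms A = {\<omega>. (\<forall>p. \<omega> p \<in> alternating_forms (fibre A p)) \<and>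
     (\<forall>(U, e)\<in>frames A. \<forall>i<rnk A. \<forall>j<rnk A. smooth_fun_on A U (\<lambda>p. \<omega> p (e i p) (e j p)))}"

text \<open>Elements of \<open>\<and>\<^sup>2 A\<^sub>p\<close> are regarded as alternating bilinear forms on the dual of \<open>A\<^sub>p\<close>
  (extended by 0).  The last clause gives both bilinearity and smoothness: locally the field is
  \<open>\<Sum> c i j e i \<otimes> e j\<close> with smooth coefficients.\<close>

definition bivectors ::
  "('m::{t2_space, second_countable_topology}, 'e::real_inner, 'v::real_vector) algebroid_data
   \<Rightarrow> ('m, 'v) bivector set" where
  "bivectors A = {P.
     (\<forall>p \<xi> \<eta>. \<xi> \<notin> dual_fibre A p \<or> \<eta> \<notin> dual_fibre A p \<longrightarrow> P p \<xi> \<eta> = 0) \<and>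
     (\<forall>p. \<forall>\<xi>\<in>dual_fibre A p. P p \<xi> \<xi> = 0) \<and>
     (\<forall>(U, e)\<in>frames A. \<exists>c. (\<forall>i<rnk A. \<forall>j<rnk A. smooth_fun_on A U (c i j)) \<and>
        (\<forall>p\<in>U. \<forall>\<xi>\<in>dual_fibre A p. \<forall>\<eta>\<in>dual_fibre A p.
           P p \<xi> \<eta> = (\<Sum>i<rnk A. \<Sum>j<rnk A. c i j p * \<xi> (e i p) * \<eta> (e j p))))}"

text \<open>\<open>\<omega> x = - i\<^sub>x \<omega>\<close>\<close>

definition flat :: "('m, 'v) two_form \<Rightarrow> 'm \<Rightarrow> 'v \<Rightarrow> 'v \<Rightarrow> real" where
  "flat \<omega> p x = (\<lambda>y. - \<omega> p x y)"

text \<open>\<open>\<pi> \<xi> = i\<^sub>\<xi> \<pi>\<close>, the vector \<open>x\<close> with \<open>\<eta> x = \<pi> \<xi> \<eta>\<close> for all \<open>\<eta>\<close>\<close>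

definition sharp ::
  "('m::{t2_space, second_countable_topology}, 'e::real_inner, 'v::real_vector) algebroid_data
   \<Rightarrow> ('m, 'v) bivector \<Rightarrow> 'm \<Rightarrow> ('v \<Rightarrow> real) \<Rightarrow> 'v" where
  "sharp A P p \<xi> = (THE x. x \<in> fibre A p \<and> (\<forall>\<eta>\<in>dual_fibre A p. \<eta> x = P p \<xi> \<eta>))"

definition nondegenerate_form ::
  "('m::{t2_space, second_countable_topology}, 'e::real_inner, 'v::real_vector) algebroid_data
   \<Rightarrow> ('m, 'v) two_form \<Rightarrow> bool" where
  "nondegenerate_form A \<omega> \<longleftrightarrow> (\<forall>p. bij_betw (flat \<omega> p) (fibre A p) (dual_fibre A p))"

definition nondegenerate_bivector ::
  "('m::{t2_space, second_countable_topology}, 'e::real_inner, 'v::real_vector) algebroid_data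
   \<Rightarrow> ('m, 'v) bivector \<Rightarrow> bool" where
  "nondegenerate_bivector A P \<longleftrightarrow> (\<forall>p. bij_betw (sharp A P p) (dual_fibre A p) (fibre A p))"

text \<open>The bivector whose bundle map is the inverse of the bundle map of \<open>\<omega>\<close>\<close>

definition inverse_bivector ::
  "('m::{t2_space, second_countable_topology}, 'e::real_inner, 'v::real_vector) algebroid_data
   \<Rightarrow> ('m, 'v) two_form \<Rightarrow> ('m, 'v) bivector" where
  "inverse_bivector A \<omega> p \<xi> \<eta> =
     (if \<xi> \<in> dual_fibre A p \<and> \<eta> \<in> dual_fibre A p
      then \<eta> (the_inv_into (fibre A p) (flat \<omega> p) \<xi>) else 0)"


section \<open>Differential and Schouten--Nijenhuis bracket\<close>

text \<open>The Lie algebroid differential in degrees 1 and 2; here forms are evaluated on sections.\<close>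

definition diff_form1 ::
  "('m::{t2_space, second_countable_topology}, 'e::real_inner, 'v::real_vector) algebroid_data
   \<Rightarrow> ('m, 'v) covector_field \<Rightarrow> ('m \<Rightarrow> 'v) \<Rightarrow> ('m \<Rightarrow> 'v) \<Rightarrow> 'm \<Rightarrow> real" where
  "diff_form1 A \<xi> X Y p =
     anchor A p (X p) (\<lambda>q. \<xi> q (Y q)) - anchor A p (Y p) (\<lambda>q. \<xi> q (X q)) - \<xi> p (bracket A X Y p)"

definition diff_form2 ::
  "('m::{t2_space, second_countable_topology}, 'e::real_inner, 'v::real_vector) algebroid_data
   \<Rightarrow> ('m, 'v) two_form \<Rightarrow> ('m \<Rightarrow> 'v) \<Rightarrow> ('m \<Rightarrow> 'v) \<Rightarrow> ('m \<Rightarrow> 'v) \<Rightarrow> 'm \<Rightarrow> real" where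
  "diff_form2 A \<omega> X Y Z p =
     anchor A p (X p) (\<lambda>q. \<omega> q (Y q) (Z q)) - anchor A p (Y p) (\<lambda>q. \<omega> q (X q) (Z q))
     + anchor A p (Z p) (\<lambda>q. \<omega> q (X q) (Y q))
     - \<omega> p (bracket A X Y p) (Z p) + \<omega> p (bracket A X Z p) (Y p) - \<omega> p (bracket A Y Z p) (X p)"

definition presymplectic ::
  "('m::{t2_space, second_countable_topology}, 'e::real_inner, 'v::real_vector) algebroid_data
   \<Rightarrow> ('m, 'v) two_form \<Rightarrow> bool" where
  "presymplectic A \<omega> \<longleftrightarrow> \<omega> \<in> two_forms A \<and>
     (\<forall>X\<in>sections A. \<forall>Y\<in>sections A. \<forall>Z\<in>sections A. \<forall>p. diff_form2 A \<omega> X Y Z p = 0)"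

definition wedge2 :: "'v \<Rightarrow> 'v \<Rightarrow> ('v \<Rightarrow> real) \<Rightarrow> ('v \<Rightarrow> real) \<Rightarrow> real" where
  "wedge2 x y \<alpha> \<beta> = \<alpha> x * \<beta> y - \<alpha> y * \<beta> x"

definition wedge3 ::
  "'v \<Rightarrow> 'v \<Rightarrow> 'v \<Rightarrow> ('v \<Rightarrow> real) \<Rightarrow> ('v \<Rightarrow> real) \<Rightarrow> ('v \<Rightarrow> real) \<Rightarrow> real" where
  "wedge3 x y z \<alpha> \<beta> \<gamma> = \<alpha> x * wedge2 y z \<beta> \<gamma> - \<alpha> y * wedge2 x z \<beta> \<gamma> + \<alpha> z * wedge2 x y \<beta> \<gamma>"

text \<open>\<open>P = \<Sum>i<n. X i \<and> Y i\<close> over the open set \<open>U\<close>\<close>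

definition decomposes_on ::
  "('m::{t2_space, second_countable_topology}, 'e::real_inner, 'v::real_vector) algebroid_data
   \<Rightarrow> 'm set \<Rightarrow> ('m, 'v) bivector \<Rightarrow> nat \<Rightarrow> (nat \<Rightarrow> 'm \<Rightarrow> 'v) \<Rightarrow> (nat \<Rightarrow> 'm \<Rightarrow> 'v) \<Rightarrow> bool" where
  "decomposes_on A U P n X Y \<longleftrightarrow>
     (\<forall>i<n. X i \<in> sections A \<and> Y i \<in> sections A) \<and>
     (\<forall>q\<in>U. \<forall>\<alpha>\<in>dual_fibre A q. \<forall>\<beta>\<in>dual_fibre A q.
        P q \<alpha> \<beta> = (\<Sum>i<n. wedge2 (X i q) (Y i q) \<alpha> \<beta>))"

text \<open>\<open>[X\<^sub>1 \<and> X\<^sub>2, Y\<^sub>1 \<and> Y\<^sub>2] = \<Sum> (-1)\<^sup>i\<^sup>+\<^sup>j [X\<^sub>i, Y\<^sub>j] \<and> X\<^sub>k \<and> Y\<^sub>l\<close>, where \<open>{i, k} = {j, l} = {1, 2}\<close>\<close>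

definition decomposable_bracket ::
  "('m::{t2_space, second_countable_topology}, 'e::real_inner, 'v::real_vector) algebroid_data
   \<Rightarrow> ('m \<Rightarrow> 'v) \<Rightarrow> ('m \<Rightarrow> 'v) \<Rightarrow> ('m \<Rightarrow> 'v) \<Rightarrow> ('m \<Rightarrow> 'v) \<Rightarrow> ('m, 'v) trivector" where
  "decomposable_bracket A X1 X2 Y1 Y2 p \<alpha> \<beta> \<gamma> =
     wedge3 (bracket A X1 Y1 p) (X2 p) (Y2 p) \<alpha> \<beta> \<gamma> - wedge3 (bracket A X1 Y2 p) (X2 p) (Y1 p) \<alpha> \<beta> \<gamma>
     - wedge3 (bracket A X2 Y1 p) (X1 p) (Y2 p) \<alpha> \<beta> \<gamma> + wedge3 (bracket A X2 Y2 p) (X1 p) (Y1 p) \<alpha> \<beta> \<gamma>"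

text \<open>The bracket of bivectors is the local, biadditive extension of the bracket of decomposable ones.
  Its value at \<open>p\<close> is computed from any decompositions of \<open>P\<close> and \<open>Q\<close> near \<open>p\<close>; it does not depend
  on their choice.\<close>

definition schouten_bracket ::
  "('m::{t2_space, second_countable_topology}, 'e::real_inner, 'v::real_vector) algebroid_data
   \<Rightarrow> ('m, 'v) bivector \<Rightarrow> ('m, 'v) bivector \<Rightarrow> ('m, 'v) trivector" where
  "schouten_bracket A P Q p \<alpha> \<beta> \<gamma> =
     (if \<alpha> \<in> dual_fibre A p \<and> \<beta> \<in> dual_fibre A p \<and> \<gamma> \<in> dual_fibre A p then
        (THE t. \<exists>U n m X1 X2 Y1 Y2. open U \<and> p \<in> U \<and>
           decomposes_on A U P n X1 X2 \<and> decomposes_on A U Q m Y1 Y2 \<and>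
           t = (\<Sum>i<n. \<Sum>j<m. decomposable_bracket A (X1 i) (X2 i) (Y1 j) (Y2 j) p \<alpha> \<beta> \<gamma>))
      else 0)"

definition poisson_bivector ::
  "('m::{t2_space, second_countable_topology}, 'e::real_inner, 'v::real_vector) algebroid_data
   \<Rightarrow> ('m, 'v) bivector \<Rightarrow> bool" where
  "poisson_bivector A P \<longleftrightarrow> P \<in> bivectors A \<and> schouten_bracket A P P = (\<lambda>p \<alpha> \<beta> \<gamma>. 0)"


section \<open>Dirac structures\<close>

text \<open>A family of fibrewise subsets of \<open>A \<oplus> A\<^sup>*\<close> is given by its fibres \<open>L p\<close>.\<close>

definition is_subspace_at ::
  "('m::{t2_space, second_countable_topology}, 'e::real_inner, 'v::real_vector) algebroid_data
   \<Rightarrow> 'm \<Rightarrow> ('v \<times> ('v \<Rightarrow> real)) set \<Rightarrow> bool" where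
  "is_subspace_at A p W \<longleftrightarrow>
     W \<subseteq> fibre A p \<times> dual_fibre A p \<and> (0, \<lambda>v. 0) \<in> W \<and>
     (\<forall>(x, \<xi>)\<in>W. \<forall>(y, \<eta>)\<in>W. (x + y, \<lambda>v. \<xi> v + \<eta> v) \<in> W) \<and>
     (\<forall>c. \<forall>(x, \<xi>)\<in>W. (c *\<^sub>R x, \<lambda>v. c * \<xi> v) \<in> W)"

definition pairing :: "'v \<times> ('v \<Rightarrow> real) \<Rightarrow> 'v \<times> ('v \<Rightarrow> real) \<Rightarrow> real" where
  "pairing a b = snd a (fst b) + snd b (fst a)"

definition isotropic_at ::
  "('m::{t2_space, second_countable_topology}, 'e::real_inner, 'v::real_vector) algebroid_data
   \<Rightarrow> 'm \<Rightarrow> ('v \<times> ('v \<Rightarrow> real)) set \<Rightarrow> bool" where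
  "isotropic_at A p W \<longleftrightarrow> is_subspace_at A p W \<and> (\<forall>a\<in>W. \<forall>b\<in>W. pairing a b = 0)"

definition maximally_isotropic_at ::
  "('m::{t2_space, second_countable_topology}, 'e::real_inner, 'v::real_vector) algebroid_data
   \<Rightarrow> 'm \<Rightarrow> ('v \<times> ('v \<Rightarrow> real)) set \<Rightarrow> bool" where
  "maximally_isotropic_at A p W \<longleftrightarrow>
     isotropic_at A p W \<and> (\<forall>W'. isotropic_at A p W' \<and> W \<subseteq> W' \<longrightarrow> W' = W)"

text \<open>Smooth subbundles: near every point, \<open>L\<close> has a smooth frame \<open>(s i, \<sigma> i)\<close>, \<open>i < r\<close>.\<close>

definition subbundle ::
  "('m::{t2_space, second_countable_topology}, 'e::real_inner, 'v::real_vector) algebroid_data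
   \<Rightarrow> ('m \<Rightarrow> ('v \<times> ('v \<Rightarrow> real)) set) \<Rightarrow> bool" where
  "subbundle A L \<longleftrightarrow>
     (\<forall>p. \<exists>U r s \<sigma>. open U \<and> p \<in> U \<and>
        (\<forall>i<r. smooth_section_on A U (s i) \<and> smooth_cosection_on A U (\<sigma> i)) \<and>
        (\<forall>q\<in>U. L q = {(\<Sum>i<r. c i *\<^sub>R s i q, \<lambda>v. \<Sum>i<r. c i * \<sigma> i q v) | c :: nat \<Rightarrow> real. True} \<and>
           (\<forall>c :: nat \<Rightarrow> real. (\<Sum>i<r. c i *\<^sub>R s i q) = 0 \<and> (\<lambda>v. \<Sum>i<r. c i * \<sigma> i q v) = (\<lambda>v. 0)
              \<longrightarrow> (\<forall>i<r. c i = 0))))"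

definition subbundle_sections ::
  "('m::{t2_space, second_countable_topology}, 'e::real_inner, 'v::real_vector) algebroid_data
   \<Rightarrow> ('m \<Rightarrow> ('v \<times> ('v \<Rightarrow> real)) set) \<Rightarrow> (('m \<Rightarrow> 'v) \<times> ('m, 'v) covector_field) set" where
  "subbundle_sections A L =
     {(X, \<xi>). X \<in> sections A \<and> \<xi> \<in> cosections A \<and> (\<forall>p. (X p, \<xi> p) \<in> L p)}"

definition lie_derivative ::
  "('m::{t2_space, second_countable_topology}, 'e::real_inner, 'v::real_vector) algebroid_data
   \<Rightarrow> ('m \<Rightarrow> 'v) \<Rightarrow> ('m, 'v) covector_field \<Rightarrow> ('m \<Rightarrow> 'v) \<Rightarrow> 'm \<Rightarrow> real" where
  "lie_derivative A X \<eta> Z p = anchor A p (X p) (\<lambda>q. \<eta> q (Z q)) - \<eta> p (bracket A X Z p)"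

text \<open>The second component is the section \<open>\<zeta> = \<L>\<^sub>X \<eta> - i\<^sub>Y (d\<xi>)\<close> of \<open>A\<^sup>*\<close>, described by its values
  on the sections of \<open>A\<close>.\<close>

definition dorfman_bracket ::
  "('m::{t2_space, second_countable_topology}, 'e::real_inner, 'v::real_vector) algebroid_data
   \<Rightarrow> ('m \<Rightarrow> 'v) \<times> ('m, 'v) covector_field \<Rightarrow> ('m \<Rightarrow> 'v) \<times> ('m, 'v) covector_field
   \<Rightarrow> ('m \<Rightarrow> 'v) \<times> ('m, 'v) covector_field" where
  "dorfman_bracket A = (\<lambda>(X, \<xi>) (Y, \<eta>).
     (bracket A X Y,
      THE \<zeta>. \<zeta> \<in> cosections A \<and>
        (\<forall>Z\<in>sections A. \<forall>p. \<zeta> p (Z p) = lie_derivative A X \<eta> Z p - diff_form1 A \<xi> Y Z p)))"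

definition dirac_structure ::
  "('m::{t2_space, second_countable_topology}, 'e::real_inner, 'v::real_vector) algebroid_data
   \<Rightarrow> ('m \<Rightarrow> ('v \<times> ('v \<Rightarrow> real)) set) \<Rightarrow> bool" where
  "dirac_structure A L \<longleftrightarrow>
     subbundle A L \<and> (\<forall>p. maximally_isotropic_at A p (L p)) \<and>
     (\<forall>a\<in>subbundle_sections A L. \<forall>b\<in>subbundle_sections A L.
        dorfman_bracket A a b \<in> subbundle_sections A L)"

definition form_graph ::
  "('m::{t2_space, second_countable_topology}, 'e::real_inner, 'v::real_vector) algebroid_data
   \<Rightarrow> ('m, 'v) two_form \<Rightarrow> 'm \<Rightarrow> ('v \<times> ('v \<Rightarrow> real)) set" where
  "form_graph A \<omega> p = {(x, flat \<omega> p x) | x. x \<in> fibre A p}"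


section \<open>Nijenhuis relations and pairs\<close>

definition dual_relation ::
  "('m::{t2_space, second_countable_topology}, 'e::real_inner, 'v::real_vector) algebroid_data
   \<Rightarrow> (('m \<Rightarrow> 'v) \<times> ('m \<Rightarrow> 'v)) set
   \<Rightarrow> (('m, 'v) covector_field \<times> ('m, 'v) covector_field) set" where
  "dual_relation A N = {(\<beta>, \<alpha>). \<beta> \<in> cosections A \<and> \<alpha> \<in> cosections A \<and>
     (\<forall>(u, v)\<in>N. \<forall>p. \<alpha> p (u p) = \<beta> p (v p))}"

definition nijenhuis_relation ::
  "('m::{t2_space, second_countable_topology}, 'e::real_inner, 'v::real_vector) algebroid_data
   \<Rightarrow> (('m \<Rightarrow> 'v) \<times> ('m \<Rightarrow> 'v)) set \<Rightarrow> bool" where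
  "nijenhuis_relation A N \<longleftrightarrow>
     (\<forall>u1 v1 u2 v2 \<alpha> \<alpha>' \<alpha>''.
        (u1, v1) \<in> N \<and> (u2, v2) \<in> N \<and>
        (\<alpha>, \<alpha>') \<in> dual_relation A N \<and> (\<alpha>', \<alpha>'') \<in> dual_relation A N \<longrightarrow>
        (\<forall>p. \<alpha> p (bracket A v1 v2 p) - \<alpha>' p (bracket A v1 u2 p + bracket A u1 v2 p)
             + \<alpha>'' p (bracket A u1 u2 p) = 0))"

definition dirac_relation ::
  "('m::{t2_space, second_countable_topology}, 'e::real_inner, 'v::real_vector) algebroid_data
   \<Rightarrow> ('m \<Rightarrow> ('v \<times> ('v \<Rightarrow> real)) set) \<Rightarrow> ('m \<Rightarrow> ('v \<times> ('v \<Rightarrow> real)) set)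
   \<Rightarrow> (('m \<Rightarrow> 'v) \<times> ('m \<Rightarrow> 'v)) set" where
  "dirac_relation A L L' = {(x, y). x \<in> sections A \<and> y \<in> sections A \<and>
     (\<exists>\<xi>\<in>cosections A. (x, \<xi>) \<in> subbundle_sections A L' \<and> (y, \<xi>) \<in> subbundle_sections A L)}"

definition dirac_pair ::
  "('m::{t2_space, second_countable_topology}, 'e::real_inner, 'v::real_vector) algebroid_data
   \<Rightarrow> ('m \<Rightarrow> ('v \<times> ('v \<Rightarrow> real)) set) \<Rightarrow> ('m \<Rightarrow> ('v \<times> ('v \<Rightarrow> real)) set) \<Rightarrow> bool" where
  "dirac_pair A L L' \<longleftrightarrow>
     dirac_structure A L \<and> dirac_structure A L' \<and> nijenhuis_relation A (dirac_relation A L L')"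

definition presymplectic_pair ::
  "('m::{t2_space, second_countable_topology}, 'e::real_inner, 'v::real_vector) algebroid_data
   \<Rightarrow> ('m, 'v) two_form \<Rightarrow> ('m, 'v) two_form \<Rightarrow> bool" where
  "presymplectic_pair A \<omega> \<omega>' \<longleftrightarrow>
     presymplectic A \<omega> \<and> presymplectic A \<omega>' \<and> dirac_pair A (form_graph A \<omega>) (form_graph A \<omega>')"

definition symplectic_pairs ::
  "('m::{t2_space, second_countable_topology}, 'e::real_inner, 'v::real_vector) algebroid_data
   \<Rightarrow> (('m, 'v) two_form \<times> ('m, 'v) two_form) set" where
  "symplectic_pairs A = {(\<omega>, \<omega>'). presymplectic_pair A \<omega> \<omega>' \<and>
     nondegenerate_form A \<omega> \<and> nondegenerate_form A \<omega>'}"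

definition poisson_relation ::
  "('m::{t2_space, second_countable_topology}, 'e::real_inner, 'v::real_vector) algebroid_data
   \<Rightarrow> ('m, 'v) bivector \<Rightarrow> ('m, 'v) bivector \<Rightarrow> (('m \<Rightarrow> 'v) \<times> ('m \<Rightarrow> 'v)) set" where
  "poisson_relation A P P' =
     {(\<lambda>p. sharp A P' p (\<xi> p), \<lambda>p. sharp A P p (\<xi> p)) | \<xi>. \<xi> \<in> cosections A}"

definition nondegenerate_poisson_pairs ::
  "('m::{t2_space, second_countable_topology}, 'e::real_inner, 'v::real_vector) algebroid_data
   \<Rightarrow> (('m, 'v) bivector \<times> ('m, 'v) bivector) set" where
  "nondegenerate_poisson_pairs A = {(P, P').
     poisson_bivector A P \<and> poisson_bivector A P' \<and>
     nondegenerate_bivector A P \<and> nondegenerate_bivector A P' \<and>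
     nijenhuis_relation A (poisson_relation A P P')}"

end

theory Submission
  imports Defs "Jordan_Normal_Form.Determinant"
begin

text \<open>
  A non-degenerate form \<open>\<omega>\<close> and the bivector \<open>\<pi>\<close> with the inverse bundle map determine each other, and
  smoothness is preserved by Cramer's rule.  For sections \<open>x\<close>, \<open>y\<close>, \<open>z\<close> with images \<open>\<alpha>\<close>, \<open>\<beta>\<close>, \<open>\<gamma>\<close>
  under \<open>\<omega>\<close> one has \<open>[\<pi>, \<pi>](\<alpha>, \<beta>, \<gamma>) = - 2 d\<omega>(x, y, z)\<close>: write \<open>\<pi> = \<Sum> X\<^sub>i \<and> Y\<^sub>i\<close> near a point, so
  that \<open>x = \<Sum> i\<^sub>\<alpha>(X\<^sub>i \<and> Y\<^sub>i)\<close> there, and expand both sides by the Leibniz rules.  The same computation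
  shows that the value of the Schouten bracket is independent of the decompositions.  As every vector
  extends to a global section (bump functions), \<open>\<pi>\<close> is Poisson if and only if \<open>\<omega>\<close> is closed.  Finally
  the relation \<open>\<omega>' x = \<omega> y\<close> defined by the graphs of \<open>\<omega>\<close> and \<open>\<omega>'\<close> is \<open>{(\<pi>'\<xi>, \<pi>\<xi>)}\<close>, and the graph
  of a closed form is a Dirac structure, so both notions of pair impose the same Nijenhuis condition.
\<close>

section \<open>Calculus of smooth functions\<close>

text \<open>The factor -2 arises because the Schouten formula treats its two arguments alike, while
  an expansion of d\<omega> does not. Let one decomposition supply the first entry of each Lie
  bracket and the direction of each derivative, and another supply the second entry and the function
  that is differentiated. Then d\<omega> is a double sum over pairs of summands, and the bracket of
  such a pair is minus the sum of its two orderings. Only in this symmetrized sum do all derivative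
  terms cancel; each ordering then contributes one d\<omega>.

  The obstacle is locality. Decompositions consist of global sections but represent the bivector
  only near a point, whereas anchor and bracket act on global functions and sections. Bump functions
  therefore serve twice: they produce the decompositions, and through the Leibniz rules they show
  that anchor and bracket see only what happens near the point. Since fibres carry no topology,
  smoothness of a section is a statement about its coefficients in frames, which is why inverting a
  bundle map smoothly becomes a linear system with smooth coefficients.\<close>

lemma Ck_on_cong:
  assumes "open S" "Ck_on k S f" "\<And>x. x \<in> S \<Longrightarrow> f x = g x"
  shows "Ck_on k S g"
proof (cases k)
  case 0
  then show ?thesis using assms by (metis Ck_on.simps(1) continuous_on_cong)
next
  case (Suc n)
  then obtain f' where "\<And>x. x \<in> S \<Longrightarrow> (f has_derivative f' x) (at x)" "\<forall>v. Ck_on n S (\<lambda>x. f' x v)"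
    using assms(2) by auto
  \<comment> \<open>On an open set the derivative depends only on the values there, so
    \<open>g\<close> inherits the same field \<open>f'\<close>; a case split on \<open>k\<close>
    replaces an induction.\<close>
  moreover from this have "(g has_derivative f' x) (at x)" if "x \<in> S" for x
    using that assms(1,3) has_derivative_transform_within_open[of f _ _ UNIV S g] by blast
  ultimately show ?thesis using Suc by auto
qed

lemma Ck_on_subset: "Ck_on k S f \<Longrightarrow> T \<subseteq> S \<Longrightarrow> Ck_on k T f"
proof (induction k arbitrary: f)
  case 0
  then show ?case using continuous_on_subset by auto
next
  case (Suc k)
  then show ?case by (simp, meson subsetD)
qed

lemma Ck_on_Suc_imp: "Ck_on (Suc k) S f \<Longrightarrow> Ck_on k S f"
proof (induction k arbitrary: f)
  case 0
  then show ?case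
    by (auto intro!: continuous_at_imp_continuous_on dest!: bspec has_derivative_continuous)
next
  case (Suc k)
  from Suc.prems obtain f' where f': "\<forall>x\<in>S. (f has_derivative f' x) (at x)"
    "\<forall>v. Ck_on (Suc k) S (\<lambda>x. f' x v)" by (metis Ck_on.simps(2))
  then have "\<forall>v. Ck_on k S (\<lambda>x. f' x v)" using Suc.IH by blast
  with f'(1) show ?case by (metis Ck_on.simps(2))
qed

text \<open>Derivative fields found on different neighbourhoods agree, because the derivative at a
  point is unique; \<open>frechet_derivative\<close> names the glued field.\<close>

lemma Ck_on_local:
  assumes "\<And>x. x \<in> S \<Longrightarrow> \<exists>T. open T \<and> x \<in> T \<and> Ck_on k T f"
  shows "Ck_on k S f"
  using assms
proof (induction k arbitrary: f)
  case 0
  then have "isCont f x" if "x \<in> S" for x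
    using that continuous_on_eq_continuous_at by fastforce
  then show ?case by (simp add: continuous_at_imp_continuous_on)
next
  case (Suc k)
  define f' where "f' x = frechet_derivative f (at x)" for x
  have *: "\<exists>T. open T \<and> x \<in> T \<and> (\<forall>y\<in>T. (f has_derivative f' y) (at y)) \<and> (\<forall>v. Ck_on k T (\<lambda>y. f' y v))"
    if x: "x \<in> S" for x
  proof -
    obtain T g where T: "open T" "x \<in> T" "\<forall>y\<in>T. (f has_derivative g y) (at y)" "\<forall>v. Ck_on k T (\<lambda>y. g y v)"
      using Suc.prems[OF x] by auto
    then have eq: "g y = f' y" if "y \<in> T" for y
      unfolding f'_def using frechet_derivative_at that by blast
    then have "Ck_on k T (\<lambda>y. f' y v)" for v
      using Ck_on_cong[OF T(1), of k "\<lambda>y. g y v" "\<lambda>y. f' y v"] T(4) by auto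
    then show ?thesis using T eq by metis
  qed
  have "Ck_on k S (\<lambda>y. f' y v)" for v
    by (rule Suc.IH) (use * in meson)
  moreover have "\<forall>x\<in>S. (f has_derivative f' x) (at x)" using * by blast
  ultimately show ?case by auto
qed

lemma Ck_on_const [simp]: "Ck_on k S (\<lambda>x. c :: 'b::real_normed_vector)"
proof (induction k arbitrary: c)
  case (Suc k)
  then show ?case by (auto intro!: exI[of _ "\<lambda>_ _. 0"])
qed simp

lemma Ck_on_add: "Ck_on k S f \<Longrightarrow> Ck_on k S g \<Longrightarrow> Ck_on k S (\<lambda>x. f x + g x)"
proof (induction k arbitrary: f g)
  case 0
  then show ?case by (auto intro: continuous_on_add)
next
  case (Suc k)
  obtain f' g' where "\<forall>x\<in>S. (f has_derivative f' x) (at x)" "\<forall>v. Ck_on k S (\<lambda>x. f' x v)"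
    "\<forall>x\<in>S. (g has_derivative g' x) (at x)" "\<forall>v. Ck_on k S (\<lambda>x. g' x v)"
    using Suc.prems by (metis Ck_on.simps(2))
  then show ?case
    by (auto intro!: exI[of _ "\<lambda>x v. f' x v + g' x v"] Suc.IH has_derivative_add)
qed

text \<open>One induction serves both real multiplication and the inner product. The product rule
  mixes the derivatives with the factors themselves, which are used one order of differentiability
  lower.\<close>

lemma (in bounded_bilinear) Ck_on:
  "Ck_on k S f \<Longrightarrow> Ck_on k S g \<Longrightarrow> Ck_on k S (\<lambda>x. prod (f x) (g x))"
proof (induction k arbitrary: f g)
  case 0
  then show ?case by (auto intro: continuous_on)
next
  case (Suc k)
  have *: "Ck_on k S f" "Ck_on k S g" using Suc.prems Ck_on_Suc_imp by blast+
  obtain f' g' where "\<forall>x\<in>S. (f has_derivative f' x) (at x)" "\<forall>v. Ck_on k S (\<lambda>x. f' x v)"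
    "\<forall>x\<in>S. (g has_derivative g' x) (at x)" "\<forall>v. Ck_on k S (\<lambda>x. g' x v)"
    using Suc.prems by (metis Ck_on.simps(2))
  then show ?case using *
    by (auto intro!: exI[of _ "\<lambda>x v. prod (f x) (g' x v) + prod (f' x v) (g x)"] Ck_on_add Suc.IH FDERIV)
qed

lemmas Ck_on_mult = bounded_bilinear.Ck_on[OF bounded_bilinear_mult]
lemmas Ck_on_inner = bounded_bilinear.Ck_on[OF bounded_bilinear_inner]

lemma Ck_on_inverse:
  fixes u :: "'a::real_normed_vector \<Rightarrow> real"
  shows "Ck_on k S u \<Longrightarrow> \<forall>x\<in>S. u x \<noteq> 0 \<Longrightarrow> Ck_on k S (\<lambda>x. inverse (u x))"
proof (induction k arbitrary: u)
  case 0
  then show ?case by (auto intro: continuous_on_inverse)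
next
  case (Suc k)
  have *: "Ck_on k S (\<lambda>x. inverse (u x))" using Suc Ck_on_Suc_imp by blast
  obtain u' where "\<forall>x\<in>S. (u has_derivative u' x) (at x)" "\<forall>v. Ck_on k S (\<lambda>x. u' x v)"
    using Suc.prems by (metis Ck_on.simps(2))
  \<comment> \<open>The derivative is written as a plain product, with the sign as a factor
    \<open>-1\<close>, so that closure under products covers it.\<close>
  then show ?case using * Suc.prems(2)
    by (auto intro!: exI[of _ "\<lambda>x v. (-1) * (inverse (u x) * u' x v * inverse (u x))"] Ck_on_mult
        Ck_on_const derivative_eq_intros)
qed

text \<open>The derivatives of these functions are linear combinations of functions of the same family, so
  all of them are smooth.\<close>

definition exp_decay :: "nat \<Rightarrow> real \<Rightarrow> real" where
  "exp_decay n t = (if t > 0 then inverse t ^ n * exp (- inverse t) else 0)"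

text \<open>From the right, the substitution s = 1/t reduces this to s^n / exp s tending to 0 as s
  tends to infinity; on the left the function is 0.\<close>

lemma exp_decay_tendsto_0: "(exp_decay n \<longlongrightarrow> 0) (at 0)"
proof -
  have "((\<lambda>t. inverse t ^ n / exp (inverse t)) \<longlongrightarrow> 0) (at_right (0::real))"
    by (rule filterlim_compose[OF tendsto_power_div_exp_0 filterlim_inverse_at_top_right])
  then have "(exp_decay n \<longlongrightarrow> 0) (at_right 0)"
    by (rule Lim_transform_eventually)
       (auto simp: exp_decay_def exp_minus divide_inverse eventually_at_filter)
  moreover have "(exp_decay n \<longlongrightarrow> 0) (at_left 0)"
    by (rule tendsto_eventually) (auto simp: exp_decay_def eventually_at_filter)
  ultimately show ?thesis by (simp add: filterlim_split_at)
qed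

text \<open>Away from 0 this is the product rule. At 0 the right-hand side vanishes and the
  difference quotient of \<open>exp_decay n\<close> is \<open>exp_decay (Suc n)\<close>, which tends
  to 0.\<close>

lemma exp_decay_deriv:
  "(exp_decay n has_real_derivative (- real n * exp_decay (Suc n) t + exp_decay (Suc (Suc n)) t)) (at t)"
proof (cases t "0::real" rule: linorder_cases)
  case less
  show ?thesis
    by (rule has_field_derivative_transform_within_open[of "\<lambda>_. 0" _ _ "{..<0}"])
       (use less in \<open>auto simp: exp_decay_def\<close>)
next
  case greater
  have "((\<lambda>t. inverse t ^ n) has_real_derivative - (real n * inverse t ^ Suc n)) (at t)"
    using DERIV_power[OF DERIV_inverse[of t], of n] greater by (cases n) (auto simp: mult_ac)
  moreover have "((\<lambda>t. exp (- inverse t)) has_real_derivative exp (- inverse t) * inverse t ^ 2) (at t)"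
    using greater by (auto intro!: derivative_eq_intros simp: power2_eq_square)
  ultimately have "((\<lambda>t. inverse t ^ n * exp (- inverse t)) has_real_derivative
    (- real n * exp_decay (Suc n) t + exp_decay (Suc (Suc n)) t)) (at t)"
    using greater
    by (auto dest: DERIV_mult simp: exp_decay_def power2_eq_square mult_ac add_ac elim!: DERIV_cong)
  then show ?thesis
    by (rule has_field_derivative_transform_within_open[of _ _ _ "{0<..}"])
       (use greater in \<open>auto simp: exp_decay_def\<close>)
next
  case equal
  have "((\<lambda>h. (exp_decay n h - exp_decay n 0) / h) \<longlongrightarrow> 0) (at 0)"
    by (rule Lim_transform_eventually[OF exp_decay_tendsto_0[of "Suc n"]])
       (auto simp: exp_decay_def field_simps)
  then have "(exp_decay n has_real_derivative 0) (at 0)"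
    unfolding DERIV_def by simp
  then show ?thesis using equal by (simp add: exp_decay_def)
qed

lemma Ck_on_exp_decay: "Ck_on k S u \<Longrightarrow> Ck_on k S (\<lambda>x. exp_decay n (u x))"
proof (induction k arbitrary: u n)
  case 0
  have "continuous_on UNIV (exp_decay n)"
    using exp_decay_deriv DERIV_isCont continuous_at_imp_continuous_on by blast
  then show ?case using 0 continuous_on_compose2[of UNIV "exp_decay n" S u] by auto
next
  case (Suc k)
  have *: "Ck_on k S u" using Suc.prems Ck_on_Suc_imp by blast
  obtain u' where u': "\<forall>x\<in>S. (u has_derivative u' x) (at x)" "\<forall>v. Ck_on k S (\<lambda>x. u' x v)"
    using Suc.prems by (metis Ck_on.simps(2))
  have "((\<lambda>x. exp_decay n (u x)) has_derivative
      (\<lambda>v. (- real n * exp_decay (Suc n) (u x) + exp_decay (Suc (Suc n)) (u x)) * u' x v)) (at x)"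
    if "x \<in> S" for x
    using diff_chain_at[OF u'(1)[rule_format, OF that]
        exp_decay_deriv[unfolded has_field_derivative_def]]
    by (simp add: o_def)
  then show ?case using * u'
    by (auto intro!: exI[of _ "\<lambda>x v. (- real n * exp_decay (Suc n) (u x) + exp_decay (Suc (Suc n)) (u x)) * u' x v"]
        Ck_on_mult Ck_on_add Ck_on_const Suc.IH)
qed

lemma smooth_map_on_cong:
  "open S \<Longrightarrow> smooth_map_on S f \<Longrightarrow> (\<And>x. x \<in> S \<Longrightarrow> f x = g x) \<Longrightarrow> smooth_map_on S g"
  unfolding smooth_map_on_def by (meson Ck_on_cong)

lemma smooth_map_on_subset: "smooth_map_on S f \<Longrightarrow> T \<subseteq> S \<Longrightarrow> smooth_map_on T f"
  unfolding smooth_map_on_def using Ck_on_subset by blast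

lemma smooth_map_on_local:
  "(\<And>x. x \<in> S \<Longrightarrow> \<exists>T. open T \<and> x \<in> T \<and> smooth_map_on T f) \<Longrightarrow> smooth_map_on S f"
  unfolding smooth_map_on_def by (meson Ck_on_local)

lemma smooth_map_on_const [simp]: "smooth_map_on S (\<lambda>x. c)"
  by (simp add: smooth_map_on_def)

lemma smooth_map_on_add:
  "smooth_map_on S f \<Longrightarrow> smooth_map_on S g \<Longrightarrow> smooth_map_on S (\<lambda>x. f x + g x)"
  by (simp add: smooth_map_on_def Ck_on_add)

lemma smooth_map_on_mult:
  fixes f g :: "'a::real_normed_vector \<Rightarrow> real"
  shows "smooth_map_on S f \<Longrightarrow> smooth_map_on S g \<Longrightarrow> smooth_map_on S (\<lambda>x. f x * g x)"
  by (simp add: smooth_map_on_def Ck_on_mult)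

lemma smooth_map_on_inner:
  "smooth_map_on S f \<Longrightarrow> smooth_map_on S g \<Longrightarrow> smooth_map_on S (\<lambda>x. inner (f x) (g x))"
  by (simp add: smooth_map_on_def Ck_on_inner)

lemma smooth_map_on_inverse:
  fixes u :: "'a::real_normed_vector \<Rightarrow> real"
  shows "smooth_map_on S u \<Longrightarrow> \<forall>x\<in>S. u x \<noteq> 0 \<Longrightarrow> smooth_map_on S (\<lambda>x. inverse (u x))"
  by (simp add: smooth_map_on_def Ck_on_inverse)

lemma smooth_map_on_exp_decay: "smooth_map_on S u \<Longrightarrow> smooth_map_on S (\<lambda>x. exp_decay n (u x))"
  by (simp add: smooth_map_on_def Ck_on_exp_decay)

section \<open>Bump functions\<close>

text \<open>The space is only an inner product space with a finite spanning set, so compactness is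
  derived from coordinates: with respect to an orthogonal spanning set the ball lies in a box of
  coefficients, and a box is a finite sum of compact segments.\<close>

lemma compact_cball_finite_dim:
  fixes a :: "'e::real_inner"
  assumes "finite B" "span B = (UNIV :: 'e set)"
  shows "compact (cball a r)"
proof -
  obtain C :: "'e set" where C: "finite C" "span C = UNIV" "pairwise real_inner_class.orthogonal C"
    using basis_orthogonal[OF assms(1)] assms(2) by auto
  define K where "K F M = {\<Sum>c\<in>F. g c *\<^sub>R c | g. \<forall>c\<in>F. \<bar>g c\<bar> \<le> M c}" for F :: "'e set" and M :: "'e \<Rightarrow> real"
  have K: "compact (K F M)" if "finite F" for F M
    using that
  proof (induction F)
    case empty
    then show ?case by (simp add: K_def)
  next
    case (insert c F)
    have "compact ((\<lambda>t. t *\<^sub>R c) ` {- M c..M c})"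
      by (intro compact_continuous_image continuous_intros) auto
    from compact_sums[OF this insert.IH]
    have "compact {x + y |x y. x \<in> (\<lambda>t. t *\<^sub>R c) ` {- M c..M c} \<and> y \<in> K F M}" .
    also have "{x + y |x y. x \<in> (\<lambda>t. t *\<^sub>R c) ` {- M c..M c} \<and> y \<in> K F M} = K (insert c F) M"
    proof (intro equalityI subsetI)
      fix z assume "z \<in> {x + y |x y. x \<in> (\<lambda>t. t *\<^sub>R c) ` {- M c..M c} \<and> y \<in> K F M}"
      then obtain t y where t: "- M c \<le> t" "t \<le> M c" "y \<in> K F M" "z = t *\<^sub>R c + y" by auto
      then obtain g where "\<forall>c\<in>F. \<bar>g c\<bar> \<le> M c" "y = (\<Sum>c\<in>F. g c *\<^sub>R c)" unfolding K_def by auto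
      with t have "\<bar>t\<bar> \<le> M c" "\<forall>c\<in>F. \<bar>g c\<bar> \<le> M c" "z = t *\<^sub>R c + (\<Sum>c\<in>F. g c *\<^sub>R c)"
        by auto
      moreover have "(\<Sum>x\<in>F. (if x = c then t else g x) *\<^sub>R x) = (\<Sum>x\<in>F. g x *\<^sub>R x)"
        using insert.hyps(2) by (intro sum.cong) auto
      ultimately show "z \<in> K (insert c F) M"
        unfolding K_def using insert.hyps by (auto intro!: exI[of _ "\<lambda>x. if x = c then t else g x"])
    next
      fix z assume "z \<in> K (insert c F) M"
      then obtain g where "\<forall>x\<in>insert c F. \<bar>g x\<bar> \<le> M x" "z = (\<Sum>x\<in>insert c F. g x *\<^sub>R x)"
        by (auto simp: K_def)
      moreover from this have "z = g c *\<^sub>R c + (\<Sum>x\<in>F. g x *\<^sub>R x)" using insert.hyps by simp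
      ultimately show "z \<in> {x + y |x y. x \<in> (\<lambda>t. t *\<^sub>R c) ` {- M c..M c} \<and> y \<in> K F M}"
        by (fastforce simp: K_def abs_le_iff)
    qed
    finally show ?case .
  qed
  \<comment> \<open>Points of the ball have norm at most \<open>norm a + \<bar>r\<bar>\<close>, so
    Cauchy-Schwarz bounds the coefficient \<open>inner c x / inner c c\<close>.\<close>
  have "cball a r \<subseteq> K C (\<lambda>c. (norm a + \<bar>r\<bar>) * norm c / (inner c c))"
  proof
    fix x assume x: "x \<in> cball a r"
    have "norm x \<le> norm a + \<bar>r\<bar>"
      using x norm_triangle_sub[of x a] by (auto simp: dist_norm norm_minus_commute)
    have "x \<in> span C" using C(2) by simp
    then have "(\<Sum>c\<in>C. ((inner c x) / (inner c c)) *\<^sub>R c) = x"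
    proof -
      obtain u where u: "x = (\<Sum>c\<in>C. u c *\<^sub>R c)"
        using \<open>x \<in> span C\<close> C(1) span_finite by auto
      have "inner c x = u c * (inner c c)" if "c \<in> C" for c
      proof -
        have "inner c x = (\<Sum>d\<in>C. u d * (inner c d))" by (simp add: u inner_sum_right)
        also have "\<dots> = (\<Sum>d\<in>C. if d = c then u c * (inner c c) else 0)"
          using C(3) that by (intro sum.cong) (auto simp: pairwise_def real_inner_class.orthogonal_def)
        finally show ?thesis using C(1) that by simp
      qed
      \<comment> \<open>\<open>C\<close> may contain 0. The quotient is then 0 by the convention for
        division, and the summand is the zero vector for any coefficient.\<close>
      then show ?thesis by (auto simp: u intro!: sum.cong)
    qed
    moreover have "\<bar>(inner c x) / (inner c c)\<bar> \<le> (norm a + \<bar>r\<bar>) * norm c / (inner c c)" for c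
    proof -
      have "\<bar>inner c x\<bar> \<le> norm c * norm x" by (rule Cauchy_Schwarz_ineq2)
      also have "\<dots> \<le> (norm a + \<bar>r\<bar>) * norm c"
        using \<open>norm x \<le> norm a + \<bar>r\<bar>\<close> by (metis mult.commute mult_left_mono norm_ge_zero)
      finally show ?thesis by (simp add: divide_right_mono)
    qed
    ultimately show "x \<in> K C (\<lambda>c. (norm a + \<bar>r\<bar>) * norm c / (inner c c))"
      unfolding K_def by (intro CollectI exI[of _ "\<lambda>c. inner c x / inner c c"]) simp
  qed
  then have "cball a r = K C (\<lambda>c. (norm a + \<bar>r\<bar>) * norm c / (inner c c)) \<inter> cball a r" by blast
  then show ?thesis using K[OF C(1)] by (metis closed_cball compact_Int_closed)
qed

section \<open>Smooth functions on a manifold, read off in charts\<close>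

locale smooth_manifold =
  fixes A :: "('m::{t2_space, second_countable_topology}, 'e::real_inner, 'v::real_vector) algebroid_data"
  assumes atlas: "smooth_atlas (atlas A)"
begin

lemma chart:
  assumes "(U, \<phi>) \<in> atlas A"
  shows "open U" "open (\<phi> ` U)" "inj_on \<phi> U" "homeomorphism U (\<phi> ` U) \<phi> (inv_into U \<phi>)"
  using atlas assms unfolding smooth_atlas_def by auto

lemma chart_cover: "\<exists>U \<phi>. (U, \<phi>) \<in> atlas A \<and> p \<in> U"
proof -
  have "p \<in> (\<Union>(U, \<phi>)\<in>atlas A. U)" using atlas unfolding smooth_atlas_def by simp
  then show ?thesis by auto
qed

lemma transition:
  assumes "(U, \<phi>) \<in> atlas A" "(V, \<psi>) \<in> atlas A"
  shows "smooth_map_on (\<phi> ` (U \<inter> V)) (\<psi> \<circ> inv_into U \<phi>)"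
proof -
  have "\<forall>(U, \<phi>)\<in>atlas A. \<forall>(V, \<psi>)\<in>atlas A. smooth_map_on (\<phi> ` (U \<inter> V)) (\<psi> \<circ> inv_into U \<phi>)"
    using atlas unfolding smooth_atlas_def by simp
  then show ?thesis using assms by fast
qed

lemma chart_inv: "(U, \<phi>) \<in> atlas A \<Longrightarrow> p \<in> U \<Longrightarrow> inv_into U \<phi> (\<phi> p) = p"
  using chart(3) by (rule inv_into_f_f)

lemma open_chart_image:
  assumes "(U, \<phi>) \<in> atlas A" "open W"
  shows "open (\<phi> ` (U \<inter> W))"
  using homeomorphism_imp_open_map[OF chart(4)[OF assms(1)], of "U \<inter> W"] assms chart(2)[OF assms(1)]
  by (metis inf.commute open_openin_trans openin_open_Int openin_open_trans)

lemma smooth_fun_onD: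
  "smooth_fun_on A W f \<Longrightarrow> (U, \<phi>) \<in> atlas A \<Longrightarrow> smooth_map_on (\<phi> ` (U \<inter> W)) (\<lambda>x. f (inv_into U \<phi> x))"
  unfolding smooth_fun_on_def o_def by fast

lemma smooth_fun_onI:
  "(\<And>U \<phi>. (U, \<phi>) \<in> atlas A \<Longrightarrow> smooth_map_on (\<phi> ` (U \<inter> W)) (\<lambda>x. f (inv_into U \<phi> x)))
    \<Longrightarrow> smooth_fun_on A W f"
  unfolding smooth_fun_on_def o_def by fast

lemma smooth_fun_on_cong:
  assumes "open W" "smooth_fun_on A W f" "\<And>p. p \<in> W \<Longrightarrow> f p = g p"
  shows "smooth_fun_on A W g"
proof (rule smooth_fun_onI)
  fix U \<phi> assume U: "(U, \<phi>) \<in> atlas A"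
  show "smooth_map_on (\<phi> ` (U \<inter> W)) (\<lambda>x. g (inv_into U \<phi> x))"
    by (rule smooth_map_on_cong[OF open_chart_image[OF U assms(1)] smooth_fun_onD[OF assms(2) U]])
       (auto simp: chart_inv[OF U] assms(3))
qed

lemma smooth_fun_on_subset:
  assumes "smooth_fun_on A W f" "V \<subseteq> W"
  shows "smooth_fun_on A V f"
proof (rule smooth_fun_onI)
  fix U \<phi> assume U: "(U, \<phi>) \<in> atlas A"
  show "smooth_map_on (\<phi> ` (U \<inter> V)) (\<lambda>x. f (inv_into U \<phi> x))"
    by (rule smooth_map_on_subset[OF smooth_fun_onD[OF assms(1) U]]) (use assms(2) in blast)
qed

lemma smooth_fun_on_local:
  assumes "\<And>p. p \<in> W \<Longrightarrow> \<exists>V. open V \<and> p \<in> V \<and> smooth_fun_on A V f"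
  shows "smooth_fun_on A W f"
proof (rule smooth_fun_onI, rule smooth_map_on_local)
  fix U \<phi> x assume U: "(U, \<phi>) \<in> atlas A" and "x \<in> \<phi> ` (U \<inter> W)"
  then obtain p where p: "p \<in> U" "p \<in> W" "x = \<phi> p" by auto
  then obtain V where V: "open V" "p \<in> V" "smooth_fun_on A V f" using assms by blast
  have "x \<in> \<phi> ` (U \<inter> V)" using p V(2) by blast
  then show "\<exists>T. open T \<and> x \<in> T \<and> smooth_map_on T (\<lambda>x. f (inv_into U \<phi> x))"
    using open_chart_image[OF U V(1)] smooth_fun_onD[OF V(3) U] by blast
qed

lemma smooth_fun_on_const [simp]: "smooth_fun_on A W (\<lambda>p. c)"
  by (rule smooth_fun_onI) simp

lemma smooth_fun_on_add:
  "smooth_fun_on A W f \<Longrightarrow> smooth_fun_on A W g \<Longrightarrow> smooth_fun_on A W (\<lambda>p. f p + g p)"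
  by (rule smooth_fun_onI) (rule smooth_map_on_add[OF smooth_fun_onD smooth_fun_onD])

lemma smooth_fun_on_mult:
  "smooth_fun_on A W f \<Longrightarrow> smooth_fun_on A W g \<Longrightarrow> smooth_fun_on A W (\<lambda>p. f p * g p)"
  by (rule smooth_fun_onI) (rule smooth_map_on_mult[OF smooth_fun_onD smooth_fun_onD])

lemma smooth_fun_on_inverse:
  assumes "smooth_fun_on A W f" "\<And>p. p \<in> W \<Longrightarrow> f p \<noteq> 0"
  shows "smooth_fun_on A W (\<lambda>p. inverse (f p))"
proof (rule smooth_fun_onI)
  fix U \<phi> assume U: "(U, \<phi>) \<in> atlas A"
  show "smooth_map_on (\<phi> ` (U \<inter> W)) (\<lambda>x. inverse (f (inv_into U \<phi> x)))"
    by (rule smooth_map_on_inverse[OF smooth_fun_onD[OF assms(1) U]])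
       (auto simp: chart_inv[OF U] assms(2))
qed

lemma smooth_fun_on_minus: "smooth_fun_on A W f \<Longrightarrow> smooth_fun_on A W (\<lambda>p. - f p)"
  using smooth_fun_on_mult[OF smooth_fun_on_const[of W "-1"]] by simp

lemma smooth_fun_on_diff:
  "smooth_fun_on A W f \<Longrightarrow> smooth_fun_on A W g \<Longrightarrow> smooth_fun_on A W (\<lambda>p. f p - g p)"
  using smooth_fun_on_add[OF _ smooth_fun_on_minus] by simp

lemma smooth_fun_on_sum:
  "(\<And>i. i \<in> I \<Longrightarrow> smooth_fun_on A W (f i)) \<Longrightarrow> smooth_fun_on A W (\<lambda>p. \<Sum>i\<in>I. f i p)"
  by (induction I rule: infinite_finite_induct) (auto intro: smooth_fun_on_add)

lemma smooth_fun_on_prod: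
  "(\<And>i. i \<in> I \<Longrightarrow> smooth_fun_on A W (f i)) \<Longrightarrow> smooth_fun_on A W (\<lambda>p. \<Prod>i\<in>I. f i p)"
  by (induction I rule: infinite_finite_induct) (auto intro: smooth_fun_on_mult)

text \<open>In a chart this is the quotient E(r^2 - d) / (E(r^2 - d) + E(d - (r/2)^2)), where E is
  \<open>exp_decay 0\<close> and d is the squared distance from the centre; squaring makes d an
  inner product and hence smooth. The closed set \<open>K\<close> is part of the result so that
  local objects can be cut off and continued by 0: \<open>W\<close> and \<open>- K\<close> form an
  open cover.\<close>

lemma bump_function:
  assumes "open W" "p \<in> W"
  obtains \<beta> V K where "\<beta> \<in> smooth_funs A" "open V" "p \<in> V" "V \<subseteq> K" "closed K" "K \<subseteq> W"
    "\<And>q. q \<in> V \<Longrightarrow> \<beta> q = 1" "\<And>q. q \<notin> K \<Longrightarrow> \<beta> q = 0"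
proof -
  obtain U \<phi> where U: "(U, \<phi>) \<in> atlas A" "p \<in> U"
    using chart_cover by blast
  note ch = chart[OF U(1)] and inv = chart_inv[OF U(1)]
  have "open (\<phi> ` (U \<inter> W))" by (rule open_chart_image[OF U(1) assms(1)])
  then obtain r where r: "r > 0" "cball (\<phi> p) r \<subseteq> \<phi> ` (U \<inter> W)"
    using U(2) assms(2) unfolding open_contains_cball by blast
  define K where "K = inv_into U \<phi> ` cball (\<phi> p) r"
  define V where "V = U \<inter> \<phi> -` ball (\<phi> p) (r/2)"
  define d where "d x = inner (x - \<phi> p) (x - \<phi> p)" for x
  have dd: "d x = (dist (\<phi> p) x)^2" for x
    by (simp add: d_def dist_norm power2_norm_eq_inner norm_minus_commute)
  define N where "N x = exp_decay 0 (r^2 - d x) + exp_decay 0 (d x - (r/2)^2)" for x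
  define h where "h x = exp_decay 0 (r^2 - d x) * inverse (N x)" for x
  define \<beta> where "\<beta> q = (if q \<in> U then h (\<phi> q) else 0)" for q
  \<comment> \<open>The summands of \<open>N\<close> vanish only when \<open>d x\<close> is at least
    \<open>r^2\<close>, respectively at most \<open>(r/2)^2\<close>, so never both at once.\<close>
  have "(r/2)^2 < r^2" using r(1) by (simp add: power_divide)
  then have N: "N x > 0" for x
    by (auto simp: N_def exp_decay_def add_pos_nonneg add_nonneg_pos)
  have contphi: "continuous_on U \<phi>" and contpsi: "continuous_on (\<phi> ` U) (inv_into U \<phi>)"
    using ch(4) unfolding homeomorphism_def by auto
  have "compact (cball (\<phi> p) r)"
    using atlas compact_cball_finite_dim unfolding smooth_atlas_def by metis
  moreover have "continuous_on (cball (\<phi> p) r) (inv_into U \<phi>)"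
    using r(2) by (intro continuous_on_subset[OF contpsi]) auto
  ultimately have "compact K"
    unfolding K_def by (intro compact_continuous_image)
  \<comment> \<open>Here the manifold is Hausdorff. Closedness in the whole manifold, not merely in
    the chart, makes the continuation of \<beta> by 0 smooth.\<close>
  then have "closed K" by (rule compact_imp_closed)
  have KUW: "K \<subseteq> U \<inter> W"
  proof
    fix q assume "q \<in> K"
    then obtain x where x: "x \<in> cball (\<phi> p) r" "q = inv_into U \<phi> x" unfolding K_def by blast
    then obtain q' where "q' \<in> U" "q' \<in> W" "x = \<phi> q'" using r(2) by blast
    then show "q \<in> U \<inter> W" using inv x(2) by simp
  qed
  have Kiff: "q \<in> K \<longleftrightarrow> dist (\<phi> p) (\<phi> q) \<le> r" if "q \<in> U" for q
  proof
    assume "q \<in> K"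
    then obtain x where x: "x \<in> cball (\<phi> p) r" "q = inv_into U \<phi> x" unfolding K_def by blast
    then have "x \<in> \<phi> ` U" using r(2) by blast
    then show "dist (\<phi> p) (\<phi> q) \<le> r"
      using x f_inv_into_f[of x \<phi> U] by simp
  next
    assume "dist (\<phi> p) (\<phi> q) \<le> r"
    then show "q \<in> K" unfolding K_def by (intro image_eqI[of _ _ "\<phi> q"]) (simp_all add: inv[OF that])
  qed
  have zero: "\<beta> q = 0" if "q \<notin> K" for q
  proof (cases "q \<in> U")
    case True
    then have "r < dist (\<phi> p) (\<phi> q)" using that Kiff by force
    then have "r^2 < d (\<phi> q)" using r(1) by (simp add: dd power_strict_mono)
    then show ?thesis by (simp add: \<beta>_def h_def exp_decay_def)
  qed (simp add: \<beta>_def)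
  have one: "\<beta> q = 1" if "q \<in> V" for q
  proof -
    have "dist (\<phi> p) (\<phi> q) < r/2" "q \<in> U"
      using that by (auto simp: V_def)
    then have "d (\<phi> q) < (r/2)^2"
      unfolding dd by (intro power_strict_mono) auto
    then show ?thesis using \<open>q \<in> U\<close> N[of "\<phi> q"] by (simp add: \<beta>_def h_def N_def exp_decay_def)
  qed
  have "smooth_fun_on A U \<beta>"
    unfolding smooth_fun_on_def
  proof safe
    fix U' \<psi> assume U': "(U', \<psi>) \<in> atlas A"
    define G where "G = \<phi> \<circ> inv_into U' \<psi>"
    have "smooth_map_on (\<psi> ` (U' \<inter> U)) G"
      unfolding G_def by (rule transition[OF U' U(1)])
    then have "smooth_map_on (\<psi> ` (U' \<inter> U)) (\<lambda>x. d (G x))"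
      unfolding d_def diff_conv_add_uminus by (intro smooth_map_on_inner smooth_map_on_add) auto
    note dG = this
    have "smooth_map_on (\<psi> ` (U' \<inter> U)) (\<lambda>x. r^2 - d (G x))"
      using smooth_map_on_add[OF smooth_map_on_const[of _ "r^2"]
          smooth_map_on_mult[OF smooth_map_on_const[of _ "-1"] dG]] by simp
    then have 1: "smooth_map_on (\<psi> ` (U' \<inter> U)) (\<lambda>x. exp_decay 0 (r^2 - d (G x)))"
      by (rule smooth_map_on_exp_decay)
    have "smooth_map_on (\<psi> ` (U' \<inter> U)) (\<lambda>x. d (G x) - (r/2)^2)"
      using smooth_map_on_add[OF dG smooth_map_on_const[of _ "- ((r/2)^2)"]] by simp
    then have 2: "smooth_map_on (\<psi> ` (U' \<inter> U)) (\<lambda>x. exp_decay 0 (d (G x) - (r/2)^2))"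
      by (rule smooth_map_on_exp_decay)
    have "smooth_map_on (\<psi> ` (U' \<inter> U)) (\<lambda>x. inverse (N (G x)))"
      by (rule smooth_map_on_inverse)
         (use smooth_map_on_add[OF 1 2] N in \<open>auto simp: N_def less_imp_neq[symmetric]\<close>)
    from smooth_map_on_mult[OF 1 this]
    have "smooth_map_on (\<psi> ` (U' \<inter> U)) (\<lambda>x. h (G x))" unfolding h_def .
    then show "smooth_map_on (\<psi> ` (U' \<inter> U)) (\<beta> \<circ> inv_into U' \<psi>)"
      by (rule smooth_map_on_cong[rotated])
         (use chart_inv[OF U'] open_chart_image[OF U' ch(1)] in \<open>auto simp: \<beta>_def G_def\<close>)
  qed
  moreover have "smooth_fun_on A (- K) \<beta>"
    by (rule smooth_fun_on_cong[of _ "\<lambda>_. 0"]) (use zero \<open>closed K\<close> in auto)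
  ultimately have "smooth_fun_on A UNIV \<beta>"
  proof (intro smooth_fun_on_local)
    fix q assume "smooth_fun_on A U \<beta>" "smooth_fun_on A (- K) \<beta>"
    moreover have "q \<in> U \<or> q \<in> - K" using KUW by blast
    ultimately show "\<exists>V. open V \<and> q \<in> V \<and> smooth_fun_on A V \<beta>"
      using ch(1) \<open>closed K\<close> by (metis open_Compl)
  qed
  moreover have "open V"
    unfolding V_def using contphi ch(1) by (metis continuous_on_open_vimage inf_commute open_ball)
  moreover have "p \<in> V" using U(2) r(1) by (simp add: V_def)
  moreover have "V \<subseteq> K" using Kiff r(1) by (auto simp: V_def)
  ultimately show ?thesis
    using that[of \<beta> V K] zero one KUW \<open>closed K\<close> by (auto simp: smooth_funs_def)
qed

end

section \<open>Sections and frames\<close>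

lemma dual_space_add: "\<xi> \<in> dual_space V \<Longrightarrow> x \<in> V \<Longrightarrow> y \<in> V \<Longrightarrow> \<xi> (x + y) = \<xi> x + \<xi> y"
  by (simp add: dual_space_def)

lemma dual_space_scaleR: "\<xi> \<in> dual_space V \<Longrightarrow> x \<in> V \<Longrightarrow> \<xi> (c *\<^sub>R x) = c * \<xi> x"
  by (simp add: dual_space_def)

lemma dual_space_outside: "\<xi> \<in> dual_space V \<Longrightarrow> x \<notin> V \<Longrightarrow> \<xi> x = 0"
  by (simp add: dual_space_def)

lemma dual_space_uminus: "\<xi> \<in> dual_space V \<Longrightarrow> x \<in> V \<Longrightarrow> \<xi> (- x) = - \<xi> x"
  using dual_space_scaleR[of \<xi> V x "-1"] by simp

lemma dual_space_zero: "\<xi> \<in> dual_space V \<Longrightarrow> subspace V \<Longrightarrow> \<xi> 0 = 0"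
  using dual_space_scaleR[of \<xi> V 0 0] by (simp add: subspace_0)

lemma dual_space_diff:
  "\<xi> \<in> dual_space V \<Longrightarrow> subspace V \<Longrightarrow> x \<in> V \<Longrightarrow> y \<in> V \<Longrightarrow> \<xi> (x - y) = \<xi> x - \<xi> y"
  using dual_space_add[of \<xi> V x "- y"] dual_space_uminus[of \<xi> V y] by (simp add: subspace_neg)

lemma dual_space_sum:
  assumes "\<xi> \<in> dual_space V" "subspace V" "\<And>i. i \<in> I \<Longrightarrow> f i \<in> V"
  shows "\<xi> (\<Sum>i\<in>I. f i) = (\<Sum>i\<in>I. \<xi> (f i))"
  using assms(3)
proof (induction I rule: infinite_finite_induct)
  case (insert i I)
  then have "\<xi> (f i + sum f I) = \<xi> (f i) + \<xi> (sum f I)"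
    by (intro dual_space_add[OF assms(1)] subspace_sum[OF assms(2)]) auto
  then show ?case using insert by simp
qed (use dual_space_zero[OF assms(1,2)] in auto)

lemma dual_space_lincomb:
  assumes "\<xi> \<in> dual_space V" "subspace V" "\<And>i. i \<in> I \<Longrightarrow> f i \<in> V"
  shows "\<xi> (\<Sum>i\<in>I. c i *\<^sub>R f i) = (\<Sum>i\<in>I. c i * \<xi> (f i))"
  using dual_space_sum[OF assms(1,2), of I "\<lambda>i. c i *\<^sub>R f i"] assms
  by (simp add: subspace_scale dual_space_scaleR)

text \<open>Independence is a property of the set of frame values; injectivity of the indexing turns
  it into independence of the indexed family.\<close>

lemma sum_frame_eq_0:
  fixes f :: "nat \<Rightarrow> 'v::real_vector"
  assumes "inj_on f {..<k}" "independent (f ` {..<k})" "(\<Sum>i<k. c i *\<^sub>R f i) = 0" "i < k"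
  shows "c i = 0"
proof -
  define g where "g = c \<circ> inv_into {..<k} f"
  have "(\<Sum>v\<in>f ` {..<k}. g v *\<^sub>R v) = (\<Sum>i<k. c i *\<^sub>R f i)"
    unfolding sum.reindex[OF assms(1)] using assms(1) by (auto simp: g_def intro!: sum.cong)
  then have "g (f i) = 0"
    using independentD[OF assms(2), of "f ` {..<k}" g "f i"] assms(3,4) by auto
  then show ?thesis using assms(1,4) by (simp add: g_def)
qed

lemma span_frame:
  fixes f :: "nat \<Rightarrow> 'v::real_vector"
  assumes "x \<in> span (f ` {..<k})"
  shows "\<exists>c. x = (\<Sum>i<k. c i *\<^sub>R f i)"
  using assms
proof (induction rule: span_induct_alt)
  case base
  show ?case by (intro exI[of _ "\<lambda>_. 0"]) simp
next
  case (step a x y)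
  then obtain c j where c: "y = (\<Sum>i<k. c i *\<^sub>R f i)" "j < k" "x = f j" by auto
  have "(\<Sum>i<k. (if i = j then a else 0) *\<^sub>R f i) = (\<Sum>i<k. if i = j then a *\<^sub>R f j else 0)"
    by (rule sum.cong) auto
  then have "a *\<^sub>R x + y = (\<Sum>i<k. (c i + (if i = j then a else 0)) *\<^sub>R f i)"
    using c by (simp add: scaleR_left_distrib sum.distrib)
  then show ?case by (intro exI[of _ "\<lambda>i. c i + (if i = j then a else 0)"])
qed

section \<open>Frames, sections and covector fields of a vector bundle\<close>

locale smooth_bundle =
  fixes A :: "('m::{t2_space, second_countable_topology}, 'e::real_inner, 'v::real_vector) algebroid_data"
  assumes vector_bundle: "vector_bundle A"

sublocale smooth_bundle \<subseteq> smooth_manifold A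
  using vector_bundle by unfold_locales (simp add: vector_bundle_def)

context smooth_bundle begin

lemma frame_cover: "\<exists>U e. (U, e) \<in> frames A \<and> p \<in> U"
proof -
  have "p \<in> (\<Union>(U, e)\<in>frames A. U)" using vector_bundle unfolding vector_bundle_def by simp
  then show ?thesis by auto
qed

lemma frame:
  assumes "(U, e) \<in> frames A"
  shows "open U" "\<And>i. i < rnk A \<Longrightarrow> smooth_section_on A U (e i)"
    "\<And>p. p \<in> U \<Longrightarrow> inj_on (\<lambda>i. e i p) {..<rnk A}"
    "\<And>p. p \<in> U \<Longrightarrow> independent ((\<lambda>i. e i p) ` {..<rnk A})"
    "\<And>p. p \<in> U \<Longrightarrow> span ((\<lambda>i. e i p) ` {..<rnk A}) = fibre A p"
proof -
  have "\<forall>(U, e)\<in>frames A. open U \<and>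
        (\<forall>p\<in>U. inj_on (\<lambda>i. e i p) {..<rnk A} \<and> independent ((\<lambda>i. e i p) ` {..<rnk A}) \<and>
           span ((\<lambda>i. e i p) ` {..<rnk A}) = fibre A p) \<and>
        (\<forall>i<rnk A. smooth_section_on A U (e i))"
    using vector_bundle unfolding vector_bundle_def by simp
  then show "open U" "\<And>i. i < rnk A \<Longrightarrow> smooth_section_on A U (e i)"
    "\<And>p. p \<in> U \<Longrightarrow> inj_on (\<lambda>i. e i p) {..<rnk A}"
    "\<And>p. p \<in> U \<Longrightarrow> independent ((\<lambda>i. e i p) ` {..<rnk A})"
    "\<And>p. p \<in> U \<Longrightarrow> span ((\<lambda>i. e i p) ` {..<rnk A}) = fibre A p"
    using assms by fast+
qed

lemma subspace_fibre: "subspace (fibre A p)"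
  using frame_cover[of p] frame(5) by (metis subspace_span)

lemma frame_in_fibre: "(U, e) \<in> frames A \<Longrightarrow> p \<in> U \<Longrightarrow> i < rnk A \<Longrightarrow> e i p \<in> fibre A p"
  using frame(5)[of U e p] span_base[of "e i p" "(\<lambda>i. e i p) ` {..<rnk A}"] by simp

lemma frame_coords_0:
  assumes "(U, e) \<in> frames A" "p \<in> U" "(\<Sum>i<rnk A. c i *\<^sub>R e i p) = 0" "i < rnk A"
  shows "c i = 0"
  using sum_frame_eq_0[OF frame(3,4)[OF assms(1,2)] assms(3,4)] .

lemma frame_coords:
  assumes "(U, e) \<in> frames A" "p \<in> U" "x \<in> fibre A p"
  shows "\<exists>c. x = (\<Sum>i<rnk A. c i *\<^sub>R e i p)"
  using span_frame[of x "\<lambda>i. e i p"] frame(5)[OF assms(1,2)] assms(3) by simp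

lemma dual_lincomb:
  assumes "(U, e) \<in> frames A" "p \<in> U" "\<xi> \<in> dual_fibre A p"
  shows "\<xi> (\<Sum>i<rnk A. c i *\<^sub>R e i p) = (\<Sum>i<rnk A. c i * \<xi> (e i p))"
  by (rule dual_space_lincomb[OF assms(3) subspace_fibre]) (simp add: frame_in_fibre[OF assms(1,2)])

lemma lincomb_in_fibre:
  "(\<And>i. i \<in> I \<Longrightarrow> f i \<in> fibre A p) \<Longrightarrow> (\<Sum>i\<in>I. c i *\<^sub>R f i) \<in> fibre A p"
  by (intro subspace_sum subspace_scale subspace_fibre)

lemma dual_eqI:
  assumes "(U, e) \<in> frames A" "p \<in> U" "\<xi> \<in> dual_fibre A p" "\<eta> \<in> dual_fibre A p"
    "\<And>i. i < rnk A \<Longrightarrow> \<xi> (e i p) = \<eta> (e i p)"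
  shows "\<xi> = \<eta>"
proof
  fix x show "\<xi> x = \<eta> x"
  proof (cases "x \<in> fibre A p")
    case True
    then obtain c where c: "x = (\<Sum>i<rnk A. c i *\<^sub>R e i p)" using frame_coords[OF assms(1,2)] by blast
    show ?thesis
      unfolding c dual_lincomb[OF assms(1,2,3)] dual_lincomb[OF assms(1,2,4)] using assms(5) by simp
  next
    case False
    then show ?thesis using assms dual_space_outside by metis
  qed
qed

text \<open>The coordinates with respect to a frame are unique, hence linear in the vector;
  continued by 0 off the fibre they are functionals in the sense of
  \<open>dual_space\<close>.\<close>

lemma dual_basis:
  assumes "(U, e) \<in> frames A" "p \<in> U"
  obtains \<epsilon> where "\<And>i. i < rnk A \<Longrightarrow> \<epsilon> i \<in> dual_fibre A p"
    "\<And>i j. i < rnk A \<Longrightarrow> j < rnk A \<Longrightarrow> \<epsilon> i (e j p) = (if i = j then 1 else 0)"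
proof -
  let ?V = "fibre A p"
  obtain c where c: "\<And>x. x \<in> ?V \<Longrightarrow> x = (\<Sum>i<rnk A. c x i *\<^sub>R e i p)"
    using frame_coords[OF assms] by metis
  have uniq: "c x i = d i" if "x = (\<Sum>i<rnk A. d i *\<^sub>R e i p)" "i < rnk A" for x d i
  proof -
    have "x \<in> ?V" unfolding that(1) by (rule lincomb_in_fibre) (simp add: frame_in_fibre[OF assms])
    then have "(\<Sum>i<rnk A. (c x i - d i) *\<^sub>R e i p) = 0"
      using c that(1) by (simp add: scaleR_left_diff_distrib sum_subtractf)
    then show ?thesis using frame_coords_0[OF assms _ that(2)] by fastforce
  qed
  define \<epsilon> where "\<epsilon> i x = (if x \<in> ?V then c x i else 0)" for i x
  have add: "c (x + y) i = c x i + c y i" if "x \<in> ?V" "y \<in> ?V" "i < rnk A" for x y i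
  proof (rule uniq[OF _ that(3)])
    have "x + y = (\<Sum>i<rnk A. c x i *\<^sub>R e i p) + (\<Sum>i<rnk A. c y i *\<^sub>R e i p)"
      using c[OF that(1)] c[OF that(2)] by simp
    then show "x + y = (\<Sum>i<rnk A. (c x i + c y i) *\<^sub>R e i p)"
      by (simp add: scaleR_left_distrib sum.distrib)
  qed
  have scale: "c (t *\<^sub>R x) i = t * c x i" if "x \<in> ?V" "i < rnk A" for x t i
  proof (rule uniq[OF _ that(2)])
    show "t *\<^sub>R x = (\<Sum>i<rnk A. (t * c x i) *\<^sub>R e i p)"
      using arg_cong[OF c[OF that(1)], of "\<lambda>x. t *\<^sub>R x"] by (simp add: scaleR_sum_right)
  qed
  have "\<epsilon> i \<in> dual_fibre A p" if "i < rnk A" for i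
    unfolding dual_space_def \<epsilon>_def
    using add scale that subspace_fibre by (auto simp: subspace_add subspace_scale)
  moreover have "\<epsilon> i (e j p) = (if i = j then 1 else 0)" if "i < rnk A" "j < rnk A" for i j
  proof -
    have "(\<Sum>i<rnk A. (if i = j then 1 else 0) *\<^sub>R e i p) = (\<Sum>i<rnk A. if i = j then e j p else 0)"
      by (rule sum.cong) auto
    then have "c (e j p) i = (if i = j then 1 else 0)"
      using that by (intro uniq) auto
    then show ?thesis using frame_in_fibre[OF assms that(2)] by (simp add: \<epsilon>_def)
  qed
  ultimately show ?thesis using that by blast
qed

text \<open>A dual basis separates vectors. This makes the definite description in
  \<open>sharp\<close> single-valued and lets identities between vectors be checked by pairing with
  covectors.\<close>

lemma fibre_eqI:
  assumes "x \<in> fibre A p" "y \<in> fibre A p" "\<And>\<eta>. \<eta> \<in> dual_fibre A p \<Longrightarrow> \<eta> x = \<eta> y"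
  shows "x = y"
proof -
  obtain U e where U: "(U, e) \<in> frames A" "p \<in> U" using frame_cover by blast
  obtain \<epsilon> where \<epsilon>: "\<And>i. i < rnk A \<Longrightarrow> \<epsilon> i \<in> dual_fibre A p"
    "\<And>i j. i < rnk A \<Longrightarrow> j < rnk A \<Longrightarrow> \<epsilon> i (e j p) = (if i = j then 1 else 0)"
    using dual_basis[OF U] by blast
  obtain c where c: "x - y = (\<Sum>i<rnk A. c i *\<^sub>R e i p)"
    using frame_coords[OF U] subspace_diff[OF subspace_fibre assms(1,2)] by blast
  have "c i = 0" if "i < rnk A" for i
  proof -
    have "0 = \<epsilon> i (x - y)"
      using assms \<epsilon>(1)[OF that] dual_space_diff[OF \<epsilon>(1)[OF that] subspace_fibre] by simp
    also have "\<dots> = (\<Sum>j<rnk A. c j * \<epsilon> i (e j p))" unfolding c by (rule dual_lincomb[OF U \<epsilon>(1)[OF that]])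
    also have "\<dots> = (\<Sum>j<rnk A. if j = i then c i else 0)" using \<epsilon>(2) that by (intro sum.cong) auto
    finally show ?thesis using that by simp
  qed
  then show ?thesis using c by simp
qed

text \<open>The permutation expansion exhibits the determinant as a polynomial in the entries. The
  matrices are those with a variable dimension, since the rank of the bundle is a number and not a
  type.\<close>

lemma smooth_fun_on_det:
  fixes k :: nat
  assumes "\<And>i j. i < k \<Longrightarrow> j < k \<Longrightarrow> smooth_fun_on A W (M i j)"
  shows "smooth_fun_on A W (\<lambda>p. Determinant.det (mat k k (\<lambda>(i, j). M i j p)))"
proof -
  have "smooth_fun_on A W (\<lambda>p. \<Sum>\<sigma> | \<sigma> permutes {0..<k}. of_int (sign \<sigma>) * (\<Prod>i = 0..<k. M i (\<sigma> i) p))"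
    by (intro smooth_fun_on_sum smooth_fun_on_mult smooth_fun_on_const smooth_fun_on_prod assms)
       (auto dest: permutes_in_image)
  moreover have "Determinant.det (mat k k (\<lambda>(i, j). M i j p)) =
    (\<Sum>\<sigma> | \<sigma> permutes {0..<k}. of_int (sign \<sigma>) * (\<Prod>i = 0..<k. M i (\<sigma> i) p))" for p
    by (subst det_def'[of _ k]) (auto intro!: sum.cong prod.cong dest: permutes_in_image)
  ultimately show ?thesis by simp
qed

text \<open>By Cramer's rule.\<close>

lemma smooth_linear_system:
  fixes k :: nat
  assumes W: "open W"
    and M: "\<And>i j. i < k \<Longrightarrow> j < k \<Longrightarrow> smooth_fun_on A W (M i j)"
    and b: "\<And>i. i < k \<Longrightarrow> smooth_fun_on A W (b i)"
    and eq: "\<And>p i. p \<in> W \<Longrightarrow> i < k \<Longrightarrow> (\<Sum>j<k. M i j p * c j p) = b i p"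
    and inj: "\<And>p d j. p \<in> W \<Longrightarrow> (\<And>i. i < k \<Longrightarrow> (\<Sum>j<k. M i j p * d j) = 0) \<Longrightarrow> j < k \<Longrightarrow> d j = 0"
    and j: "j < k"
  shows "smooth_fun_on A W (c j)"
proof -
  define D where "D p = mat k k (\<lambda>(i, j). M i j p)" for p
  \<comment> \<open>The matrix of Cramer's rule: column \<open>j\<close> of \<open>D p\<close>
    replaced by the right-hand side, so that \<open>c j p\<close> is a quotient of
    determinants.\<close>
  define N where "N p = mat k k (\<lambda>(i, l). (if l = j then b i else M i l) p)" for p
  have D: "D p \<in> carrier_mat k k" for p by (simp add: D_def)
  have mult: "(D p *\<^sub>v x) $ i = (\<Sum>j<k. M i j p * x $ j)" if "x \<in> carrier_vec k" "i < k" for x p i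
    using that by (simp add: D_def scalar_prod_def lessThan_atLeast0)
  \<comment> \<open>A vanishing determinant would yield a non-zero solution of the homogeneous
    system, contradicting \<open>inj\<close>.\<close>
  have det: "Determinant.det (D p) \<noteq> 0" if "p \<in> W" for p
  proof
    assume "Determinant.det (D p) = 0"
    then obtain v where v: "v \<in> carrier_vec k" "v \<noteq> 0\<^sub>v k" "D p *\<^sub>v v = 0\<^sub>v k"
      using det_0_iff_vec_prod_zero_field[OF D] by blast
    then have "(\<Sum>j<k. M i j p * v $ j) = 0" if "i < k" for i
      using mult[OF v(1) that, of p] that by simp
    then have "v $ j = 0" if "j < k" for j using inj[OF \<open>p \<in> W\<close> _ that] by blast
    then show False using v(1,2) by auto
  qed
  have "c j p = Determinant.det (N p) * inverse (Determinant.det (D p))" if p: "p \<in> W" for p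
  proof -
    let ?x = "vec k (\<lambda>j. c j p)"
    have "replace_col (D p) (D p *\<^sub>v ?x) j = N p"
      using mult[of ?x] eq[OF p]
      by (intro eq_matI) (auto simp: replace_col_def N_def D_def)
    then have "Determinant.det (N p) = c j p * Determinant.det (D p)"
      using cramer_lemma_mat[OF D, of ?x j p] j by simp
    then show ?thesis using det[OF p] by simp
  qed
  moreover have "smooth_fun_on A W (\<lambda>p. Determinant.det (N p) * inverse (Determinant.det (D p)))"
    unfolding N_def using det
    by (intro smooth_fun_on_mult smooth_fun_on_inverse smooth_fun_on_det) (auto simp: D_def intro!: smooth_fun_on_det M b)
  ultimately show ?thesis by (intro smooth_fun_on_cong[OF W, of _ "c j"]) auto
qed

lemma smooth_section_onI:
  assumes "\<And>p. p \<in> W \<Longrightarrow> s p \<in> fibre A p"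
    "\<And>U e. (U, e) \<in> frames A \<Longrightarrow> \<exists>c. (\<forall>i<rnk A. smooth_fun_on A (U \<inter> W) (c i)) \<and>
        (\<forall>q\<in>U \<inter> W. s q = (\<Sum>i<rnk A. c i q *\<^sub>R e i q))"
  shows "smooth_section_on A W s"
  using assms unfolding smooth_section_on_def by auto

lemma smooth_section_onD:
  assumes "smooth_section_on A W s"
  shows "p \<in> W \<Longrightarrow> s p \<in> fibre A p"
    "(U, e) \<in> frames A \<Longrightarrow> \<exists>c. (\<forall>i<rnk A. smooth_fun_on A (U \<inter> W) (c i)) \<and>
        (\<forall>q\<in>U \<inter> W. s q = (\<Sum>i<rnk A. c i q *\<^sub>R e i q))"
  using assms unfolding smooth_section_on_def by fast+

lemma smooth_section_on_lincomb:
  assumes "\<And>j. j \<in> J \<Longrightarrow> smooth_section_on A W (s j)" "\<And>j. j \<in> J \<Longrightarrow> smooth_fun_on A W (f j)"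
  shows "smooth_section_on A W (\<lambda>p. \<Sum>j\<in>J. f j p *\<^sub>R s j p)"
proof (rule smooth_section_onI)
  fix U e assume U: "(U, e) \<in> frames A"
  have "\<exists>c. \<forall>j\<in>J. (\<forall>i<rnk A. smooth_fun_on A (U \<inter> W) (c j i)) \<and>
        (\<forall>q\<in>U \<inter> W. s j q = (\<Sum>i<rnk A. c j i q *\<^sub>R e i q))"
    by (intro bchoice ballI smooth_section_onD(2)[OF assms(1) U])
  then obtain c where c: "\<And>j i. j \<in> J \<Longrightarrow> i < rnk A \<Longrightarrow> smooth_fun_on A (U \<inter> W) (c j i)"
    "\<And>j q. j \<in> J \<Longrightarrow> q \<in> U \<inter> W \<Longrightarrow> s j q = (\<Sum>i<rnk A. c j i q *\<^sub>R e i q)" by blast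
  have "(\<Sum>j\<in>J. f j q *\<^sub>R s j q) = (\<Sum>i<rnk A. (\<Sum>j\<in>J. f j q * c j i q) *\<^sub>R e i q)" if "q \<in> U \<inter> W" for q
  proof -
    have "(\<Sum>j\<in>J. f j q *\<^sub>R s j q) = (\<Sum>j\<in>J. \<Sum>i<rnk A. (f j q * c j i q) *\<^sub>R e i q)"
      using c(2) that by (intro sum.cong) (auto simp: scaleR_sum_right)
    also have "\<dots> = (\<Sum>i<rnk A. \<Sum>j\<in>J. (f j q * c j i q) *\<^sub>R e i q)" by (rule sum.swap)
    finally show ?thesis by (simp add: scaleR_left.sum)
  qed
  moreover have "smooth_fun_on A (U \<inter> W) (\<lambda>q. \<Sum>j\<in>J. f j q * c j i q)" if "i < rnk A" for i
    using smooth_fun_on_subset[OF assms(2), of _ "U \<inter> W"] c(1) that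
    by (intro smooth_fun_on_sum smooth_fun_on_mult) auto
  ultimately show "\<exists>c. (\<forall>i<rnk A. smooth_fun_on A (U \<inter> W) (c i)) \<and>
        (\<forall>q\<in>U \<inter> W. (\<Sum>j\<in>J. f j q *\<^sub>R s j q) = (\<Sum>i<rnk A. c i q *\<^sub>R e i q))"
    by (intro exI[of _ "\<lambda>i q. \<Sum>j\<in>J. f j q * c j i q"]) simp
qed (intro lincomb_in_fibre smooth_section_onD(1)[OF assms(1)])

lemma section_in_fibre: "X \<in> sections A \<Longrightarrow> X p \<in> fibre A p"
  unfolding sections_def using smooth_section_onD(1) by blast

lemma smooth_funs_on: "f \<in> smooth_funs A \<Longrightarrow> smooth_fun_on A W f"
  unfolding smooth_funs_def using smooth_fun_on_subset by blast

lemma sections_lincomb: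
  "(\<And>j. j \<in> J \<Longrightarrow> X j \<in> sections A) \<Longrightarrow> (\<And>j. j \<in> J \<Longrightarrow> f j \<in> smooth_funs A)
    \<Longrightarrow> (\<lambda>p. \<Sum>j\<in>J. f j p *\<^sub>R X j p) \<in> sections A"
  by (simp add: sections_def smooth_funs_def smooth_section_on_lincomb)

lemma sections_scale: "X \<in> sections A \<Longrightarrow> f \<in> smooth_funs A \<Longrightarrow> (\<lambda>p. f p *\<^sub>R X p) \<in> sections A"
  using sections_lincomb[of "{0::nat}" "\<lambda>_. X" "\<lambda>_. f"] by simp

lemma const_smooth_funs [simp]: "(\<lambda>p. c) \<in> smooth_funs A"
  by (simp add: smooth_funs_def)

lemma sections_sum: "(\<And>j. j \<in> J \<Longrightarrow> X j \<in> sections A) \<Longrightarrow> (\<lambda>p. \<Sum>j\<in>J. X j p) \<in> sections A"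
  using sections_lincomb[of J X "\<lambda>_ _. 1"] by simp

lemma sections_add: "X \<in> sections A \<Longrightarrow> Y \<in> sections A \<Longrightarrow> (\<lambda>p. X p + Y p) \<in> sections A"
  using sections_sum[of "{False, True}" "\<lambda>b. if b then Y else X"] by simp

lemma sections_minus: "X \<in> sections A \<Longrightarrow> (\<lambda>p. - X p) \<in> sections A"
  using sections_scale[of X "\<lambda>_. -1"] by simp

lemma sections_diff: "X \<in> sections A \<Longrightarrow> Y \<in> sections A \<Longrightarrow> (\<lambda>p. X p - Y p) \<in> sections A"
  using sections_add[OF _ sections_minus] by simp

lemma sections_0 [simp]: "(\<lambda>p. 0) \<in> sections A"
  using sections_sum[of "{} :: nat set"] by simp

text \<open>Cutting off by a bump function gives global sections that agree with the given ones near
  \<open>p\<close>. A whole family is treated with one neighbourhood \<open>V\<close>, as needed for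
  frames; \<open>decomposes_on\<close> asks for global sections.\<close>

lemma sections_extend:
  assumes "open W" "p \<in> W" "\<And>i. i \<in> I \<Longrightarrow> smooth_section_on A W (s i)"
  obtains X V where "open V" "p \<in> V" "V \<subseteq> W" "\<And>i. i \<in> I \<Longrightarrow> X i \<in> sections A"
    "\<And>i q. q \<in> V \<Longrightarrow> X i q = s i q"
proof -
  obtain \<beta> V K where \<beta>: "\<beta> \<in> smooth_funs A" "open V" "p \<in> V" "V \<subseteq> K" "closed K" "K \<subseteq> W"
    "\<And>q. q \<in> V \<Longrightarrow> \<beta> q = 1" "\<And>q. q \<notin> K \<Longrightarrow> \<beta> q = 0"
    using bump_function[OF assms(1,2)] by metis
  define X where "X i q = (if q \<in> W then \<beta> q *\<^sub>R s i q else 0)" for i q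
  have "smooth_section_on A UNIV (X i)" if "i \<in> I" for i
  proof (rule smooth_section_onI)
    fix q
    show "X i q \<in> fibre A q"
      using smooth_section_onD(1)[OF assms(3)[OF that]] subspace_fibre
      by (auto simp: X_def subspace_0 subspace_scale)
  next
    fix U e assume U: "(U, e) \<in> frames A"
    with smooth_section_onD(2)[OF assms(3)[OF that]]
    obtain c where c: "\<And>i. i < rnk A \<Longrightarrow> smooth_fun_on A (U \<inter> W) (c i)"
      "\<And>q. q \<in> U \<inter> W \<Longrightarrow> s i q = (\<Sum>i<rnk A. c i q *\<^sub>R e i q)"
      by metis
    define c' where "c' i q = (if q \<in> W then \<beta> q * c i q else 0)" for i q
    have "smooth_fun_on A (U \<inter> UNIV) (c' i)" if "i < rnk A" for i
    proof (rule smooth_fun_on_local)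
      fix q assume "q \<in> U \<inter> UNIV"
      \<comment> \<open>The coefficient is a product of smooth functions on
        \<open>U \<inter> W\<close> and identically 0 on \<open>- K\<close>; these two open sets
        cover \<open>U\<close>.\<close>
      then have q: "q \<in> U \<inter> W \<or> q \<in> - K" using \<beta>(6) by blast
      have "smooth_fun_on A (U \<inter> W) (c' i)"
        by (rule smooth_fun_on_cong[OF _ smooth_fun_on_mult[OF smooth_funs_on[OF \<beta>(1)] c(1)[OF that]]])
           (use frame(1)[OF U] assms(1) in \<open>auto simp: c'_def\<close>)
      moreover have "smooth_fun_on A (- K) (c' i)"
        by (rule smooth_fun_on_cong[OF _ smooth_fun_on_const[of _ 0]])
           (use \<beta> in \<open>auto simp: c'_def\<close>)
      ultimately show "\<exists>V. open V \<and> q \<in> V \<and> smooth_fun_on A V (c' i)"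
        using q frame(1)[OF U] assms(1) \<beta>(5) by (metis open_Compl open_Int)
    qed
    moreover have "X i q = (\<Sum>i<rnk A. c' i q *\<^sub>R e i q)" if "q \<in> U" for q
      using c(2)[of q] that by (simp add: X_def c'_def scaleR_sum_right)
    ultimately show "\<exists>c. (\<forall>i<rnk A. smooth_fun_on A (U \<inter> UNIV) (c i)) \<and>
        (\<forall>q\<in>U \<inter> UNIV. X i q = (\<Sum>i<rnk A. c i q *\<^sub>R e i q))"
      by (intro exI[of _ c']) simp
  qed
  then have "\<And>i. i \<in> I \<Longrightarrow> X i \<in> sections A" by (simp add: sections_def)
  moreover have VW: "V \<subseteq> W" using \<beta>(4,6) by (rule subset_trans)
  moreover have "X i q = s i q" if "q \<in> V" for i q
    using that VW \<beta>(7) by (auto simp: X_def)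
  ultimately show ?thesis using that \<beta>(2,3) by metis
qed

text \<open>Constant coefficients in a frame give a local section, which is then extended. Pointwise
  identities can thus be tested on global sections.\<close>

lemma section_through:
  assumes "x \<in> fibre A p"
  obtains X where "X \<in> sections A" "X p = x"
proof -
  obtain U e where U: "(U, e) \<in> frames A" "p \<in> U" using frame_cover by blast
  obtain c where c: "x = (\<Sum>i<rnk A. c i *\<^sub>R e i p)" using frame_coords[OF U assms] by blast
  have "smooth_section_on A U (\<lambda>q. \<Sum>i<rnk A. c i *\<^sub>R e i q)"
    by (rule smooth_section_on_lincomb) (auto intro: frame(2)[OF U(1)])
  then show ?thesis
    using sections_extend[OF frame(1)[OF U(1)] U(2), of "{0::nat}" "\<lambda>_ q. \<Sum>i<rnk A. c i *\<^sub>R e i q"] c that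
    by (metis singletonI)
qed

lemma smooth_cosection_onI:
  assumes "\<And>p. p \<in> W \<Longrightarrow> \<alpha> p \<in> dual_fibre A p"
    "\<And>U e i. (U, e) \<in> frames A \<Longrightarrow> i < rnk A \<Longrightarrow> smooth_fun_on A (U \<inter> W) (\<lambda>p. \<alpha> p (e i p))"
  shows "smooth_cosection_on A W \<alpha>"
  using assms unfolding smooth_cosection_on_def by auto

lemma smooth_cosection_onD:
  assumes "smooth_cosection_on A W \<alpha>"
  shows "p \<in> W \<Longrightarrow> \<alpha> p \<in> dual_fibre A p"
    "(U, e) \<in> frames A \<Longrightarrow> i < rnk A \<Longrightarrow> smooth_fun_on A (U \<inter> W) (\<lambda>p. \<alpha> p (e i p))"
  using assms unfolding smooth_cosection_on_def by fast+

lemma cosection_in_dual: "\<alpha> \<in> cosections A \<Longrightarrow> \<alpha> p \<in> dual_fibre A p"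
  unfolding cosections_def using smooth_cosection_onD(1) by blast

lemma smooth_pairing:
  assumes W: "open W" and \<alpha>: "smooth_cosection_on A W \<alpha>" and X: "smooth_section_on A W X"
  shows "smooth_fun_on A W (\<lambda>p. \<alpha> p (X p))"
proof (rule smooth_fun_on_local)
  fix p assume "p \<in> W"
  obtain U e where U: "(U, e) \<in> frames A" "p \<in> U" using frame_cover by blast
  then obtain c where c: "\<And>i. i < rnk A \<Longrightarrow> smooth_fun_on A (U \<inter> W) (c i)"
    "\<And>q. q \<in> U \<inter> W \<Longrightarrow> X q = (\<Sum>i<rnk A. c i q *\<^sub>R e i q)"
    using smooth_section_onD(2)[OF X] by metis
  have o: "open (U \<inter> W)" using frame(1)[OF U(1)] W by blast
  have "smooth_fun_on A (U \<inter> W) (\<lambda>p. \<Sum>i<rnk A. c i p * \<alpha> p (e i p))"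
    using c(1) smooth_cosection_onD(2)[OF \<alpha> U(1)] by (intro smooth_fun_on_sum smooth_fun_on_mult) auto
  then have "smooth_fun_on A (U \<inter> W) (\<lambda>p. \<alpha> p (X p))"
    by (rule smooth_fun_on_cong[OF o])
       (use c(2) dual_lincomb[OF U(1) _ smooth_cosection_onD(1)[OF \<alpha>]] in auto)
  then show "\<exists>V. open V \<and> p \<in> V \<and> smooth_fun_on A V (\<lambda>p. \<alpha> p (X p))"
    using o U(2) \<open>p \<in> W\<close> by blast
qed

lemma pairing_smooth_funs:
  "\<alpha> \<in> cosections A \<Longrightarrow> X \<in> sections A \<Longrightarrow> (\<lambda>p. \<alpha> p (X p)) \<in> smooth_funs A"
  unfolding cosections_def sections_def smooth_funs_def by (simp add: smooth_pairing)

text \<open>Every vector of a fibre is the value of a section, and off the fibre both sides are 0.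
  This provides the uniqueness behind the definite description in
  \<open>dorfman_bracket\<close>.\<close>

lemma cosections_eqI:
  assumes "\<alpha> \<in> cosections A" "\<beta> \<in> cosections A"
    "\<And>X p. X \<in> sections A \<Longrightarrow> \<alpha> p (X p) = \<beta> p (X p)"
  shows "\<alpha> = \<beta>"
proof (intro ext)
  fix p x show "\<alpha> p x = \<beta> p x"
  proof (cases "x \<in> fibre A p")
    case True
    then show ?thesis using section_through assms(3) by metis
  next
    case False
    then show ?thesis using cosection_in_dual[OF assms(1)] cosection_in_dual[OF assms(2)] dual_space_outside
      by metis
  qed
qed

end

section \<open>Non-degenerate forms and bivectors\<close>

lemma dual_space_lincombI:
  assumes "\<And>i. i \<in> I \<Longrightarrow> \<xi> i \<in> dual_space V"
  shows "(\<lambda>v. \<Sum>i\<in>I. c i * \<xi> i v) \<in> dual_space V"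
  using assms unfolding dual_space_def
  by (auto simp: distrib_left sum.distrib sum_distrib_left mult_ac intro!: sum.cong)

lemma dual_space_uminusI: "\<xi> \<in> dual_space V \<Longrightarrow> (\<lambda>v. - \<xi> v) \<in> dual_space V"
  by (auto simp: dual_space_def)

text \<open>The minus sign cancels the one in \<open>flat\<close>, so that for non-degenerate
  \<open>P\<close> the bundle map of this form is the inverse of \<open>sharp A P p\<close>. Only
  \<open>x\<close> is guarded: as a function of \<open>y\<close> the inverse image is a functional
  that already vanishes off the fibre.\<close>

definition inverse_form ::
  "('m::{t2_space, second_countable_topology}, 'e::real_inner, 'v::real_vector) algebroid_data
   \<Rightarrow> ('m, 'v) bivector \<Rightarrow> ('m, 'v) two_form" where
  "inverse_form A P p x y =
     (if x \<in> fibre A p then - the_inv_into (dual_fibre A p) (sharp A P p) x y else 0)"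

context smooth_bundle begin

lemma dual_lincombI:
  "(\<And>i. i \<in> I \<Longrightarrow> \<xi> i \<in> dual_fibre A p) \<Longrightarrow> (\<lambda>v. \<Sum>i\<in>I. c i * \<xi> i v) \<in> dual_fibre A p"
  by (rule dual_space_lincombI)

lemma form_dual:
  assumes "\<omega> \<in> two_forms A"
  shows "\<omega> p x \<in> dual_fibre A p" "(\<lambda>x. \<omega> p x y) \<in> dual_fibre A p" "\<omega> p x x = 0"
proof -
  have "\<omega> p \<in> alternating_forms (fibre A p)" using assms by (simp add: two_forms_def)
  then show "\<omega> p x \<in> dual_fibre A p" "(\<lambda>x. \<omega> p x y) \<in> dual_fibre A p" "\<omega> p x x = 0"
    by (simp_all add: alternating_forms_def)
qed

lemma form_skew:
  assumes "\<omega> \<in> two_forms A"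
  shows "\<omega> p x y = - \<omega> p y x"
proof (cases "x \<in> fibre A p \<and> y \<in> fibre A p")
  case True
  have "0 = \<omega> p (x + y) (x + y)" using form_dual(3)[OF assms] by simp
  also have "\<dots> = \<omega> p x (x + y) + \<omega> p y (x + y)"
    using dual_space_add[OF form_dual(2)[OF assms]] True by simp
  also have "\<dots> = \<omega> p x y + \<omega> p y x"
    using dual_space_add[OF form_dual(1)[OF assms]] True form_dual(3)[OF assms] by simp
  finally show ?thesis by simp
next
  case False
  then show ?thesis
    using dual_space_outside[OF form_dual(1)[OF assms]] dual_space_outside[OF form_dual(2)[OF assms]] by force
qed

lemma flat_dual: "\<omega> \<in> two_forms A \<Longrightarrow> flat \<omega> p x \<in> dual_fibre A p"
  unfolding flat_def by (intro dual_space_uminusI form_dual)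

lemma flat_lincomb:
  assumes "\<omega> \<in> two_forms A" "\<And>i. i \<in> I \<Longrightarrow> f i \<in> fibre A p"
  shows "flat \<omega> p (\<Sum>i\<in>I. c i *\<^sub>R f i) = (\<lambda>y. \<Sum>i\<in>I. c i * flat \<omega> p (f i) y)"
proof
  fix y
  show "flat \<omega> p (\<Sum>i\<in>I. c i *\<^sub>R f i) y = (\<Sum>i\<in>I. c i * flat \<omega> p (f i) y)"
    using dual_space_lincomb[OF form_dual(2)[OF assms(1), of p y] subspace_fibre, of I f c] assms(2)
    by (simp add: flat_def sum_negf)
qed

lemma two_form_smooth:
  assumes "\<omega> \<in> two_forms A" "(U, e) \<in> frames A" "i < rnk A" "j < rnk A"
  shows "smooth_fun_on A U (\<lambda>p. \<omega> p (e i p) (e j p))"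
  using assms unfolding two_forms_def by fast

lemma flat_cosection_on:
  assumes W: "open W" and \<omega>: "\<omega> \<in> two_forms A" and X: "smooth_section_on A W X"
  shows "smooth_cosection_on A W (\<lambda>p. flat \<omega> p (X p))"
proof (rule smooth_cosection_onI)
  show "flat \<omega> p (X p) \<in> dual_fibre A p" for p by (rule flat_dual[OF \<omega>])
next
  fix U e j assume U: "(U, e) \<in> frames A" and j: "j < rnk A"
  from smooth_section_onD(2)[OF X U]
  obtain c where c: "\<And>i. i < rnk A \<Longrightarrow> smooth_fun_on A (U \<inter> W) (c i)"
    "\<And>q. q \<in> U \<inter> W \<Longrightarrow> X q = (\<Sum>i<rnk A. c i q *\<^sub>R e i q)" by metis
  have "smooth_fun_on A (U \<inter> W) (\<lambda>p. \<omega> p (e i p) (e j p))" if "i < rnk A" for i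
    by (rule smooth_fun_on_subset[OF two_form_smooth[OF \<omega> U that j]]) simp
  then have "smooth_fun_on A (U \<inter> W) (\<lambda>p. \<Sum>i<rnk A. c i p * - \<omega> p (e i p) (e j p))"
    using c(1) by (intro smooth_fun_on_sum smooth_fun_on_mult smooth_fun_on_minus) auto
  then show "smooth_fun_on A (U \<inter> W) (\<lambda>p. flat \<omega> p (X p) (e j p))"
  proof (rule smooth_fun_on_cong[rotated])
    fix p assume p: "p \<in> U \<inter> W"
    then show "(\<Sum>i<rnk A. c i p * - \<omega> p (e i p) (e j p)) = flat \<omega> p (X p) (e j p)"
      using flat_lincomb[OF \<omega>, of "{..<rnk A}" "\<lambda>i. e i p" p "\<lambda>i. c i p"] c(2)[OF p] frame_in_fibre[OF U, of p]
      by (simp add: flat_def)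
  qed (use frame(1)[OF U] W in blast)
qed

lemma flat_cosection: "\<omega> \<in> two_forms A \<Longrightarrow> X \<in> sections A \<Longrightarrow> (\<lambda>p. flat \<omega> p (X p)) \<in> cosections A"
  unfolding sections_def cosections_def using flat_cosection_on[of UNIV \<omega> X] by simp

lemma form_smooth_funs:
  assumes "\<omega> \<in> two_forms A" "X \<in> sections A" "Y \<in> sections A"
  shows "(\<lambda>p. \<omega> p (X p) (Y p)) \<in> smooth_funs A"
  using pairing_smooth_funs[OF flat_cosection[OF assms(1,3)] assms(2)] form_skew[OF assms(1), of _ "X _" "Y _"]
  by (simp add: flat_def)

text \<open>The frame coordinates of \<open>X\<close> solve a linear system whose matrix consists of
  the values of \<omega> on the frame and whose right-hand side consists of those of \<xi>. A
  solution of the homogeneous system is a vector annihilated by \<open>flat \<omega> q\<close>,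
  hence 0 by non-degeneracy.\<close>

lemma smooth_section_on_of_flat:
  assumes W: "open W" and \<omega>: "\<omega> \<in> two_forms A" and nd: "nondegenerate_form A \<omega>"
    and \<xi>: "smooth_cosection_on A W \<xi>"
    and X: "\<And>p. p \<in> W \<Longrightarrow> X p \<in> fibre A p" "\<And>p. p \<in> W \<Longrightarrow> flat \<omega> p (X p) = \<xi> p"
  shows "smooth_section_on A W X"
proof (rule smooth_section_onI)
  fix U e assume U: "(U, e) \<in> frames A"
  let ?k = "rnk A"
  have "\<exists>c. \<forall>q\<in>U \<inter> W. X q = (\<Sum>i<?k. c q i *\<^sub>R e i q)"
    by (intro bchoice ballI frame_coords[OF U]) (use X(1) in auto)
  then obtain c where c: "\<And>q. q \<in> U \<inter> W \<Longrightarrow> X q = (\<Sum>i<?k. c q i *\<^sub>R e i q)" by metis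
  \<comment> \<open>Evaluation on \<open>e i q\<close> yields row \<open>i\<close> of the system;
    since the vector enters the first slot of \<omega>, the entry in column \<open>j\<close> is
    \<open>- \<omega> q (e j q) (e i q)\<close>.\<close>
  have fl: "flat \<omega> q (\<Sum>i<?k. d i *\<^sub>R e i q) (e i q) = (\<Sum>j<?k. - \<omega> q (e j q) (e i q) * d j)"
    if "q \<in> U \<inter> W" for q d i
    using flat_lincomb[OF \<omega>, of "{..<?k}" "\<lambda>i. e i q" q d] frame_in_fibre[OF U, of q] that
    by (simp add: flat_def mult.commute)
  have "smooth_fun_on A (U \<inter> W) (\<lambda>q. c q i)" if "i < ?k" for i
  proof (rule smooth_linear_system[of _ ?k "\<lambda>i j q. - \<omega> q (e j q) (e i q)" "\<lambda>i q. \<xi> q (e i q)"])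
    show "open (U \<inter> W)" using frame(1)[OF U] W by blast
    show "smooth_fun_on A (U \<inter> W) (\<lambda>q. - \<omega> q (e j q) (e i q))" if "i < ?k" "j < ?k" for i j
      by (rule smooth_fun_on_minus smooth_fun_on_subset[OF two_form_smooth[OF \<omega> U that(2,1)]])+ simp
    show "smooth_fun_on A (U \<inter> W) (\<lambda>q. \<xi> q (e i q))" if "i < ?k" for i
      by (rule smooth_cosection_onD(2)[OF \<xi> U that])
    show "(\<Sum>j<?k. - \<omega> q (e j q) (e i q) * c q j) = \<xi> q (e i q)" if "q \<in> U \<inter> W" "i < ?k" for q i
      using fl[OF that(1), of "c q" i] c[OF that(1)] X(2)[of q] that by simp
    show "d j = 0" if q: "q \<in> U \<inter> W" and d: "\<And>i. i < ?k \<Longrightarrow> (\<Sum>j<?k. - \<omega> q (e j q) (e i q) * d j) = 0"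
      and j: "j < ?k" for q d j
    proof -
      have qU: "q \<in> U" using q by simp
      let ?x = "\<Sum>i<?k. d i *\<^sub>R e i q"
      have x: "?x \<in> fibre A q" by (rule lincomb_in_fibre) (simp add: frame_in_fibre[OF U qU])
      have "flat \<omega> q ?x = flat \<omega> q 0"
      proof (rule dual_eqI[OF U qU flat_dual[OF \<omega>] flat_dual[OF \<omega>]])
        fix i assume "i < ?k"
        then show "flat \<omega> q ?x (e i q) = flat \<omega> q 0 (e i q)"
          using fl[OF q, of d i] d fl[OF q, of "\<lambda>_. 0" i] by simp
      qed
      then have "?x = 0"
        using nd x subspace_0[OF subspace_fibre] unfolding nondegenerate_form_def bij_betw_def
        by (meson inj_onD)
      then show ?thesis using frame_coords_0[OF U qU] j by blast
    qed
  qed (rule that)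
  then show "\<exists>c. (\<forall>i<?k. smooth_fun_on A (U \<inter> W) (c i)) \<and>
        (\<forall>q\<in>U \<inter> W. X q = (\<Sum>i<?k. c i q *\<^sub>R e i q))"
    using c by (intro exI[of _ "\<lambda>i q. c q i"]) simp
qed (rule X)

text \<open>Smoothness must be tested against every frame of the bundle: the value of a dual
  covector on a vector of another frame is a transition coefficient, and these are smooth because
  frames consist of smooth sections.\<close>

lemma dual_frame:
  assumes U: "(U, e) \<in> frames A"
  obtains \<epsilon> where "\<And>i. i < rnk A \<Longrightarrow> smooth_cosection_on A U (\<epsilon> i)"
    "\<And>p i j. p \<in> U \<Longrightarrow> i < rnk A \<Longrightarrow> j < rnk A \<Longrightarrow> \<epsilon> i p (e j p) = (if i = j then 1 else 0)"
proof -
  have "\<exists>\<epsilon>. \<forall>p\<in>U. (\<forall>i<rnk A. \<epsilon> p i \<in> dual_fibre A p) \<and>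
      (\<forall>i<rnk A. \<forall>j<rnk A. \<epsilon> p i (e j p) = (if i = j then 1 else 0))"
  proof (intro bchoice ballI)
    fix p assume p: "p \<in> U"
    show "\<exists>\<epsilon>. (\<forall>i<rnk A. \<epsilon> i \<in> dual_fibre A p) \<and>
      (\<forall>i<rnk A. \<forall>j<rnk A. \<epsilon> i (e j p) = (if i = j then 1 else 0))"
      by (rule dual_basis[OF U p]) (intro exI conjI allI impI)
  qed
  then obtain \<epsilon> where \<epsilon>: "\<And>p i. p \<in> U \<Longrightarrow> i < rnk A \<Longrightarrow> \<epsilon> p i \<in> dual_fibre A p"
    "\<And>p i j. p \<in> U \<Longrightarrow> i < rnk A \<Longrightarrow> j < rnk A \<Longrightarrow> \<epsilon> p i (e j p) = (if i = j then 1 else 0)"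
    by metis
  have "smooth_cosection_on A U (\<lambda>p. \<epsilon> p i)" if i: "i < rnk A" for i
  proof (rule smooth_cosection_onI)
    fix V f j assume V: "(V, f) \<in> frames A" and j: "j < rnk A"
    from smooth_section_onD(2)[OF frame(2)[OF V j] U]
    obtain c where c: "\<And>i. i < rnk A \<Longrightarrow> smooth_fun_on A (U \<inter> V) (c i)"
      "\<And>q. q \<in> U \<inter> V \<Longrightarrow> f j q = (\<Sum>i<rnk A. c i q *\<^sub>R e i q)" by metis
    have "\<epsilon> q i (f j q) = c i q" if q: "q \<in> U \<inter> V" for q
    proof -
      have qU: "q \<in> U" using q by simp
      have "\<epsilon> q i (f j q) = (\<Sum>l<rnk A. c l q * \<epsilon> q i (e l q))"
        unfolding c(2)[OF q] by (rule dual_lincomb[OF U qU \<epsilon>(1)[OF qU i]])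
      also have "\<dots> = (\<Sum>l<rnk A. if l = i then c i q else 0)"
        using \<epsilon>(2)[OF qU i] by (intro sum.cong) auto
      finally show ?thesis using i by simp
    qed
    moreover have "open (U \<inter> V)" using frame(1)[OF U] frame(1)[OF V] by blast
    ultimately have "smooth_fun_on A (U \<inter> V) (\<lambda>p. \<epsilon> p i (f j p))"
      using smooth_fun_on_cong[OF _ c(1)[OF i], of "\<lambda>q. \<epsilon> q i (f j q)"] by simp
    then show "smooth_fun_on A (V \<inter> U) (\<lambda>p. \<epsilon> p i (f j p))" by (simp add: Int_commute)
  qed (rule \<epsilon>(1)[OF _ i])
  then show ?thesis by (rule that[of "\<lambda>i p. \<epsilon> p i"]) (simp_all add: \<epsilon>(2))
qed

lemma sharp_eqI:
  assumes "x \<in> fibre A p" "\<And>\<eta>. \<eta> \<in> dual_fibre A p \<Longrightarrow> \<eta> x = P p \<xi> \<eta>"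
  shows "sharp A P p \<xi> = x"
  unfolding sharp_def using assms fibre_eqI by (intro the_equality) auto

lemma inverse_bivector_flat:
  assumes "\<omega> \<in> two_forms A" "nondegenerate_form A \<omega>" "x \<in> fibre A p" "\<eta> \<in> dual_fibre A p"
  shows "inverse_bivector A \<omega> p (flat \<omega> p x) \<eta> = \<eta> x"
proof -
  have "inj_on (flat \<omega> p) (fibre A p)"
    using assms(2) by (simp add: nondegenerate_form_def bij_betw_def)
  then show ?thesis
    using assms flat_dual[OF assms(1)] by (simp add: inverse_bivector_def the_inv_into_f_f)
qed

lemma sharp_inverse_flat:
  assumes "\<omega> \<in> two_forms A" "nondegenerate_form A \<omega>" "x \<in> fibre A p"
  shows "sharp A (inverse_bivector A \<omega>) p (flat \<omega> p x) = x"
  using assms by (intro sharp_eqI) (auto simp: inverse_bivector_flat)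

lemma flat_surj:
  assumes "nondegenerate_form A \<omega>" "\<xi> \<in> dual_fibre A p"
  obtains x where "x \<in> fibre A p" "flat \<omega> p x = \<xi>"
proof -
  have "\<xi> \<in> flat \<omega> p ` fibre A p" using assms by (simp add: nondegenerate_form_def bij_betw_def)
  then show ?thesis using that by (metis imageE)
qed

lemma sharp_inverse:
  assumes "\<omega> \<in> two_forms A" "nondegenerate_form A \<omega>" "\<xi> \<in> dual_fibre A p"
  shows "sharp A (inverse_bivector A \<omega>) p \<xi> \<in> fibre A p"
    "flat \<omega> p (sharp A (inverse_bivector A \<omega>) p \<xi>) = \<xi>"
proof -
  obtain x where "x \<in> fibre A p" "flat \<omega> p x = \<xi>" using flat_surj[OF assms(2,3)] .
  then show "sharp A (inverse_bivector A \<omega>) p \<xi> \<in> fibre A p"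
    "flat \<omega> p (sharp A (inverse_bivector A \<omega>) p \<xi>) = \<xi>"
    using sharp_inverse_flat[OF assms(1,2)] by auto
qed

lemma nondegenerate_inverse_bivector:
  assumes "\<omega> \<in> two_forms A" "nondegenerate_form A \<omega>"
  shows "nondegenerate_bivector A (inverse_bivector A \<omega>)"
  unfolding nondegenerate_bivector_def
proof
  fix p
  show "bij_betw (sharp A (inverse_bivector A \<omega>) p) (dual_fibre A p) (fibre A p)"
    by (rule bij_betw_byWitness[of _ "flat \<omega> p"])
       (use sharp_inverse[OF assms] sharp_inverse_flat[OF assms] flat_dual[OF assms(1)] in auto)
qed

text \<open>The coefficients are the coordinates of the images of the dual frame under the inverse
  bundle map, smooth by \<open>smooth_section_on_of_flat\<close>. The bivector is alternating
  because its value on \<open>flat \<omega> p x\<close> twice is - \<omega>(x, x).\<close>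

lemma inverse_bivector_in_bivectors:
  assumes \<omega>: "\<omega> \<in> two_forms A" and nd: "nondegenerate_form A \<omega>"
  shows "inverse_bivector A \<omega> \<in> bivectors A"
proof -
  let ?P = "inverse_bivector A \<omega>" and ?k = "rnk A"
  have "?P p \<xi> \<xi> = 0" if \<xi>: "\<xi> \<in> dual_fibre A p" for p \<xi>
  proof -
    obtain x where x: "x \<in> fibre A p" "flat \<omega> p x = \<xi>" using flat_surj[OF nd \<xi>] .
    then have "?P p \<xi> \<xi> = flat \<omega> p x x"
      using inverse_bivector_flat[OF \<omega> nd x(1) \<xi>] by simp
    then show ?thesis using form_dual(3)[OF \<omega>] by (simp add: flat_def)
  qed
  moreover have "\<exists>c. (\<forall>i<?k. \<forall>j<?k. smooth_fun_on A U (c i j)) \<and>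
        (\<forall>p\<in>U. \<forall>\<xi>\<in>dual_fibre A p. \<forall>\<eta>\<in>dual_fibre A p.
           ?P p \<xi> \<eta> = (\<Sum>i<?k. \<Sum>j<?k. c i j p * \<xi> (e i p) * \<eta> (e j p)))"
    if U: "(U, e) \<in> frames A" for U e
  proof -
    obtain \<epsilon> where \<epsilon>: "\<And>i. i < ?k \<Longrightarrow> smooth_cosection_on A U (\<epsilon> i)"
      "\<And>p i j. p \<in> U \<Longrightarrow> i < ?k \<Longrightarrow> j < ?k \<Longrightarrow> \<epsilon> i p (e j p) = (if i = j then 1 else 0)"
      using dual_frame[OF U] by metis
    define X where "X i p = sharp A ?P p (\<epsilon> i p)" for i p
    have X: "X i p \<in> fibre A p" "flat \<omega> p (X i p) = \<epsilon> i p" if "i < ?k" "p \<in> U" for i p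
      using sharp_inverse[OF \<omega> nd smooth_cosection_onD(1)[OF \<epsilon>(1)]] that by (auto simp: X_def)
    have "smooth_section_on A U (X i)" if "i < ?k" for i
      using smooth_section_on_of_flat[OF frame(1)[OF U] \<omega> nd \<epsilon>(1)[OF that]] X[OF that] by simp
    then have "\<exists>c. \<forall>i\<in>{..<?k}. (\<forall>j<?k. smooth_fun_on A (U \<inter> U) (c i j)) \<and>
        (\<forall>q\<in>U \<inter> U. X i q = (\<Sum>j<?k. c i j q *\<^sub>R e j q))"
      by (intro bchoice ballI smooth_section_onD(2)[OF _ U]) simp
    then obtain c where c: "\<And>i j. i < ?k \<Longrightarrow> j < ?k \<Longrightarrow> smooth_fun_on A U (c i j)"
      "\<And>i q. i < ?k \<Longrightarrow> q \<in> U \<Longrightarrow> X i q = (\<Sum>j<?k. c i j q *\<^sub>R e j q)"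
      by auto
    have "?P p \<xi> \<eta> = (\<Sum>i<?k. \<Sum>j<?k. c i j p * \<xi> (e i p) * \<eta> (e j p))"
      if p: "p \<in> U" and \<xi>: "\<xi> \<in> dual_fibre A p" and \<eta>: "\<eta> \<in> dual_fibre A p" for p \<xi> \<eta>
    proof -
      \<comment> \<open>Since \<xi> is the combination of the dual frame with coefficients
        \<open>\<xi> (e i p)\<close>, this is its image under the inverse bundle map.\<close>
      let ?x = "\<Sum>i<?k. \<xi> (e i p) *\<^sub>R X i p"
      have x: "?x \<in> fibre A p" by (rule lincomb_in_fibre) (simp add: X p)
      have "flat \<omega> p ?x = \<xi>"
      proof (rule dual_eqI[OF U p flat_dual[OF \<omega>] \<xi>])
        fix j assume j: "j < ?k"
        have "flat \<omega> p ?x (e j p) = (\<Sum>i<?k. \<xi> (e i p) * flat \<omega> p (X i p) (e j p))"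
          by (subst flat_lincomb[OF \<omega>]) (auto simp: X p)
        also have "\<dots> = (\<Sum>i<?k. if i = j then \<xi> (e j p) else 0)"
          using \<epsilon>(2)[OF p] X p j by (intro sum.cong) auto
        finally show "flat \<omega> p ?x (e j p) = \<xi> (e j p)" using j by simp
      qed
      then have "?P p \<xi> \<eta> = \<eta> ?x" using inverse_bivector_flat[OF \<omega> nd x \<eta>] by simp
      also have "\<dots> = (\<Sum>i<?k. \<xi> (e i p) * \<eta> (X i p))"
        by (rule dual_space_lincomb[OF \<eta> subspace_fibre]) (simp add: X p)
      also have "\<dots> = (\<Sum>i<?k. \<Sum>j<?k. c i j p * \<xi> (e i p) * \<eta> (e j p))"
        using c(2) p dual_lincomb[OF U p \<eta>]
        by (intro sum.cong) (auto simp: sum_distrib_left mult_ac)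
      finally show ?thesis .
    qed
    then show ?thesis using c(1) by (intro exI[of _ c]) simp
  qed
  ultimately show ?thesis
    unfolding bivectors_def by (auto simp: inverse_bivector_def)
qed

text \<open>The bivector determines its \<open>sharp\<close>, whose inverse is \<open>flat\<close>;
  off the fibre both forms are 0.\<close>

lemma inverse_bivector_inj:
  assumes \<omega>: "\<omega> \<in> two_forms A" "nondegenerate_form A \<omega>"
    and \<omega>': "\<omega>' \<in> two_forms A" "nondegenerate_form A \<omega>'"
    and eq: "inverse_bivector A \<omega> = inverse_bivector A \<omega>'"
  shows "\<omega> = \<omega>'"
proof (intro ext)
  fix p x y
  show "\<omega> p x y = \<omega>' p x y"
  proof (cases "x \<in> fibre A p")
    case True
    then have "flat \<omega>' p x = flat \<omega> p x"
      using sharp_inverse(2)[OF \<omega>' flat_dual[OF \<omega>(1)], of p x] sharp_inverse_flat[OF \<omega> True] eq by simp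
    then show ?thesis unfolding flat_def by (metis neg_equal_iff_equal)
  next
    case False
    then show ?thesis
      using dual_space_outside[OF form_dual(2)[OF \<omega>(1)]] dual_space_outside[OF form_dual(2)[OF \<omega>'(1)]]
      by metis
  qed
qed

end

section \<open>Bundle maps of bivectors and the forms inverse to them\<close>

context smooth_bundle begin

lemma bivector_frame:
  assumes "P \<in> bivectors A" "(U, e) \<in> frames A"
  obtains c where "\<And>i j. i < rnk A \<Longrightarrow> j < rnk A \<Longrightarrow> smooth_fun_on A U (c i j)"
    "\<And>p \<xi> \<eta>. p \<in> U \<Longrightarrow> \<xi> \<in> dual_fibre A p \<Longrightarrow> \<eta> \<in> dual_fibre A p \<Longrightarrow>
       P p \<xi> \<eta> = (\<Sum>i<rnk A. \<Sum>j<rnk A. c i j p * \<xi> (e i p) * \<eta> (e j p))"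
proof -
  have "\<forall>(U, e)\<in>frames A. \<exists>c. (\<forall>i<rnk A. \<forall>j<rnk A. smooth_fun_on A U (c i j)) \<and>
        (\<forall>p\<in>U. \<forall>\<xi>\<in>dual_fibre A p. \<forall>\<eta>\<in>dual_fibre A p.
           P p \<xi> \<eta> = (\<Sum>i<rnk A. \<Sum>j<rnk A. c i j p * \<xi> (e i p) * \<eta> (e j p)))"
    using assms(1) by (simp add: bivectors_def)
  from bspec[OF this assms(2)] obtain c where
    "(\<forall>i<rnk A. \<forall>j<rnk A. smooth_fun_on A U (c i j)) \<and>
        (\<forall>p\<in>U. \<forall>\<xi>\<in>dual_fibre A p. \<forall>\<eta>\<in>dual_fibre A p.
           P p \<xi> \<eta> = (\<Sum>i<rnk A. \<Sum>j<rnk A. c i j p * \<xi> (e i p) * \<eta> (e j p)))"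
    by auto
  then show ?thesis by (intro that[of c]) simp_all
qed

lemma bivector_at:
  assumes P: "P \<in> bivectors A" and U: "(U, e) \<in> frames A" "p \<in> U"
  obtains c where "\<And>\<xi> \<eta>. \<xi> \<in> dual_fibre A p \<Longrightarrow> \<eta> \<in> dual_fibre A p \<Longrightarrow>
       P p \<xi> \<eta> = (\<Sum>i<rnk A. \<Sum>j<rnk A. c i j * \<xi> (e i p) * \<eta> (e j p))"
proof (rule bivector_frame[OF P U(1)])
  fix c assume "\<And>p \<xi> \<eta>. p \<in> U \<Longrightarrow> \<xi> \<in> dual_fibre A p \<Longrightarrow> \<eta> \<in> dual_fibre A p \<Longrightarrow>
       P p \<xi> \<eta> = (\<Sum>i<rnk A. \<Sum>j<rnk A. c i j p * \<xi> (e i p) * \<eta> (e j p))"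
  from this[OF U(2)] show ?thesis by (rule that)
qed

lemma bivector_alternating: "P \<in> bivectors A \<Longrightarrow> \<xi> \<in> dual_fibre A p \<Longrightarrow> P p \<xi> \<xi> = 0"
  by (simp add: bivectors_def)

lemma bivector_outside: "P \<in> bivectors A \<Longrightarrow> \<xi> \<notin> dual_fibre A p \<or> \<eta> \<notin> dual_fibre A p \<Longrightarrow> P p \<xi> \<eta> = 0"
  by (auto simp: bivectors_def)

lemma bivector_lincomb:
  assumes P: "P \<in> bivectors A" and \<xi>: "\<And>i. i \<in> I \<Longrightarrow> \<xi> i \<in> dual_fibre A p" and \<eta>: "\<eta> \<in> dual_fibre A p"
  shows "P p (\<lambda>v. \<Sum>i\<in>I. d i * \<xi> i v) \<eta> = (\<Sum>i\<in>I. d i * P p (\<xi> i) \<eta>)"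
proof -
  let ?k = "rnk A"
  obtain U e where U: "(U, e) \<in> frames A" "p \<in> U" using frame_cover by blast
  obtain c where c: "\<And>\<xi> \<eta>. \<xi> \<in> dual_fibre A p \<Longrightarrow> \<eta> \<in> dual_fibre A p \<Longrightarrow>
       P p \<xi> \<eta> = (\<Sum>i<?k. \<Sum>j<?k. c i j * \<xi> (e i p) * \<eta> (e j p))"
    using bivector_at[OF P U] by blast
  have L: "(\<lambda>v. \<Sum>i\<in>I. d i * \<xi> i v) \<in> dual_fibre A p" by (rule dual_lincombI) (rule \<xi>)
  have "P p (\<lambda>v. \<Sum>i\<in>I. d i * \<xi> i v) \<eta>
      = (\<Sum>k<?k. \<Sum>j<?k. \<Sum>i\<in>I. d i * (c k j * \<xi> i (e k p) * \<eta> (e j p)))"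
    unfolding c[OF L \<eta>]
    by (simp add: sum_distrib_left sum_distrib_right mult_ac)
  also have "\<dots> = (\<Sum>k<?k. \<Sum>i\<in>I. \<Sum>j<?k. d i * (c k j * \<xi> i (e k p) * \<eta> (e j p)))"
    by (intro sum.cong[OF refl] sum.swap)
  also have "\<dots> = (\<Sum>i\<in>I. \<Sum>k<?k. \<Sum>j<?k. d i * (c k j * \<xi> i (e k p) * \<eta> (e j p)))"
    by (rule sum.swap)
  also have "\<dots> = (\<Sum>i\<in>I. d i * P p (\<xi> i) \<eta>)"
    using c[OF \<xi> \<eta>] by (simp add: sum_distrib_left)
  finally show ?thesis .
qed

text \<open>Polarization of \<open>P p \<xi> \<xi> = 0\<close>; the coefficient formula in a frame
  supplies the bilinearity.\<close>

lemma bivector_skew: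
  assumes P: "P \<in> bivectors A" and \<xi>: "\<xi> \<in> dual_fibre A p" and \<eta>: "\<eta> \<in> dual_fibre A p"
  shows "P p \<xi> \<eta> = - P p \<eta> \<xi>"
proof -
  let ?k = "rnk A" and ?s = "\<lambda>v. \<xi> v + \<eta> v"
  obtain U e where U: "(U, e) \<in> frames A" "p \<in> U" using frame_cover by blast
  obtain c where c: "\<And>\<xi> \<eta>. \<xi> \<in> dual_fibre A p \<Longrightarrow> \<eta> \<in> dual_fibre A p \<Longrightarrow>
       P p \<xi> \<eta> = (\<Sum>i<?k. \<Sum>j<?k. c i j * \<xi> (e i p) * \<eta> (e j p))"
    using bivector_at[OF P U] by blast
  have s: "?s \<in> dual_fibre A p" using \<xi> \<eta> by (auto simp: dual_space_def algebra_simps)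
  have "0 = P p ?s ?s" using bivector_alternating[OF P s] by simp
  also have "\<dots> = P p \<xi> \<xi> + P p \<xi> \<eta> + P p \<eta> \<xi> + P p \<eta> \<eta>"
    unfolding c[OF s s] c[OF \<xi> \<xi>] c[OF \<xi> \<eta>] c[OF \<eta> \<xi>] c[OF \<eta> \<eta>]
    by (simp add: algebra_simps sum.distrib)
  finally show ?thesis using bivector_alternating[OF P] \<xi> \<eta> by simp
qed

text \<open>The coefficients in a frame give a vector representing \<open>P p \<xi>\<close>
  explicitly, so the definite description in \<open>sharp\<close> has a value for every
  bivector.\<close>

lemma sharp_bivector:
  assumes P: "P \<in> bivectors A" and \<xi>: "\<xi> \<in> dual_fibre A p"
  shows "sharp A P p \<xi> \<in> fibre A p" "\<eta> \<in> dual_fibre A p \<Longrightarrow> \<eta> (sharp A P p \<xi>) = P p \<xi> \<eta>"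
proof -
  let ?k = "rnk A"
  obtain U e where U: "(U, e) \<in> frames A" "p \<in> U" using frame_cover by blast
  obtain c where c: "\<And>\<xi> \<eta>. \<xi> \<in> dual_fibre A p \<Longrightarrow> \<eta> \<in> dual_fibre A p \<Longrightarrow>
       P p \<xi> \<eta> = (\<Sum>i<?k. \<Sum>j<?k. c i j * \<xi> (e i p) * \<eta> (e j p))"
    using bivector_at[OF P U] by blast
  define x where "x = (\<Sum>j<?k. (\<Sum>i<?k. c i j * \<xi> (e i p)) *\<^sub>R e j p)"
  have x: "x \<in> fibre A p" unfolding x_def by (rule lincomb_in_fibre) (simp add: frame_in_fibre[OF U])
  have eta: "\<eta> x = P p \<xi> \<eta>" if \<eta>: "\<eta> \<in> dual_fibre A p" for \<eta>
  proof -
    have "\<eta> x = (\<Sum>j<?k. \<Sum>i<?k. c i j * \<xi> (e i p) * \<eta> (e j p))"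
      unfolding x_def dual_lincomb[OF U \<eta>] by (simp add: sum_distrib_right)
    also have "\<dots> = P p \<xi> \<eta>" unfolding c[OF \<xi> \<eta>] by (rule sum.swap)
    finally show ?thesis .
  qed
  have "sharp A P p \<xi> = x" using x eta by (intro sharp_eqI)
  then show "sharp A P p \<xi> \<in> fibre A p" "\<eta> \<in> dual_fibre A p \<Longrightarrow> \<eta> (sharp A P p \<xi>) = P p \<xi> \<eta>"
    using x eta by auto
qed

lemma sharp_lincomb:
  assumes P: "P \<in> bivectors A" and \<xi>: "\<And>i. i \<in> I \<Longrightarrow> \<xi> i \<in> dual_fibre A p"
  shows "sharp A P p (\<lambda>v. \<Sum>i\<in>I. d i * \<xi> i v) = (\<Sum>i\<in>I. d i *\<^sub>R sharp A P p (\<xi> i))"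
proof (rule sharp_eqI)
  show "(\<Sum>i\<in>I. d i *\<^sub>R sharp A P p (\<xi> i)) \<in> fibre A p"
    by (rule lincomb_in_fibre) (rule sharp_bivector(1)[OF P \<xi>])
  fix \<eta> assume \<eta>: "\<eta> \<in> dual_fibre A p"
  have "\<eta> (\<Sum>i\<in>I. d i *\<^sub>R sharp A P p (\<xi> i)) = (\<Sum>i\<in>I. d i * \<eta> (sharp A P p (\<xi> i)))"
    by (rule dual_space_lincomb[OF \<eta> subspace_fibre]) (rule sharp_bivector(1)[OF P \<xi>])
  also have "\<dots> = (\<Sum>i\<in>I. d i * P p (\<xi> i) \<eta>)"
    using sharp_bivector(2)[OF P \<xi> \<eta>] by simp
  finally show "\<eta> (\<Sum>i\<in>I. d i *\<^sub>R sharp A P p (\<xi> i)) = P p (\<lambda>v. \<Sum>i\<in>I. d i * \<xi> i v) \<eta>"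
    using bivector_lincomb[of P I \<xi> p \<eta> d] P \<xi> \<eta> by simp
qed

context
  fixes P assumes P: "P \<in> bivectors A" and nd: "nondegenerate_bivector A P"
begin

lemma flat_inverse_form:
  "x \<in> fibre A p \<Longrightarrow> flat (inverse_form A P) p x = the_inv_into (dual_fibre A p) (sharp A P p) x"
  by (simp add: flat_def inverse_form_def)

lemma bij_sharp: "bij_betw (sharp A P p) (dual_fibre A p) (fibre A p)"
  using nd by (simp add: nondegenerate_bivector_def)

lemma flat_inverse_form_dual: "x \<in> fibre A p \<Longrightarrow> flat (inverse_form A P) p x \<in> dual_fibre A p"
  unfolding flat_inverse_form using bij_betw_the_inv_into[OF bij_sharp] by (rule bij_betw_apply)

lemma sharp_flat_inverse_form: "x \<in> fibre A p \<Longrightarrow> sharp A P p (flat (inverse_form A P) p x) = x"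
  unfolding flat_inverse_form using f_the_inv_into_f_bij_betw[OF bij_sharp] by blast

lemma flat_inverse_form_sharp:
  "\<xi> \<in> dual_fibre A p \<Longrightarrow> flat (inverse_form A P) p (sharp A P p \<xi>) = \<xi>"
  using sharp_bivector(1)[OF P] the_inv_into_f_f[OF bij_betw_imp_inj_on[OF bij_sharp]]
  by (simp add: flat_inverse_form)

text \<open>The inverse of a linear bijection is linear: \<open>sharp\<close> sends the right-hand
  side to the combination of the vectors, and \<open>flat\<close> brings it back.\<close>

lemma flat_inverse_form_lincomb:
  assumes "\<And>i. i \<in> I \<Longrightarrow> f i \<in> fibre A p"
  shows "flat (inverse_form A P) p (\<Sum>i\<in>I. c i *\<^sub>R f i) = (\<lambda>v. \<Sum>i\<in>I. c i * flat (inverse_form A P) p (f i) v)"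
proof -
  have L: "(\<lambda>v. \<Sum>i\<in>I. c i * flat (inverse_form A P) p (f i) v) \<in> dual_fibre A p"
    by (rule dual_lincombI) (rule flat_inverse_form_dual[OF assms])
  have "sharp A P p (\<lambda>v. \<Sum>i\<in>I. c i * flat (inverse_form A P) p (f i) v) = (\<Sum>i\<in>I. c i *\<^sub>R f i)"
    by (subst sharp_lincomb[OF P]) (use assms in \<open>auto simp: flat_inverse_form_dual sharp_flat_inverse_form\<close>)
  then show ?thesis
    using flat_inverse_form_sharp[OF L] by simp
qed

text \<open>For x = \<pi>\<xi> the value of \<xi> on x is \<pi>(\<xi>, \<xi>) = 0, so the
  alternating property passes from the bivector to the form.\<close>

lemma inverse_form_alternating: "inverse_form A P p \<in> alternating_forms (fibre A p)"
proof -
  let ?\<omega> = "inverse_form A P p"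
  have eq: "?\<omega> x = (\<lambda>y. - flat (inverse_form A P) p x y)" for x by (simp add: flat_def)
  have "?\<omega> x \<in> dual_fibre A p" for x
  proof (cases "x \<in> fibre A p")
    case True
    then show ?thesis unfolding eq by (intro dual_space_uminusI flat_inverse_form_dual)
  next
    case False
    then have "?\<omega> x = (\<lambda>v. 0)" by (auto simp: inverse_form_def)
    then show ?thesis using dual_lincombI[of "{} :: nat set"] by simp
  qed
  moreover have "(\<lambda>x. ?\<omega> x y) \<in> dual_fibre A p" for y
    unfolding dual_space_def
  proof (safe)
    fix x x' assume "x \<in> fibre A p" "x' \<in> fibre A p"
    then show "?\<omega> (x + x') y = ?\<omega> x y + ?\<omega> x' y"
      using flat_inverse_form_lincomb[of "{False, True}" "\<lambda>b. if b then x' else x" p "\<lambda>_. 1"]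
      by (simp add: eq)
  next
    fix c x assume "x \<in> fibre A p"
    then show "?\<omega> (c *\<^sub>R x) y = c * ?\<omega> x y"
      using flat_inverse_form_lincomb[of "{()}" "\<lambda>_. x" p "\<lambda>_. c"] by (simp add: eq)
  next
    fix x assume "x \<notin> fibre A p"
    then show "?\<omega> x y = 0" by (simp add: inverse_form_def)
  qed
  moreover have "?\<omega> x x = 0" for x
  proof (cases "x \<in> fibre A p")
    case True
    then have "flat (inverse_form A P) p x x = flat (inverse_form A P) p x (sharp A P p (flat (inverse_form A P) p x))"
      by (simp add: sharp_flat_inverse_form)
    also have "\<dots> = 0"
      using sharp_bivector(2)[OF P] bivector_alternating[OF P] flat_inverse_form_dual[OF True] by simp
    finally show ?thesis by (simp add: flat_def)
  next
    case False
    then show ?thesis by (simp add: inverse_form_def)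
  qed
  ultimately show ?thesis unfolding alternating_forms_def by simp
qed

text \<open>For fixed \<open>i\<close>, the values of the covector \<open>flat\<close> of
  \<open>e i p\<close> on the frame solve a system whose matrix is the transpose of the coefficients
  of \<open>P\<close> and whose right-hand side holds the coordinates of \<open>e i p\<close>.
  Non-degeneracy of \<open>P\<close> makes the system injective.\<close>

lemma inverse_form_smooth:
  assumes U: "(U, e) \<in> frames A" and i: "i < rnk A" and j: "j < rnk A"
  shows "smooth_fun_on A U (\<lambda>p. inverse_form A P p (e i p) (e j p))"
proof -
  let ?k = "rnk A"
  obtain c where c: "\<And>i j. i < ?k \<Longrightarrow> j < ?k \<Longrightarrow> smooth_fun_on A U (c i j)"
    "\<And>p \<xi> \<eta>. p \<in> U \<Longrightarrow> \<xi> \<in> dual_fibre A p \<Longrightarrow> \<eta> \<in> dual_fibre A p \<Longrightarrow>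
       P p \<xi> \<eta> = (\<Sum>i<?k. \<Sum>j<?k. c i j p * \<xi> (e i p) * \<eta> (e j p))"
    using bivector_frame[OF P U] by blast
  obtain \<epsilon> where \<epsilon>: "\<And>i. i < ?k \<Longrightarrow> smooth_cosection_on A U (\<epsilon> i)"
      "\<And>p i j. p \<in> U \<Longrightarrow> i < ?k \<Longrightarrow> j < ?k \<Longrightarrow> \<epsilon> i p (e j p) = (if i = j then 1 else 0)"
    using dual_frame[OF U] by metis
  have coord: "(\<Sum>m<?k. c m l p * \<xi> (e m p)) = \<epsilon> l p (sharp A P p \<xi>)"
    if p: "p \<in> U" and l: "l < ?k" and \<xi>: "\<xi> \<in> dual_fibre A p" for p l \<xi>
  proof -
    note el = smooth_cosection_onD(1)[OF \<epsilon>(1)[OF l] p]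
    have "\<epsilon> l p (sharp A P p \<xi>) = (\<Sum>m<?k. \<Sum>j<?k. c m j p * \<xi> (e m p) * \<epsilon> l p (e j p))"
      using sharp_bivector(2)[OF P \<xi> el] c(2)[OF p \<xi> el] by simp
    also have "\<dots> = (\<Sum>m<?k. \<Sum>j<?k. if j = l then c m l p * \<xi> (e m p) else 0)"
      using \<epsilon>(2)[OF p l] by (intro sum.cong) auto
    finally show ?thesis using l by simp
  qed
  have e: "e i p \<in> fibre A p" if "p \<in> U" for p using frame_in_fibre[OF U that i] .
  have "smooth_fun_on A U (\<lambda>p. flat (inverse_form A P) p (e i p) (e j p))"
  proof (rule smooth_linear_system[of _ ?k "\<lambda>l m. c m l" "\<lambda>l p. \<epsilon> l p (e i p)"])
    show "smooth_fun_on A U (\<lambda>p. \<epsilon> l p (e i p))" if "l < ?k" for l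
      using smooth_cosection_onD(2)[OF \<epsilon>(1)[OF that] U i] by simp
    show "(\<Sum>m<?k. c m l p * flat (inverse_form A P) p (e i p) (e m p)) = \<epsilon> l p (e i p)"
      if "p \<in> U" "l < ?k" for p l
      using coord[OF that flat_inverse_form_dual[OF e[OF that(1)]]] sharp_flat_inverse_form[OF e[OF that(1)]]
      by simp
    \<comment> \<open>A solution of the homogeneous system is read as the covector with components
      \<open>d\<close> in the dual frame. All coordinates of its image under \<open>sharp\<close>
      vanish, so the covector itself vanishes.\<close>
    show "d m = 0" if p: "p \<in> U" and d: "\<And>l. l < ?k \<Longrightarrow> (\<Sum>m<?k. c m l p * d m) = 0" and m: "m < ?k" for p d m
    proof -
      let ?\<xi> = "\<lambda>v. \<Sum>m<?k. d m * \<epsilon> m p v"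
      have \<xi>: "?\<xi> \<in> dual_fibre A p"
        by (rule dual_lincombI) (simp add: smooth_cosection_onD(1)[OF \<epsilon>(1) p])
      have ev: "?\<xi> (e m p) = d m" if "m < ?k" for m
      proof -
        have "?\<xi> (e m p) = (\<Sum>l<?k. if l = m then d m else 0)"
          using \<epsilon>(2)[OF p _ that] by (intro sum.cong) auto
        then show ?thesis using that by simp
      qed
      obtain a where a: "sharp A P p ?\<xi> = (\<Sum>l<?k. a l *\<^sub>R e l p)"
        using frame_coords[OF U p sharp_bivector(1)[OF P \<xi>]] by metis
      have "a l = 0" if l: "l < ?k" for l
      proof -
        note el = smooth_cosection_onD(1)[OF \<epsilon>(1)[OF l] p]
        have "0 = \<epsilon> l p (sharp A P p ?\<xi>)" using coord[OF p l \<xi>] d[OF l] ev by simp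
        also have "\<dots> = (\<Sum>m<?k. a m * \<epsilon> l p (e m p))" unfolding a by (rule dual_lincomb[OF U p el])
        also have "\<dots> = (\<Sum>m<?k. if m = l then a l else 0)"
          using \<epsilon>(2)[OF p l] by (intro sum.cong) auto
        finally show ?thesis using l by simp
      qed
      then have s0: "sharp A P p ?\<xi> = 0" unfolding a by simp
      have "?\<xi> = flat (inverse_form A P) p 0" using flat_inverse_form_sharp[OF \<xi>] s0 by simp
      moreover have "flat (inverse_form A P) p 0 = (\<lambda>v. 0)"
        using flat_inverse_form_lincomb[of "{} :: nat set"] by simp
      ultimately show ?thesis using ev[OF m] by metis
    qed
  qed (use frame(1)[OF U] c(1) j in auto)
  from smooth_fun_on_minus[OF this] show ?thesis by (simp add: flat_def)
qed

lemma inverse_form_in_two_forms: "inverse_form A P \<in> two_forms A"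
  unfolding two_forms_def using inverse_form_alternating inverse_form_smooth by auto

lemma nondegenerate_inverse_form: "nondegenerate_form A (inverse_form A P)"
  unfolding nondegenerate_form_def
proof
  fix p
  show "bij_betw (flat (inverse_form A P) p) (fibre A p) (dual_fibre A p)"
    by (rule bij_betw_byWitness[of _ "sharp A P p"])
       (auto simp: flat_inverse_form_sharp sharp_flat_inverse_form flat_inverse_form_dual sharp_bivector(1)[OF P])
qed

lemma inverse_bivector_inverse_form: "inverse_bivector A (inverse_form A P) = P"
proof (intro ext)
  fix p \<xi> \<eta>
  show "inverse_bivector A (inverse_form A P) p \<xi> \<eta> = P p \<xi> \<eta>"
  proof (cases "\<xi> \<in> dual_fibre A p \<and> \<eta> \<in> dual_fibre A p")
    case True
    then have "inverse_bivector A (inverse_form A P) p (flat (inverse_form A P) p (sharp A P p \<xi>)) \<eta>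
        = \<eta> (sharp A P p \<xi>)"
      using inverse_bivector_flat[OF inverse_form_in_two_forms nondegenerate_inverse_form] sharp_bivector(1)[OF P]
      by blast
    then show ?thesis using True flat_inverse_form_sharp sharp_bivector(2)[OF P] by simp
  next
    case False
    then show ?thesis using bivector_outside[OF P] by (auto simp: inverse_bivector_def)
  qed
qed

end

end

section \<open>The Schouten bracket of an inverse bivector\<close>

locale lie_algebroid_bundle =
  fixes A :: "('m::{t2_space, second_countable_topology}, 'e::real_inner, 'v::real_vector) algebroid_data"
  assumes lie_algebroid: "lie_algebroid A"

sublocale lie_algebroid_bundle \<subseteq> smooth_bundle A
  using lie_algebroid by unfold_locales (simp add: lie_algebroid_def)

text \<open>\<open>i\<^sub>\<alpha>(X \<and> Y)\<close>\<close>

definition contract ::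
  "('m \<Rightarrow> 'v::real_vector) \<Rightarrow> ('m \<Rightarrow> 'v) \<Rightarrow> ('m, 'v) covector_field \<Rightarrow> 'm \<Rightarrow> 'v" where
  "contract X Y \<alpha> p = \<alpha> p (X p) *\<^sub>R Y p - \<alpha> p (Y p) *\<^sub>R X p"

text \<open>If \<open>\<Sum> X1 i \<and> X2 i\<close> and \<open>\<Sum> Y1 j \<and> Y2 j\<close> both represent the inverse of a form \<open>\<omega>\<close>, and
  \<open>\<alpha>\<close>, \<open>\<beta>\<close>, \<open>\<gamma>\<close> are the images of the sections \<open>x\<close>, \<open>y\<close>, \<open>z\<close>, then the sum of these terms over
  all \<open>i\<close>, \<open>j\<close> is \<open>d\<omega>(x, y, z)\<close>.\<close>

definition diff_term ::
  "('m::{t2_space, second_countable_topology}, 'e::real_inner, 'v::real_vector) algebroid_data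
   \<Rightarrow> ('m \<Rightarrow> 'v) \<Rightarrow> ('m \<Rightarrow> 'v) \<Rightarrow> ('m \<Rightarrow> 'v) \<Rightarrow> ('m \<Rightarrow> 'v)
   \<Rightarrow> ('m, 'v) covector_field \<Rightarrow> ('m, 'v) covector_field \<Rightarrow> ('m, 'v) covector_field \<Rightarrow> 'm \<Rightarrow> real" where
  "diff_term A X1 X2 Y1 Y2 \<alpha> \<beta> \<gamma> p =
     anchor A p (contract X1 X2 \<alpha> p) (\<lambda>q. wedge2 (Y1 q) (Y2 q) (\<beta> q) (\<gamma> q))
     - anchor A p (contract X1 X2 \<beta> p) (\<lambda>q. wedge2 (Y1 q) (Y2 q) (\<alpha> q) (\<gamma> q))
     + anchor A p (contract X1 X2 \<gamma> p) (\<lambda>q. wedge2 (Y1 q) (Y2 q) (\<alpha> q) (\<beta> q))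
     - \<gamma> p (bracket A (contract X1 X2 \<alpha>) (contract Y1 Y2 \<beta>) p)
     + \<beta> p (bracket A (contract X1 X2 \<alpha>) (contract Y1 Y2 \<gamma>) p)
     - \<alpha> p (bracket A (contract X1 X2 \<beta>) (contract Y1 Y2 \<gamma>) p)"

text \<open>The expansion of \<open>diff_term\<close> by the Leibniz rules, in terms of \<open>v \<alpha> X = \<alpha>(X)\<close>,
  \<open>d X \<alpha> Y = \<rho>(X)(\<alpha>(Y))\<close> and \<open>k \<alpha> X Y = \<alpha>([X, Y])\<close>; abstracting from the bundle keeps the
  polynomial identity below small.\<close>

definition expand ::
  "('c \<Rightarrow> 's \<Rightarrow> real) \<Rightarrow> ('s \<Rightarrow> 'c \<Rightarrow> 's \<Rightarrow> real) \<Rightarrow> ('c \<Rightarrow> 's \<Rightarrow> 's \<Rightarrow> real)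
    \<Rightarrow> 's \<Rightarrow> 's \<Rightarrow> 's \<Rightarrow> 's \<Rightarrow> 'c \<Rightarrow> 'c \<Rightarrow> 'c \<Rightarrow> real" where
  "expand v d k X1 X2 Y1 Y2 a b c =
    (let D = \<lambda>Z f g. v f Y1 * d Z g Y2 + v g Y2 * d Z f Y1 - (v f Y2 * d Z g Y1 + v g Y1 * d Z f Y2);
         C = \<lambda>h f g. v h X1 * D X2 f g - v h X2 * D X1 f g;
         T = \<lambda>h f X X' g Y Y'. v f X * v g Y * k h X' Y' + v f X * d X' g Y * v h Y' - v g Y * d Y' f X * v h X';
         B = \<lambda>h f g. T h f X1 X2 g Y1 Y2 - T h f X1 X2 g Y2 Y1 - T h f X2 X1 g Y1 Y2 + T h f X2 X1 g Y2 Y1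
     in C a b c - C b a c + C c a b - B c a b + B b a c - B a b c)"

text \<open>The left-hand side is the bracket of two decomposable bivectors with its wedge products
  written out; it contains no \<open>d\<close>. In a single \<open>expand\<close> derivative terms
  survive, such as the one with \<open>d X2 a Y1\<close>; they cancel against the copy with the
  pairs exchanged. Skew-symmetry of \<open>k\<close> is asked only for the arguments involved,
  because the bracket has it only on sections.\<close>

lemma expand_identity:
  assumes "\<And>h. h \<in> {a, b, c} \<Longrightarrow> k h Y1 X1 = - k h X1 Y1" "\<And>h. h \<in> {a, b, c} \<Longrightarrow> k h Y1 X2 = - k h X2 Y1"
    "\<And>h. h \<in> {a, b, c} \<Longrightarrow> k h Y2 X1 = - k h X1 Y2" "\<And>h. h \<in> {a, b, c} \<Longrightarrow> k h Y2 X2 = - k h X2 Y2"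
  shows "(k a X1 Y1 * (v b X2 * v c Y2 - v b Y2 * v c X2) - v a X2 * (k b X1 Y1 * v c Y2 - v b Y2 * k c X1 Y1) + v a Y2 * (k b X1 Y1 * v c X2 - v b X2 * k c X1 Y1))
    - (k a X1 Y2 * (v b X2 * v c Y1 - v b Y1 * v c X2) - v a X2 * (k b X1 Y2 * v c Y1 - v b Y1 * k c X1 Y2) + v a Y1 * (k b X1 Y2 * v c X2 - v b X2 * k c X1 Y2))
    - (k a X2 Y1 * (v b X1 * v c Y2 - v b Y2 * v c X1) - v a X1 * (k b X2 Y1 * v c Y2 - v b Y2 * k c X2 Y1) + v a Y2 * (k b X2 Y1 * v c X1 - v b X1 * k c X2 Y1))
    + (k a X2 Y2 * (v b X1 * v c Y1 - v b Y1 * v c X1) - v a X1 * (k b X2 Y2 * v c Y1 - v b Y1 * k c X2 Y2) + v a Y1 * (k b X2 Y2 * v c X1 - v b X1 * k c X2 Y2))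
    = - (expand v d k X1 X2 Y1 Y2 a b c + expand v d k Y1 Y2 X1 X2 a b c)"
  using assms unfolding expand_def Let_def by (simp add: algebra_simps)

context smooth_bundle begin

lemma smooth_funs_mult: "f \<in> smooth_funs A \<Longrightarrow> g \<in> smooth_funs A \<Longrightarrow> (\<lambda>p. f p * g p) \<in> smooth_funs A"
  by (simp add: smooth_funs_def smooth_fun_on_mult)

lemma smooth_funs_diff: "f \<in> smooth_funs A \<Longrightarrow> g \<in> smooth_funs A \<Longrightarrow> (\<lambda>p. f p - g p) \<in> smooth_funs A"
  by (simp add: smooth_funs_def smooth_fun_on_diff)

lemma smooth_funs_sum: "(\<And>i. i \<in> I \<Longrightarrow> f i \<in> smooth_funs A) \<Longrightarrow> (\<lambda>p. \<Sum>i\<in>I. f i p) \<in> smooth_funs A"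
  by (simp add: smooth_funs_def smooth_fun_on_sum)

lemma wedge2_smooth_funs:
  "X \<in> sections A \<Longrightarrow> Y \<in> sections A \<Longrightarrow> \<alpha> \<in> cosections A \<Longrightarrow> \<beta> \<in> cosections A
    \<Longrightarrow> (\<lambda>p. wedge2 (X p) (Y p) (\<alpha> p) (\<beta> p)) \<in> smooth_funs A"
  unfolding wedge2_def by (intro smooth_funs_diff smooth_funs_mult pairing_smooth_funs)

lemma contract_section:
  "X \<in> sections A \<Longrightarrow> Y \<in> sections A \<Longrightarrow> \<alpha> \<in> cosections A \<Longrightarrow> contract X Y \<alpha> \<in> sections A"
  unfolding contract_def [abs_def] by (intro sections_diff sections_scale pairing_smooth_funs)

text \<open>If \<open>P\<close> has coefficients \<open>c\<close> in a frame, then it is the sum of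
  the wedge products of \<open>e i\<close> with half of the combination of the frame by row
  \<open>i\<close> of \<open>c\<close>. Both families are then cut off to global sections.\<close>

lemma bivector_decomposition:
  assumes P: "P \<in> bivectors A"
  obtains U X Y where "open U" "p \<in> U" "decomposes_on A U P (rnk A) X Y"
proof -
  let ?k = "rnk A"
  obtain U e where U: "(U, e) \<in> frames A" "p \<in> U" using frame_cover by blast
  obtain c where c: "\<And>i j. i < ?k \<Longrightarrow> j < ?k \<Longrightarrow> smooth_fun_on A U (c i j)"
    "\<And>p \<xi> \<eta>. p \<in> U \<Longrightarrow> \<xi> \<in> dual_fibre A p \<Longrightarrow> \<eta> \<in> dual_fibre A p \<Longrightarrow>
       P p \<xi> \<eta> = (\<Sum>i<?k. \<Sum>j<?k. c i j p * \<xi> (e i p) * \<eta> (e j p))"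
    using bivector_frame[OF P U(1)] by blast
  \<comment> \<open>The factor 1/2 compensates for the antisymmetrization in \<open>wedge2\<close>,
    which produces P(\<alpha>, \<beta>) - P(\<beta>, \<alpha>).\<close>
  define f where "f i q = (\<Sum>j<?k. (1/2 * c i j q) *\<^sub>R e j q)" for i q
  have f: "smooth_section_on A U (f i)" if "i < ?k" for i
    unfolding f_def using c(1)[OF that]
    by (intro smooth_section_on_lincomb smooth_fun_on_mult smooth_fun_on_const) (auto intro: frame(2)[OF U(1)])
  obtain X V where X: "open V" "p \<in> V" "V \<subseteq> U" "\<And>i. i < ?k \<Longrightarrow> X i \<in> sections A"
    "\<And>i q. q \<in> V \<Longrightarrow> X i q = e i q"
    using sections_extend[OF frame(1)[OF U(1)] U(2), of "{..<?k}" e] frame(2)[OF U(1)] by (metis lessThan_iff)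
  obtain Y V' where Y: "open V'" "p \<in> V'" "V' \<subseteq> U" "\<And>i. i < ?k \<Longrightarrow> Y i \<in> sections A"
    "\<And>i q. q \<in> V' \<Longrightarrow> Y i q = f i q"
    using sections_extend[OF frame(1)[OF U(1)] U(2), of "{..<?k}" f] f by (metis lessThan_iff)
  have "P q \<alpha> \<beta> = (\<Sum>i<?k. wedge2 (X i q) (Y i q) \<alpha> \<beta>)"
    if q: "q \<in> V \<inter> V'" and \<alpha>: "\<alpha> \<in> dual_fibre A q" and \<beta>: "\<beta> \<in> dual_fibre A q" for q \<alpha> \<beta>
  proof -
    have qU: "q \<in> U" using q X(3) by blast
    have ev: "\<eta> (f i q) = (\<Sum>j<?k. 1/2 * c i j q * \<eta> (e j q))" if "\<eta> \<in> dual_fibre A q" for \<eta> i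
      unfolding f_def by (rule dual_lincomb[OF U(1) qU that])
    have "P q \<alpha> \<beta> = 1/2 * P q \<alpha> \<beta> - 1/2 * P q \<beta> \<alpha>"
      using bivector_skew[OF P \<alpha> \<beta>] by simp
    also have "\<dots> = (\<Sum>i<?k. \<alpha> (e i q) * \<beta> (f i q) - \<alpha> (f i q) * \<beta> (e i q))"
      unfolding c(2)[OF qU \<alpha> \<beta>] c(2)[OF qU \<beta> \<alpha>] ev[OF \<alpha>] ev[OF \<beta>]
      by (simp add: sum_distrib_left sum_distrib_right sum_subtractf mult_ac)
    finally show ?thesis using X(5)[of q] Y(5)[of q] q by (simp add: wedge2_def)
  qed
  then have "decomposes_on A (V \<inter> V') P ?k X Y"
    unfolding decomposes_on_def using X(4) Y(4) by simp
  moreover have "open (V \<inter> V')" "p \<in> V \<inter> V'" using X(1,2) Y(1,2) by auto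
  ultimately show ?thesis by (intro that)
qed

end

section \<open>Leibniz rules and locality of anchor and bracket\<close>

context lie_algebroid_bundle begin

lemmas anchor_axiom = lie_algebroid[unfolded lie_algebroid_def, THEN conjunct2, THEN conjunct1]
lemmas bracket_section = lie_algebroid[unfolded lie_algebroid_def, THEN conjunct2, THEN conjunct2, THEN conjunct2, THEN conjunct1, rule_format]
lemmas bracket_add_axiom = lie_algebroid[unfolded lie_algebroid_def, THEN conjunct2, THEN conjunct2, THEN conjunct2, THEN conjunct2, THEN conjunct1, rule_format]
lemmas bracket_skew_axiom = lie_algebroid[unfolded lie_algebroid_def, THEN conjunct2, THEN conjunct2, THEN conjunct2, THEN conjunct2, THEN conjunct2, THEN conjunct2, THEN conjunct1, rule_format]
lemmas bracket_leibniz_axiom = lie_algebroid[unfolded lie_algebroid_def, THEN conjunct2, THEN conjunct2, THEN conjunct2, THEN conjunct2, THEN conjunct2, THEN conjunct2, THEN conjunct2, THEN conjunct2, rule_format]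

lemma anchor_linear:
  assumes "u \<in> fibre A p" "v \<in> fibre A p" "f \<in> smooth_funs A"
  shows "anchor A p (u + v) f = anchor A p u f + anchor A p v f"
    "anchor A p (c *\<^sub>R u) f = c * anchor A p u f"
  using anchor_axiom assms by simp_all

lemma anchor_derivation:
  assumes "u \<in> fibre A p" "f \<in> smooth_funs A" "g \<in> smooth_funs A"
  shows "anchor A p u (\<lambda>q. f q + g q) = anchor A p u f + anchor A p u g"
    "anchor A p u (\<lambda>q. c * f q) = c * anchor A p u f"
    "anchor A p u (\<lambda>q. f q * g q) = f p * anchor A p u g + g p * anchor A p u f"
proof -
  have "anchor A p u \<in> tangent_space A p" using anchor_axiom assms(1) by blast
  then show "anchor A p u (\<lambda>q. f q + g q) = anchor A p u f + anchor A p u g"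
    "anchor A p u (\<lambda>q. c * f q) = c * anchor A p u f"
    "anchor A p u (\<lambda>q. f q * g q) = f p * anchor A p u g + g p * anchor A p u f"
    using assms(2,3) by (simp_all add: tangent_space_def)
qed

lemma anchor_diff_fun:
  assumes "u \<in> fibre A p" "f \<in> smooth_funs A" "g \<in> smooth_funs A"
  shows "anchor A p u (\<lambda>q. f q - g q) = anchor A p u f - anchor A p u g"
  using anchor_derivation(1)[OF assms(1,2) smooth_funs_mult[OF const_smooth_funs assms(3)], of "-1"]
    anchor_derivation(2)[OF assms(1,3,3), of "-1"] by simp

lemma anchor_zero_fun: "u \<in> fibre A p \<Longrightarrow> anchor A p u (\<lambda>q. 0) = 0"
  using anchor_derivation(2)[of u p "\<lambda>q. 0" "\<lambda>q. 0" 0] by simp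

lemma anchor_sum_fun:
  assumes "u \<in> fibre A p" "\<And>i. i \<in> I \<Longrightarrow> f i \<in> smooth_funs A"
  shows "anchor A p u (\<lambda>q. \<Sum>i\<in>I. f i q) = (\<Sum>i\<in>I. anchor A p u (f i))"
  using assms(2)
  by (induction I rule: infinite_finite_induct)
     (simp_all add: anchor_zero_fun anchor_derivation smooth_funs_sum assms(1))

lemma anchor_zero: "f \<in> smooth_funs A \<Longrightarrow> anchor A p 0 f = 0"
  using anchor_linear(2)[OF subspace_0[OF subspace_fibre] subspace_0[OF subspace_fibre], of f p 0] by simp

lemma anchor_diff:
  assumes "u \<in> fibre A p" "v \<in> fibre A p" "f \<in> smooth_funs A"
  shows "anchor A p (u - v) f = anchor A p u f - anchor A p v f"
  using anchor_linear(1)[OF subspace_diff[OF subspace_fibre assms(1,2)] assms(2,3)] by simp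

lemma anchor_sum:
  assumes "\<And>i. i \<in> I \<Longrightarrow> u i \<in> fibre A p" "f \<in> smooth_funs A"
  shows "anchor A p (\<Sum>i\<in>I. u i) f = (\<Sum>i\<in>I. anchor A p (u i) f)"
  using assms(1)
  by (induction I rule: infinite_finite_induct)
     (simp_all add: anchor_zero anchor_linear subspace_sum[OF subspace_fibre] assms(2))

text \<open>With a bump function b equal to 1 at \<open>p\<close> and supported in \<open>W\<close>,
  the product b (f - g) is 0 everywhere. The derivation rule at \<open>p\<close> then leaves only
  the derivative of f - g.\<close>

lemma anchor_local:
  assumes "open W" "p \<in> W" "f \<in> smooth_funs A" "g \<in> smooth_funs A" "\<And>q. q \<in> W \<Longrightarrow> f q = g q"
    and u: "u \<in> fibre A p"
  shows "anchor A p u f = anchor A p u g"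
proof -
  obtain b V K where b: "b \<in> smooth_funs A" "p \<in> V" "K \<subseteq> W"
    "\<And>q. q \<in> V \<Longrightarrow> b q = 1" "\<And>q. q \<notin> K \<Longrightarrow> b q = 0"
    using bump_function[OF assms(1,2)] by metis
  note d = smooth_funs_diff[OF assms(3,4)]
  have "b q * (f q - g q) = 0" for q
    using assms(5)[of q] b(3) b(5)[of q] by auto
  then have "(\<lambda>q. b q * (f q - g q)) = (\<lambda>q. 0)" by blast
  then have "anchor A p u (\<lambda>q. b q * (f q - g q)) = 0" using anchor_zero_fun[OF u] by simp
  then show ?thesis
    unfolding anchor_derivation(3)[OF u b(1) d] anchor_diff_fun[OF u assms(3,4)]
    using b(2,4) assms(2,5) by simp
qed

lemma bracket_in_fibre: "X \<in> sections A \<Longrightarrow> Y \<in> sections A \<Longrightarrow> bracket A X Y p \<in> fibre A p"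
  by (intro section_in_fibre bracket_section)

lemma bracket_skew: "X \<in> sections A \<Longrightarrow> Y \<in> sections A \<Longrightarrow> bracket A X Y p = - bracket A Y X p"
  by (rule fun_cong[OF bracket_skew_axiom])

lemma bracket_add_left:
  assumes "X \<in> sections A" "Y \<in> sections A" "Z \<in> sections A"
  shows "bracket A (\<lambda>p. X p + Y p) Z p = bracket A X Z p + bracket A Y Z p"
  by (rule fun_cong[OF bracket_add_axiom[OF assms]])

lemma bracket_add_right:
  assumes "X \<in> sections A" "Y \<in> sections A" "Z \<in> sections A"
  shows "bracket A X (\<lambda>p. Y p + Z p) p = bracket A X Y p + bracket A X Z p"
  using bracket_skew[OF assms(1) sections_add[OF assms(2,3)]] bracket_add_left[OF assms(2,3,1)]
    bracket_skew[OF assms(1,2)] bracket_skew[OF assms(1,3)] by simp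

lemma bracket_leibniz:
  assumes "X \<in> sections A" "Y \<in> sections A" "f \<in> smooth_funs A"
  shows "bracket A X (\<lambda>p. f p *\<^sub>R Y p) p = f p *\<^sub>R bracket A X Y p + anchor A p (X p) f *\<^sub>R Y p"
  by (rule fun_cong[OF bracket_leibniz_axiom[OF assms]])

lemma bracket_leibniz_left:
  assumes "X \<in> sections A" "Y \<in> sections A" "f \<in> smooth_funs A"
  shows "bracket A (\<lambda>p. f p *\<^sub>R X p) Y p = f p *\<^sub>R bracket A X Y p - anchor A p (Y p) f *\<^sub>R X p"
  using bracket_skew[OF sections_scale[OF assms(1,3)] assms(2)] bracket_leibniz[OF assms(2,1,3)]
    bracket_skew[OF assms(1,2)] by simp

lemma bracket_zero_right: "X \<in> sections A \<Longrightarrow> bracket A X (\<lambda>p. 0) p = 0"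
  using bracket_add_right[of X "\<lambda>p. 0" "\<lambda>p. 0" p] by simp

lemma bracket_minus_right:
  "X \<in> sections A \<Longrightarrow> Y \<in> sections A \<Longrightarrow> bracket A X (\<lambda>p. - Y p) p = - bracket A X Y p"
  using bracket_add_right[OF _ _ sections_minus, of X Y Y p] bracket_zero_right[of X p]
  by (simp add: eq_neg_iff_add_eq_0 add.commute)

lemma bracket_diff_right:
  assumes "X \<in> sections A" "Y \<in> sections A" "Z \<in> sections A"
  shows "bracket A X (\<lambda>p. Y p - Z p) p = bracket A X Y p - bracket A X Z p"
  using bracket_add_right[OF assms(1,2) sections_minus[OF assms(3)]] bracket_minus_right[OF assms(1,3)] by simp

lemma bracket_diff_left:
  assumes "X \<in> sections A" "Y \<in> sections A" "Z \<in> sections A"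
  shows "bracket A (\<lambda>p. X p - Y p) Z p = bracket A X Z p - bracket A Y Z p"
  using bracket_skew[OF sections_diff[OF assms(1,2)] assms(3)] bracket_diff_right[OF assms(3,1,2)]
    bracket_skew[OF assms(1,3)] bracket_skew[OF assms(2,3)] by simp

lemma bracket_sum_right:
  assumes "X \<in> sections A" "\<And>i. i \<in> I \<Longrightarrow> Y i \<in> sections A"
  shows "bracket A X (\<lambda>p. \<Sum>i\<in>I. Y i p) p = (\<Sum>i\<in>I. bracket A X (Y i) p)"
  using assms(2)
  by (induction I rule: infinite_finite_induct)
     (simp_all add: bracket_zero_right bracket_add_right sections_sum assms(1))

lemma bracket_sum_left:
  assumes "X \<in> sections A" "\<And>i. i \<in> I \<Longrightarrow> Y i \<in> sections A"
  shows "bracket A (\<lambda>p. \<Sum>i\<in>I. Y i p) X p = (\<Sum>i\<in>I. bracket A (Y i) X p)"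
proof -
  have "bracket A (\<lambda>p. \<Sum>i\<in>I. Y i p) X p = - (\<Sum>i\<in>I. bracket A X (Y i) p)"
    using bracket_skew[of "\<lambda>p. \<Sum>i\<in>I. Y i p" X p] sections_sum[of I Y]
      bracket_sum_right[of X I Y p] assms by simp
  also have "\<dots> = (\<Sum>i\<in>I. bracket A (Y i) X p)"
    unfolding sum_negf[symmetric] by (intro sum.cong refl bracket_skew[symmetric] assms)
  finally show ?thesis .
qed

text \<open>The argument of \<open>anchor_local\<close>, with the Leibniz rule of the bracket
  applied to b (Y - Z), which is the zero section.\<close>

lemma bracket_local_right:
  assumes "open W" "p \<in> W" "X \<in> sections A" "Y \<in> sections A" "Z \<in> sections A"
    "\<And>q. q \<in> W \<Longrightarrow> Y q = Z q"
  shows "bracket A X Y p = bracket A X Z p"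
proof -
  obtain b V K where b: "b \<in> smooth_funs A" "p \<in> V" "K \<subseteq> W"
    "\<And>q. q \<in> V \<Longrightarrow> b q = 1" "\<And>q. q \<notin> K \<Longrightarrow> b q = 0"
    using bump_function[OF assms(1,2)] by metis
  have "b q *\<^sub>R (Y q - Z q) = 0" for q
    using assms(6)[of q] b(3) b(5)[of q] by auto
  then have "(\<lambda>q. b q *\<^sub>R (Y q - Z q)) = (\<lambda>q. 0)" by blast
  then have "bracket A X (\<lambda>q. b q *\<^sub>R (Y q - Z q)) p = 0" using bracket_zero_right[OF assms(3)] by simp
  then show ?thesis
    unfolding bracket_leibniz[OF assms(3) sections_diff[OF assms(4,5)] b(1)] bracket_diff_right[OF assms(3-5)]
    using b(2,4) assms(2,6) by simp
qed

lemma bracket_local: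
  assumes "open W" "p \<in> W" "X \<in> sections A" "X' \<in> sections A" "Y \<in> sections A" "Y' \<in> sections A"
    "\<And>q. q \<in> W \<Longrightarrow> X q = X' q" "\<And>q. q \<in> W \<Longrightarrow> Y q = Y' q"
  shows "bracket A X Y p = bracket A X' Y' p"
  using bracket_local_right[OF assms(1,2,3,5,6,8)] bracket_local_right[OF assms(1,2,6,3,4,7)]
    bracket_skew[OF assms(3,6)] bracket_skew[OF assms(4,6)] by simp

text \<open>The Leibniz rule in both entries, paired with a covector at once so that later
  expansions take place among real numbers.\<close>

lemma bracket_scaled:
  assumes "X \<in> sections A" "Y \<in> sections A" "f \<in> smooth_funs A" "g \<in> smooth_funs A" "\<gamma> \<in> cosections A"
  shows "\<gamma> p (bracket A (\<lambda>q. f q *\<^sub>R X q) (\<lambda>q. g q *\<^sub>R Y q) p) =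
    f p * g p * \<gamma> p (bracket A X Y p) + f p * anchor A p (X p) g * \<gamma> p (Y p)
    - g p * anchor A p (Y p) f * \<gamma> p (X p)"
proof -
  note \<gamma> = cosection_in_dual[OF assms(5), of p]
  note X = section_in_fibre[OF assms(1), of p] and Y = section_in_fibre[OF assms(2), of p]
  note XY = bracket_in_fibre[OF assms(1,2), of p]
  note sub = subspace_scale[OF subspace_fibre] subspace_add[OF subspace_fibre] subspace_diff[OF subspace_fibre]
  have eq: "bracket A (\<lambda>q. f q *\<^sub>R X q) (\<lambda>q. g q *\<^sub>R Y q) p =
      g p *\<^sub>R (f p *\<^sub>R bracket A X Y p - anchor A p (Y p) f *\<^sub>R X p) + (f p * anchor A p (X p) g) *\<^sub>R Y p"
    using bracket_leibniz[OF sections_scale[OF assms(1,3)] assms(2,4), of p]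
      bracket_leibniz_left[OF assms(1,2,3)] anchor_linear(2)[OF X X assms(4)] by simp
  have lin: "\<gamma> p (b *\<^sub>R (a *\<^sub>R bracket A X Y p - a' *\<^sub>R X p) + b' *\<^sub>R Y p)
      = b * (a * \<gamma> p (bracket A X Y p) - a' * \<gamma> p (X p)) + b' * \<gamma> p (Y p)" for a b a' b'
    by (simp add: dual_space_add[OF \<gamma>] dual_space_diff[OF \<gamma> subspace_fibre] dual_space_scaleR[OF \<gamma>] X Y XY sub)
  show ?thesis unfolding eq lin by (simp add: algebra_simps)
qed

lemma bracket_contract:
  fixes p :: 'm
  assumes "X1 \<in> sections A" "X2 \<in> sections A" "Y1 \<in> sections A" "Y2 \<in> sections A"
    "\<alpha> \<in> cosections A" "\<beta> \<in> cosections A" "\<gamma> \<in> cosections A"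
  defines "T \<equiv> \<lambda>f X g Y. f p * g p * \<gamma> p (bracket A X Y p) + f p * anchor A p (X p) g * \<gamma> p (Y p)
    - g p * anchor A p (Y p) f * \<gamma> p (X p)"
  shows "\<gamma> p (bracket A (contract X1 X2 \<alpha>) (contract Y1 Y2 \<beta>) p) =
    T (\<lambda>q. \<alpha> q (X1 q)) X2 (\<lambda>q. \<beta> q (Y1 q)) Y2 - T (\<lambda>q. \<alpha> q (X1 q)) X2 (\<lambda>q. \<beta> q (Y2 q)) Y1
    - T (\<lambda>q. \<alpha> q (X2 q)) X1 (\<lambda>q. \<beta> q (Y1 q)) Y2 + T (\<lambda>q. \<alpha> q (X2 q)) X1 (\<lambda>q. \<beta> q (Y2 q)) Y1"
proof -
  note \<gamma> = cosection_in_dual[OF assms(7), of p]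
  note fib = subspace_diff[OF subspace_fibre] bracket_in_fibre
  \<comment> \<open>Naming the scaled sections separates the bilinear expansion of the bracket into
    four terms from the Leibniz rule for each of them.\<close>
  define s where "s \<alpha> X Y = (\<lambda>q. \<alpha> q (X q) *\<^sub>R Y q)" for \<alpha> :: "('m, 'v) covector_field" and X Y :: "'m \<Rightarrow> 'v"
  have s: "s \<alpha> X Y \<in> sections A" if "\<alpha> \<in> cosections A" "X \<in> sections A" "Y \<in> sections A" for \<alpha> X Y
    unfolding s_def using that by (intro sections_scale pairing_smooth_funs)
  have t: "\<gamma> p (bracket A (s \<alpha> X X') (s \<beta> Y Y') p) = T (\<lambda>q. \<alpha> q (X q)) X' (\<lambda>q. \<beta> q (Y q)) Y'"
    if "X \<in> sections A" "X' \<in> sections A" "Y \<in> sections A" "Y' \<in> sections A" for X X' Y Y'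
    unfolding s_def T_def using that assms(5-7) by (intro bracket_scaled pairing_smooth_funs)
  have c: "contract X Y \<alpha> = (\<lambda>q. s \<alpha> X Y q - s \<alpha> Y X q)" for X Y \<alpha>
    by (simp add: s_def contract_def fun_eq_iff)
  have "bracket A (contract X1 X2 \<alpha>) (contract Y1 Y2 \<beta>) p =
     (bracket A (s \<alpha> X1 X2) (s \<beta> Y1 Y2) p - bracket A (s \<alpha> X1 X2) (s \<beta> Y2 Y1) p)
     - (bracket A (s \<alpha> X2 X1) (s \<beta> Y1 Y2) p - bracket A (s \<alpha> X2 X1) (s \<beta> Y2 Y1) p)"
    unfolding c by (simp add: bracket_diff_left bracket_diff_right s assms(1-6) sections_diff)
  then show ?thesis
    by (simp add: dual_space_diff[OF \<gamma> subspace_fibre] fib s assms(1-6) t)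
qed

lemma anchor_contract:
  assumes "X \<in> sections A" "Y \<in> sections A" "f \<in> smooth_funs A"
  shows "anchor A p (contract X Y \<alpha> p) f = \<alpha> p (X p) * anchor A p (Y p) f - \<alpha> p (Y p) * anchor A p (X p) f"
  unfolding contract_def using assms section_in_fibre[of X p] section_in_fibre[of Y p]
  by (simp add: anchor_diff anchor_linear subspace_scale[OF subspace_fibre])

lemma anchor_wedge2:
  assumes "u \<in> fibre A p" "Y1 \<in> sections A" "Y2 \<in> sections A" "\<alpha> \<in> cosections A" "\<beta> \<in> cosections A"
  shows "anchor A p u (\<lambda>q. wedge2 (Y1 q) (Y2 q) (\<alpha> q) (\<beta> q)) =
    \<alpha> p (Y1 p) * anchor A p u (\<lambda>q. \<beta> q (Y2 q)) + \<beta> p (Y2 p) * anchor A p u (\<lambda>q. \<alpha> q (Y1 q))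
    - (\<alpha> p (Y2 p) * anchor A p u (\<lambda>q. \<beta> q (Y1 q)) + \<beta> p (Y1 p) * anchor A p u (\<lambda>q. \<alpha> q (Y2 q)))"
  unfolding wedge2_def using assms
  by (simp add: anchor_diff_fun anchor_derivation(3) smooth_funs_mult pairing_smooth_funs)

text \<open>A single \<open>diff_term\<close> still depends on derivatives of the pairings of the
  covector fields with the vector fields, while the left-hand side depends on the covector fields
  only through their values at \<open>p\<close>. Symmetrizing in the two pairs removes these
  derivatives.\<close>

lemma decomposable_bracket_eq:
  assumes X: "X1 \<in> sections A" "X2 \<in> sections A" and Y: "Y1 \<in> sections A" "Y2 \<in> sections A"
    and \<alpha>: "\<alpha> \<in> cosections A" and \<beta>: "\<beta> \<in> cosections A" and \<gamma>: "\<gamma> \<in> cosections A"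
  shows "decomposable_bracket A X1 X2 Y1 Y2 p (\<alpha> p) (\<beta> p) (\<gamma> p) =
    - (diff_term A X1 X2 Y1 Y2 \<alpha> \<beta> \<gamma> p + diff_term A Y1 Y2 X1 X2 \<alpha> \<beta> \<gamma> p)"
proof -
  have sk: "\<theta> p (bracket A Y X p) = - \<theta> p (bracket A X Y p)"
    if "\<theta> \<in> cosections A" "X \<in> sections A" "Y \<in> sections A" for \<theta> X Y
    using bracket_skew[OF that(3,2)] dual_space_uminus[OF cosection_in_dual[OF that(1)] bracket_in_fibre[OF that(2,3)]]
    by simp
  note c = section_in_fibre[OF X(1), of p] section_in_fibre[OF X(2), of p]
    section_in_fibre[OF Y(1), of p] section_in_fibre[OF Y(2), of p]
  define v where "v \<theta> Z = \<theta> p (Z p)" for \<theta> :: "('m, 'v) covector_field" and Z :: "'m \<Rightarrow> 'v"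
  define k where "k \<theta> Z W = \<theta> p (bracket A Z W p)" for \<theta> :: "('m, 'v) covector_field" and Z W :: "'m \<Rightarrow> 'v"
  define d where "d Z \<theta> W = anchor A p (Z p) (\<lambda>q. \<theta> q (W q))"
    for \<theta> :: "('m, 'v) covector_field" and Z W :: "'m \<Rightarrow> 'v"
  note expands = anchor_contract[OF X wedge2_smooth_funs[OF Y]] anchor_contract[OF Y wedge2_smooth_funs[OF X]]
    anchor_wedge2[OF c(1) Y] anchor_wedge2[OF c(2) Y] anchor_wedge2[OF c(3) X] anchor_wedge2[OF c(4) X]
    bracket_contract[OF X Y, of _ _ _ p] bracket_contract[OF Y X, of _ _ _ p] \<alpha> \<beta> \<gamma>
  have EX: "diff_term A X1 X2 Y1 Y2 \<alpha> \<beta> \<gamma> p = expand v d k X1 X2 Y1 Y2 \<alpha> \<beta> \<gamma>"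
    unfolding diff_term_def expand_def Let_def v_def k_def d_def by (simp only: expands)
  have EY: "diff_term A Y1 Y2 X1 X2 \<alpha> \<beta> \<gamma> p = expand v d k Y1 Y2 X1 X2 \<alpha> \<beta> \<gamma>"
    unfolding diff_term_def expand_def Let_def v_def k_def d_def by (simp only: expands)
  have k: "k h W Z = - k h Z W" if "h \<in> {\<alpha>, \<beta>, \<gamma>}" "Z \<in> sections A" "W \<in> sections A" for h Z W
    unfolding k_def using that \<alpha> \<beta> \<gamma> by (intro sk) auto
  show ?thesis
    unfolding EX EY decomposable_bracket_def wedge3_def wedge2_def v_def k_def
    by (rule expand_identity[of \<alpha> \<beta> \<gamma> k Y1 X1 X2 Y2 v d, OF k[OF _ X(1) Y(1)] k[OF _ X(2) Y(1)]
          k[OF _ X(1) Y(2)] k[OF _ X(2) Y(2)], unfolded v_def k_def])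
qed

end

section \<open>Sections and forms expressed through a decomposition of the inverse bivector\<close>

context smooth_bundle begin

text \<open>The two minus signs in play, from \<open>flat\<close> and from skew-symmetry, cancel:
  the value is (\<omega>y)(x) = - \<omega>(y, x) = \<omega>(x, y).\<close>

lemma inverse_bivector_flat_flat:
  assumes "\<omega> \<in> two_forms A" "nondegenerate_form A \<omega>" "x \<in> fibre A p"
  shows "inverse_bivector A \<omega> p (flat \<omega> p x) (flat \<omega> p y) = \<omega> p x y"
  using inverse_bivector_flat[OF assms flat_dual[OF assms(1)]] form_skew[OF assms(1), of p y x]
  by (simp add: flat_def)

lemma section_decomposition:
  assumes \<omega>: "\<omega> \<in> two_forms A" "nondegenerate_form A \<omega>"
    and dec: "decomposes_on A U (inverse_bivector A \<omega>) n X Y" and q: "q \<in> U" and s: "s \<in> sections A"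
  shows "s q = (\<Sum>i<n. contract (X i) (Y i) (\<lambda>q. flat \<omega> q (s q)) q)"
proof (rule fibre_eqI[OF section_in_fibre[OF s]])
  let ?\<theta> = "\<lambda>q. flat \<omega> q (s q)"
  have XY: "X i \<in> sections A" "Y i \<in> sections A" if "i < n" for i
    using dec that by (auto simp: decomposes_on_def)
  have sec: "contract (X i) (Y i) ?\<theta> \<in> sections A" if "i < n" for i
    by (intro contract_section XY[OF that] flat_cosection[OF \<omega>(1) s])
  show "(\<Sum>i<n. contract (X i) (Y i) ?\<theta> q) \<in> fibre A q"
    by (intro subspace_sum[OF subspace_fibre] section_in_fibre sec) simp
  fix \<eta> assume \<eta>: "\<eta> \<in> dual_fibre A q"
  have "\<eta> (s q) = inverse_bivector A \<omega> q (?\<theta> q) \<eta>"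
    using inverse_bivector_flat[OF \<omega> section_in_fibre[OF s] \<eta>] by simp
  also have "\<dots> = (\<Sum>i<n. wedge2 (X i q) (Y i q) (?\<theta> q) \<eta>)"
    using dec q \<eta> flat_dual[OF \<omega>(1)] by (simp add: decomposes_on_def)
  also have "\<dots> = (\<Sum>i<n. \<eta> (contract (X i) (Y i) ?\<theta> q))"
    using XY section_in_fibre[of _ q] subspace_scale[OF subspace_fibre[of q]]
    by (intro sum.cong)
       (simp_all add: wedge2_def contract_def dual_space_diff[OF \<eta> subspace_fibre] dual_space_scaleR[OF \<eta>])
  also have "\<dots> = \<eta> (\<Sum>i<n. contract (X i) (Y i) ?\<theta> q)"
    by (rule dual_space_sum[OF \<eta> subspace_fibre, symmetric]) (simp add: section_in_fibre sec)
  finally show "\<eta> (s q) = \<eta> (\<Sum>i<n. contract (X i) (Y i) ?\<theta> q)" .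
qed

lemma form_decomposition:
  assumes \<omega>: "\<omega> \<in> two_forms A" "nondegenerate_form A \<omega>"
    and dec: "decomposes_on A U (inverse_bivector A \<omega>) n X Y" and q: "q \<in> U"
    and s: "s \<in> sections A" and t: "t \<in> sections A"
  shows "\<omega> q (s q) (t q) = (\<Sum>i<n. wedge2 (X i q) (Y i q) (flat \<omega> q (s q)) (flat \<omega> q (t q)))"
  using inverse_bivector_flat_flat[OF \<omega> section_in_fibre[OF s], of q "t q"] dec q flat_dual[OF \<omega>(1)]
  by (simp add: decomposes_on_def)

end

section \<open>The Schouten bracket of the inverse bivector and the differential of the form\<close>

context lie_algebroid_bundle begin

text \<open>Two independent decompositions are allowed, because the Schouten bracket is computed
  from two. The \<open>X\<close> family replaces the differentiating section and the first bracket
  entry, the \<open>Y\<close> family the differentiated function and the second entry.\<close>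

lemma diff_form2_decomposition:
  assumes \<omega>: "\<omega> \<in> two_forms A" "nondegenerate_form A \<omega>" and U: "open U" "p \<in> U"
    and X: "decomposes_on A U (inverse_bivector A \<omega>) n X1 X2"
    and Y: "decomposes_on A U (inverse_bivector A \<omega>) m Y1 Y2"
    and x: "x \<in> sections A" and y: "y \<in> sections A" and z: "z \<in> sections A"
  shows "diff_form2 A \<omega> x y z p = (\<Sum>i<n. \<Sum>j<m. diff_term A (X1 i) (X2 i) (Y1 j) (Y2 j)
    (\<lambda>q. flat \<omega> q (x q)) (\<lambda>q. flat \<omega> q (y q)) (\<lambda>q. flat \<omega> q (z q)) p)"
proof -
  define \<theta> where "\<theta> s = (\<lambda>q. flat \<omega> q (s q))" for s
  have \<theta>: "\<theta> s \<in> cosections A" if "s \<in> sections A" for s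
    unfolding \<theta>_def by (rule flat_cosection[OF \<omega>(1) that])
  have secX: "X1 i \<in> sections A" "X2 i \<in> sections A" if "i < n" for i
    using X that by (auto simp: decomposes_on_def)
  have secY: "Y1 i \<in> sections A" "Y2 i \<in> sections A" if "i < m" for i
    using Y that by (auto simp: decomposes_on_def)
  have cX: "contract (X1 i) (X2 i) (\<theta> s) \<in> sections A" if "i < n" "s \<in> sections A" for i s
    using secX that \<theta> by (intro contract_section)
  have cY: "contract (Y1 i) (Y2 i) (\<theta> s) \<in> sections A" if "i < m" "s \<in> sections A" for i s
    using secY that \<theta> by (intro contract_section)
  have deriv: "anchor A p (s p) (\<lambda>q. \<omega> q (t q) (r q)) = (\<Sum>i<n. \<Sum>j<m.
      anchor A p (contract (X1 i) (X2 i) (\<theta> s) p) (\<lambda>q. wedge2 (Y1 j q) (Y2 j q) (\<theta> t q) (\<theta> r q)))"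
    if s: "s \<in> sections A" and t: "t \<in> sections A" and r: "r \<in> sections A" for s t r
  proof -
    let ?w = "\<lambda>j q. wedge2 (Y1 j q) (Y2 j q) (\<theta> t q) (\<theta> r q)"
    have w: "?w j \<in> smooth_funs A" if "j < m" for j
      by (intro wedge2_smooth_funs secY[OF that] \<theta> t r)
    \<comment> \<open>The two functions agree on \<open>U\<close> only, so locality of the anchor is
      essential here.\<close>
    have "anchor A p (s p) (\<lambda>q. \<omega> q (t q) (r q)) = anchor A p (s p) (\<lambda>q. \<Sum>j<m. ?w j q)"
    proof (rule anchor_local[OF U form_smooth_funs[OF \<omega>(1) t r]])
      show "(\<lambda>q. \<Sum>j<m. ?w j q) \<in> smooth_funs A" by (rule smooth_funs_sum) (simp add: w)
      show "\<omega> q (t q) (r q) = (\<Sum>j<m. ?w j q)" if "q \<in> U" for q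
        unfolding \<theta>_def by (rule form_decomposition[OF \<omega> Y that t r])
    qed (rule section_in_fibre[OF s])
    also have "\<dots> = (\<Sum>j<m. anchor A p (s p) (?w j))"
      by (rule anchor_sum_fun[OF section_in_fibre[OF s]]) (simp add: w)
    also have "\<dots> = (\<Sum>j<m. \<Sum>i<n. anchor A p (contract (X1 i) (X2 i) (\<theta> s) p) (?w j))"
    proof (rule sum.cong[OF refl])
      fix j assume "j \<in> {..<m}"
      then have j: "j < m" by simp
      \<comment> \<open>The anchor depends on the value of its section at \<open>p\<close> alone, so
        the decomposition of \<open>s\<close> at that one point suffices.\<close>
      show "anchor A p (s p) (?w j) = (\<Sum>i<n. anchor A p (contract (X1 i) (X2 i) (\<theta> s) p) (?w j))"
        unfolding section_decomposition[OF \<omega> X U(2) s] \<theta>_def[symmetric]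
        by (rule anchor_sum) (auto intro!: section_in_fibre cX s w[OF j])
    qed
    also have "\<dots> = (\<Sum>i<n. \<Sum>j<m. anchor A p (contract (X1 i) (X2 i) (\<theta> s) p) (?w j))"
      by (rule sum.swap)
    finally show ?thesis .
  qed
  have brack: "\<theta> r p (bracket A s t p) = (\<Sum>i<n. \<Sum>j<m.
      \<theta> r p (bracket A (contract (X1 i) (X2 i) (\<theta> s)) (contract (Y1 j) (Y2 j) (\<theta> t)) p))"
    if s: "s \<in> sections A" and t: "t \<in> sections A" and r: "r \<in> sections A" for s t r
  proof -
    let ?X = "\<lambda>i. contract (X1 i) (X2 i) (\<theta> s)" and ?Y = "\<lambda>j. contract (Y1 j) (Y2 j) (\<theta> t)"
    have SX: "(\<lambda>q. \<Sum>i<n. ?X i q) \<in> sections A" by (rule sections_sum) (simp add: cX s)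
    have SY: "(\<lambda>q. \<Sum>j<m. ?Y j q) \<in> sections A" by (rule sections_sum) (simp add: cY t)
    \<comment> \<open>Both entries are replaced by sums that coincide with them near
      \<open>p\<close> but possibly nowhere else.\<close>
    have "bracket A s t p = bracket A (\<lambda>q. \<Sum>i<n. ?X i q) (\<lambda>q. \<Sum>j<m. ?Y j q) p"
      unfolding \<theta>_def using SX SY section_decomposition[OF \<omega> X _ s] section_decomposition[OF \<omega> Y _ t]
      by (intro bracket_local[OF U s _ t]) (simp_all add: \<theta>_def)
    also have "\<dots> = (\<Sum>i<n. bracket A (?X i) (\<lambda>q. \<Sum>j<m. ?Y j q) p)"
      by (rule bracket_sum_left[OF SY]) (simp add: cX s)
    also have "\<dots> = (\<Sum>i<n. \<Sum>j<m. bracket A (?X i) (?Y j) p)"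
      by (intro sum.cong refl bracket_sum_right) (auto intro: cX cY s t)
    finally have eq: "bracket A s t p = (\<Sum>i<n. \<Sum>j<m. bracket A (?X i) (?Y j) p)" .
    note rp = cosection_in_dual[OF \<theta>[OF r], of p]
    have fib: "bracket A (?X i) (?Y j) p \<in> fibre A p" if "i < n" "j < m" for i j
      by (intro bracket_in_fibre cX cY that s t)
    have "\<theta> r p (\<Sum>i<n. \<Sum>j<m. bracket A (?X i) (?Y j) p) = (\<Sum>i<n. \<theta> r p (\<Sum>j<m. bracket A (?X i) (?Y j) p))"
      by (rule dual_space_sum[OF rp subspace_fibre]) (auto intro!: subspace_sum[OF subspace_fibre] fib)
    also have "\<dots> = (\<Sum>i<n. \<Sum>j<m. \<theta> r p (bracket A (?X i) (?Y j) p))"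
      by (intro sum.cong refl dual_space_sum[OF rp subspace_fibre]) (auto intro: fib)
    finally show ?thesis unfolding eq .
  qed
  have \<theta>b: "\<omega> p (bracket A s t p) (r p) = \<theta> r p (bracket A s t p)" for s t r
    using form_skew[OF \<omega>(1), of p "bracket A s t p" "r p"] by (simp add: \<theta>_def flat_def)
  show ?thesis
    unfolding diff_form2_def \<theta>b deriv[OF x y z] deriv[OF y x z] deriv[OF z x y]
      brack[OF x y z] brack[OF x z y] brack[OF y z x] \<theta>_def[symmetric] diff_term_def
    by (simp only: sum.distrib sum_subtractf)
qed

text \<open>The sum of \<open>decomposable_bracket_eq\<close> over all pairs splits into two double
  sums, one for each decomposition placed in front, and \<open>diff_form2_decomposition\<close>
  applies to both.\<close>

lemma schouten_inverse_bivector: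
  assumes \<omega>: "\<omega> \<in> two_forms A" "nondegenerate_form A \<omega>"
    and x: "x \<in> sections A" and y: "y \<in> sections A" and z: "z \<in> sections A"
  shows "schouten_bracket A (inverse_bivector A \<omega>) (inverse_bivector A \<omega>) p
      (flat \<omega> p (x p)) (flat \<omega> p (y p)) (flat \<omega> p (z p)) = - 2 * diff_form2 A \<omega> x y z p"
proof -
  let ?P = "inverse_bivector A \<omega>"
  let ?S = "\<lambda>n m X1 X2 Y1 Y2. \<Sum>i<n. \<Sum>j<m. decomposable_bracket A (X1 i) (X2 i) (Y1 j) (Y2 j) p
      (flat \<omega> p (x p)) (flat \<omega> p (y p)) (flat \<omega> p (z p))"
  have val: "?S n m X1 X2 Y1 Y2 = - 2 * diff_form2 A \<omega> x y z p"
    if U: "open U" "p \<in> U" and X: "decomposes_on A U ?P n X1 X2" and Y: "decomposes_on A U ?P m Y1 Y2"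
    for U n m X1 X2 Y1 Y2
  proof -
    note c = flat_cosection[OF \<omega>(1) x] flat_cosection[OF \<omega>(1) y] flat_cosection[OF \<omega>(1) z]
    define T where "T Z1 Z2 W1 W2 = diff_term A Z1 Z2 W1 W2
      (\<lambda>q. flat \<omega> q (x q)) (\<lambda>q. flat \<omega> q (y q)) (\<lambda>q. flat \<omega> q (z q)) p" for Z1 Z2 W1 W2
    have swap: "(\<Sum>j<m. \<Sum>i<n. T (Y1 j) (Y2 j) (X1 i) (X2 i)) = (\<Sum>i<n. \<Sum>j<m. T (Y1 j) (Y2 j) (X1 i) (X2 i))"
      by (rule sum.swap)
    have "?S n m X1 X2 Y1 Y2 = (\<Sum>i<n. \<Sum>j<m. - (T (X1 i) (X2 i) (Y1 j) (Y2 j) + T (Y1 j) (Y2 j) (X1 i) (X2 i)))"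
      unfolding T_def using X Y
      by (intro sum.cong refl decomposable_bracket_eq[OF _ _ _ _ c]) (auto simp: decomposes_on_def)
    also have "\<dots> = - ((\<Sum>i<n. \<Sum>j<m. T (X1 i) (X2 i) (Y1 j) (Y2 j)) + (\<Sum>j<m. \<Sum>i<n. T (Y1 j) (Y2 j) (X1 i) (X2 i)))"
      unfolding swap by (simp only: sum_negf sum.distrib)
    finally show ?thesis
      unfolding T_def diff_form2_decomposition[OF \<omega> U X Y x y z, symmetric]
        diff_form2_decomposition[OF \<omega> U Y X x y z, symmetric] by simp
  qed
  obtain U X Y where dec: "open U" "p \<in> U" "decomposes_on A U ?P (rnk A) X Y"
    by (rule bivector_decomposition[OF inverse_bivector_in_bivectors[OF \<omega>]])
  have "(THE t. \<exists>U n m X1 X2 Y1 Y2. open U \<and> p \<in> U \<and> decomposes_on A U ?P n X1 X2 \<and>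
      decomposes_on A U ?P m Y1 Y2 \<and> t = ?S n m X1 X2 Y1 Y2) = - 2 * diff_form2 A \<omega> x y z p"
  proof (rule the_equality)
    \<comment> \<open>For existence, one decomposition near \<open>p\<close> is used for both
      arguments.\<close>
    show "\<exists>U n m X1 X2 Y1 Y2. open U \<and> p \<in> U \<and> decomposes_on A U ?P n X1 X2 \<and>
      decomposes_on A U ?P m Y1 Y2 \<and> - 2 * diff_form2 A \<omega> x y z p = ?S n m X1 X2 Y1 Y2"
      by (rule exI[of _ U], rule exI[of _ "rnk A"], rule exI[of _ "rnk A"], rule exI[of _ X], rule exI[of _ Y],
          rule exI[of _ X], rule exI[of _ Y]) (use dec val[OF dec dec(3)] in simp)
  next
    fix t assume "\<exists>U n m X1 X2 Y1 Y2. open U \<and> p \<in> U \<and> decomposes_on A U ?P n X1 X2 \<and>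
      decomposes_on A U ?P m Y1 Y2 \<and> t = ?S n m X1 X2 Y1 Y2"
    then show "t = - 2 * diff_form2 A \<omega> x y z p" by (elim exE conjE) (simp add: val)
  qed
  then show ?thesis unfolding schouten_bracket_def by (simp add: flat_dual[OF \<omega>(1)])
qed

lemma poisson_inverse_bivector_iff:
  assumes \<omega>: "\<omega> \<in> two_forms A" "nondegenerate_form A \<omega>"
  shows "poisson_bivector A (inverse_bivector A \<omega>) \<longleftrightarrow> presymplectic A \<omega>"
proof
  assume P: "poisson_bivector A (inverse_bivector A \<omega>)"
  have "diff_form2 A \<omega> X Y Z p = 0" if "X \<in> sections A" "Y \<in> sections A" "Z \<in> sections A" for X Y Z p
    using schouten_inverse_bivector[OF \<omega> that, of p] P by (simp add: poisson_bivector_def)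
  then show "presymplectic A \<omega>" using \<omega>(1) by (simp add: presymplectic_def)
next
  let ?P = "inverse_bivector A \<omega>"
  assume d: "presymplectic A \<omega>"
  have "schouten_bracket A ?P ?P p \<alpha> \<beta> \<gamma> = 0" for p \<alpha> \<beta> \<gamma>
  proof (cases "\<alpha> \<in> dual_fibre A p \<and> \<beta> \<in> dual_fibre A p \<and> \<gamma> \<in> dual_fibre A p")
    case True
    \<comment> \<open>The formula for the bracket speaks only of covectors coming from sections; by
      non-degeneracy these exhaust the dual fibre at \<open>p\<close>.\<close>
    have "\<exists>X\<in>sections A. flat \<omega> p (X p) = \<xi>" if \<xi>: "\<xi> \<in> dual_fibre A p" for \<xi>
    proof -
      obtain x where x: "x \<in> fibre A p" "flat \<omega> p x = \<xi>" by (rule flat_surj[OF \<omega>(2) \<xi>])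
      obtain X where "X \<in> sections A" "X p = x" by (rule section_through[OF x(1)])
      then show ?thesis using x(2) by blast
    qed
    then obtain X Y Z where "X \<in> sections A" "Y \<in> sections A" "Z \<in> sections A"
      "flat \<omega> p (X p) = \<alpha>" "flat \<omega> p (Y p) = \<beta>" "flat \<omega> p (Z p) = \<gamma>"
      using True by metis
    then show ?thesis
      using schouten_inverse_bivector[OF \<omega>, of X Y Z p] d by (auto simp: presymplectic_def)
  next
    case False
    then show ?thesis by (auto simp: schouten_bracket_def)
  qed
  then show "poisson_bivector A ?P"
    using inverse_bivector_in_bivectors[OF \<omega>] by (simp add: poisson_bivector_def fun_eq_iff)
qed

end

section \<open>Graphs of presymplectic forms\<close>

context smooth_bundle begin

text \<open>A frame of \<open>A\<close> together with its image under \<open>flat\<close> is a frame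
  of the graph; independence is already visible in the first components.\<close>

lemma subbundle_form_graph:
  assumes \<omega>: "\<omega> \<in> two_forms A"
  shows "subbundle A (form_graph A \<omega>)"
  unfolding subbundle_def
proof
  fix p
  let ?k = "rnk A"
  obtain U e where U: "(U, e) \<in> frames A" "p \<in> U" using frame_cover by blast
  let ?\<sigma> = "\<lambda>i q. flat \<omega> q (e i q)"
  have "smooth_section_on A U (e i) \<and> smooth_cosection_on A U (?\<sigma> i)" if "i < ?k" for i
    using frame(2)[OF U(1) that] flat_cosection_on[OF frame(1)[OF U(1)] \<omega>] by blast
  moreover have "form_graph A \<omega> q =
      {(\<Sum>i<?k. c i *\<^sub>R e i q, \<lambda>v. \<Sum>i<?k. c i * ?\<sigma> i q v) | c :: nat \<Rightarrow> real. True}" if q: "q \<in> U" for q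
  proof -
    have fl: "flat \<omega> q (\<Sum>i<?k. c i *\<^sub>R e i q) = (\<lambda>v. \<Sum>i<?k. c i * ?\<sigma> i q v)" for c
      by (rule flat_lincomb[OF \<omega>]) (simp add: frame_in_fibre[OF U(1) q])
    have fib: "(\<Sum>i<?k. c i *\<^sub>R e i q) \<in> fibre A q" for c
      by (rule lincomb_in_fibre) (simp add: frame_in_fibre[OF U(1) q])
    show ?thesis
      unfolding form_graph_def fl[symmetric] using fib frame_coords[OF U(1) q] by blast
  qed
  moreover have "\<forall>i<?k. c i = 0" if "q \<in> U" "(\<Sum>i<?k. c i *\<^sub>R e i q) = 0" for q c
    using frame_coords_0[OF U(1) that] by simp
  ultimately show "\<exists>U r s \<sigma>. open U \<and> p \<in> U \<and>
        (\<forall>i<r. smooth_section_on A U (s i) \<and> smooth_cosection_on A U (\<sigma> i)) \<and>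
        (\<forall>q\<in>U. form_graph A \<omega> q = {(\<Sum>i<r. c i *\<^sub>R s i q, \<lambda>v. \<Sum>i<r. c i * \<sigma> i q v) | c :: nat \<Rightarrow> real. True} \<and>
           (\<forall>c :: nat \<Rightarrow> real. (\<Sum>i<r. c i *\<^sub>R s i q) = 0 \<and> (\<lambda>v. \<Sum>i<r. c i * \<sigma> i q v) = (\<lambda>v. 0)
              \<longrightarrow> (\<forall>i<r. c i = 0)))"
    using frame(1)[OF U(1)] U(2)
    by (intro exI[of _ U] exI[of _ ?k] exI[of _ e] exI[of _ ?\<sigma>]) simp
qed

text \<open>If (x, \<xi>) pairs to 0 with every (y, \<omega>y), then \<xi>(y) = - (\<omega>y)(x) =
  (\<omega>x)(y), so (x, \<xi>) already lies in the graph.\<close>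

lemma maximally_isotropic_form_graph:
  assumes \<omega>: "\<omega> \<in> two_forms A"
  shows "maximally_isotropic_at A p (form_graph A \<omega> p)"
proof -
  let ?L = "form_graph A \<omega> p" and ?V = "fibre A p"
  have lin: "flat \<omega> p (x + y) = (\<lambda>v. flat \<omega> p x v + flat \<omega> p y v)"
    "flat \<omega> p (c *\<^sub>R x) = (\<lambda>v. c * flat \<omega> p x v)" if "x \<in> ?V" "y \<in> ?V" for x y c
    using dual_space_add[OF form_dual(2)[OF \<omega>] that] dual_space_scaleR[OF form_dual(2)[OF \<omega>] that(1)]
    by (simp_all add: flat_def)
  have z: "flat \<omega> p 0 = (\<lambda>v. 0)"
    using dual_space_zero[OF form_dual(2)[OF \<omega>] subspace_fibre] by (simp add: flat_def)
  have "is_subspace_at A p ?L"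
    unfolding is_subspace_at_def
  proof (intro conjI)
    show "?L \<subseteq> ?V \<times> dual_fibre A p" using flat_dual[OF \<omega>] by (auto simp: form_graph_def)
    show "(0, \<lambda>v. 0) \<in> ?L" using z subspace_0[OF subspace_fibre] by (force simp: form_graph_def)
    show "\<forall>(x, \<xi>)\<in>?L. \<forall>(y, \<eta>)\<in>?L. (x + y, \<lambda>v. \<xi> v + \<eta> v) \<in> ?L"
      using lin(1) subspace_add[OF subspace_fibre] by (auto simp: form_graph_def)
    show "\<forall>c. \<forall>(x, \<xi>)\<in>?L. (c *\<^sub>R x, \<lambda>v. c * \<xi> v) \<in> ?L"
      using lin(2) subspace_scale[OF subspace_fibre] by (auto simp: form_graph_def)
  qed
  moreover have "pairing a b = 0" if "a \<in> ?L" "b \<in> ?L" for a b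
    using that form_skew[OF \<omega>, of p "fst a" "fst b"] by (auto simp: form_graph_def pairing_def flat_def)
  ultimately have iso: "isotropic_at A p ?L" by (simp add: isotropic_at_def)
  have "W = ?L" if W: "isotropic_at A p W" "?L \<subseteq> W" for W
  proof
    show "W \<subseteq> ?L"
    proof
      fix a assume a: "a \<in> W"
      obtain x \<xi> where eq: "a = (x, \<xi>)" by fastforce
      have x: "x \<in> ?V" and \<xi>: "\<xi> \<in> dual_fibre A p"
        using W(1) a eq by (auto simp: isotropic_at_def is_subspace_at_def)
      have "\<xi> y = flat \<omega> p x y" for y
      proof (cases "y \<in> ?V")
        case True
        then have "(y, flat \<omega> p y) \<in> W" using W(2) by (auto simp: form_graph_def)
        then have "pairing a (y, flat \<omega> p y) = 0" using W(1) a by (simp add: isotropic_at_def)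
        then show ?thesis using form_skew[OF \<omega>, of p x y] by (simp add: pairing_def eq flat_def)
      next
        case False
        then show ?thesis using dual_space_outside[OF \<xi>] dual_space_outside[OF flat_dual[OF \<omega>]] by simp
      qed
      then have "\<xi> = flat \<omega> p x" by (rule ext)
      then show "a \<in> ?L" using x eq by (auto simp: form_graph_def)
    qed
  qed (rule W(2))
  with iso show ?thesis by (simp add: maximally_isotropic_at_def)
qed

lemma sections_form_graph:
  assumes "\<omega> \<in> two_forms A"
  shows "(X, \<xi>) \<in> subbundle_sections A (form_graph A \<omega>) \<longleftrightarrow> X \<in> sections A \<and> \<xi> = (\<lambda>p. flat \<omega> p (X p))"
  using flat_cosection[OF assms] section_in_fibre
  by (auto simp: subbundle_sections_def form_graph_def)

text \<open>One inclusion is pointwise inversion. The other needs \<open>sharp\<close> to send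
  smooth covector fields to smooth sections, which is
  \<open>smooth_section_on_of_flat\<close>.\<close>

lemma dirac_relation_eq_poisson_relation:
  assumes \<omega>: "\<omega> \<in> two_forms A" "nondegenerate_form A \<omega>"
    and \<omega>': "\<omega>' \<in> two_forms A" "nondegenerate_form A \<omega>'"
  shows "dirac_relation A (form_graph A \<omega>) (form_graph A \<omega>') =
    poisson_relation A (inverse_bivector A \<omega>) (inverse_bivector A \<omega>')"
proof -
  have sec: "(\<lambda>p. sharp A (inverse_bivector A \<omega>) p (\<xi> p)) \<in> sections A"
    if "\<omega> \<in> two_forms A" "nondegenerate_form A \<omega>" "\<xi> \<in> cosections A" for \<omega> \<xi>
    using smooth_section_on_of_flat[of UNIV \<omega> \<xi> "\<lambda>p. sharp A (inverse_bivector A \<omega>) p (\<xi> p)"]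
      sharp_inverse[OF that(1,2) cosection_in_dual[OF that(3)]] that
    by (simp add: sections_def cosections_def)
  show ?thesis
  proof (intro equalityI subsetI)
    fix a assume "a \<in> dirac_relation A (form_graph A \<omega>) (form_graph A \<omega>')"
    then obtain x y \<xi> where a: "a = (x, y)" "x \<in> sections A" "y \<in> sections A" "\<xi> \<in> cosections A"
      "\<xi> = (\<lambda>p. flat \<omega>' p (x p))" "\<xi> = (\<lambda>p. flat \<omega> p (y p))"
      by (auto simp: dirac_relation_def sections_form_graph[OF \<omega>(1)] sections_form_graph[OF \<omega>'(1)])
    have "x = (\<lambda>p. sharp A (inverse_bivector A \<omega>') p (\<xi> p))"
      using sharp_inverse_flat[OF \<omega>' section_in_fibre[OF a(2)]] a(5) by simp
    moreover have "y = (\<lambda>p. sharp A (inverse_bivector A \<omega>) p (\<xi> p))"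
      using sharp_inverse_flat[OF \<omega> section_in_fibre[OF a(3)]] a(6) by simp
    ultimately show "a \<in> poisson_relation A (inverse_bivector A \<omega>) (inverse_bivector A \<omega>')"
      using a(1,4) unfolding poisson_relation_def by blast
  next
    fix a assume "a \<in> poisson_relation A (inverse_bivector A \<omega>) (inverse_bivector A \<omega>')"
    then obtain \<xi> where \<xi>: "\<xi> \<in> cosections A" and a: "a = (\<lambda>p. sharp A (inverse_bivector A \<omega>') p (\<xi> p),
        \<lambda>p. sharp A (inverse_bivector A \<omega>) p (\<xi> p))"
      by (auto simp: poisson_relation_def)
    have "\<xi> = (\<lambda>p. flat \<omega> p (sharp A (inverse_bivector A \<omega>) p (\<xi> p)))"
      "\<xi> = (\<lambda>p. flat \<omega>' p (sharp A (inverse_bivector A \<omega>') p (\<xi> p)))"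
      using sharp_inverse(2)[OF \<omega> cosection_in_dual[OF \<xi>]] sharp_inverse(2)[OF \<omega>' cosection_in_dual[OF \<xi>]]
      by simp_all
    then show "a \<in> dirac_relation A (form_graph A \<omega>) (form_graph A \<omega>')"
      unfolding dirac_relation_def sections_form_graph[OF \<omega>(1)] sections_form_graph[OF \<omega>'(1)] a
      using \<xi> sec[OF \<omega> \<xi>] sec[OF \<omega>' \<xi>] by auto
  qed
qed

end

section \<open>Dorfman brackets on graphs and the correspondence of pairs\<close>

context lie_algebroid_bundle begin

text \<open>For \<xi> = \<omega>X and \<eta> = \<omega>Y, Cartan calculus gives L_X \<eta> - i_Y
  d\<xi> = \<omega>[X, Y] - i_Y i_X d\<omega>, and the last term vanishes for a closed form. The
  proof checks this on a third section \<open>Z\<close>.\<close>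

lemma dorfman_bracket_form_graph:
  assumes d: "presymplectic A \<omega>" and X: "X \<in> sections A" and Y: "Y \<in> sections A"
  shows "dorfman_bracket A (X, \<lambda>p. flat \<omega> p (X p)) (Y, \<lambda>p. flat \<omega> p (Y p)) =
    (bracket A X Y, \<lambda>p. flat \<omega> p (bracket A X Y p))"
proof -
  have \<omega>: "\<omega> \<in> two_forms A" using d by (simp add: presymplectic_def)
  let ?\<xi> = "\<lambda>p. flat \<omega> p (X p)" and ?\<eta> = "\<lambda>p. flat \<omega> p (Y p)" and ?\<zeta> = "\<lambda>p. flat \<omega> p (bracket A X Y p)"
  have \<zeta>: "?\<zeta> \<in> cosections A" by (rule flat_cosection[OF \<omega> bracket_section[OF X Y]])
  have anchor_flat: "anchor A p (s p) (\<lambda>q. flat \<omega> q (t q) (r q)) = - anchor A p (s p) (\<lambda>q. \<omega> q (t q) (r q))"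
    if s: "s \<in> sections A" and tr: "t \<in> sections A" "r \<in> sections A" for s t r p
    using anchor_derivation(2)[OF section_in_fibre[OF s] form_smooth_funs[OF \<omega> tr] form_smooth_funs[OF \<omega> tr], of p "-1"]
    by (simp add: flat_def)
  have eq: "?\<zeta> p (Z p) = lie_derivative A X ?\<eta> Z p - diff_form1 A ?\<xi> Y Z p" if Z: "Z \<in> sections A" for Z p
  proof -
    have "diff_form2 A \<omega> X Y Z p = 0" using d X Y Z by (simp add: presymplectic_def)
    then show ?thesis
      unfolding lie_derivative_def diff_form1_def diff_form2_def anchor_flat[OF X Y Z] anchor_flat[OF Y X Z]
        anchor_flat[OF Z X Y]
      using form_skew[OF \<omega>, of p "bracket A X Z p" "Y p"] form_skew[OF \<omega>, of p "bracket A Y Z p" "X p"]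
      by (simp add: flat_def)
  qed
  have "(THE \<zeta>. \<zeta> \<in> cosections A \<and> (\<forall>Z\<in>sections A. \<forall>p.
      \<zeta> p (Z p) = lie_derivative A X ?\<eta> Z p - diff_form1 A ?\<xi> Y Z p)) = ?\<zeta>"
  proof (rule the_equality)
    fix \<zeta>' assume "\<zeta>' \<in> cosections A \<and> (\<forall>Z\<in>sections A. \<forall>p.
      \<zeta>' p (Z p) = lie_derivative A X ?\<eta> Z p - diff_form1 A ?\<xi> Y Z p)"
    then show "\<zeta>' = ?\<zeta>" using eq by (intro cosections_eqI[OF _ \<zeta>]) simp_all
  qed (use \<zeta> eq in simp)
  then show ?thesis by (simp add: dorfman_bracket_def)
qed

lemma dirac_structure_form_graph:
  assumes "presymplectic A \<omega>"
  shows "dirac_structure A (form_graph A \<omega>)"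
proof -
  have \<omega>: "\<omega> \<in> two_forms A" using assms by (simp add: presymplectic_def)
  have "dorfman_bracket A a b \<in> subbundle_sections A (form_graph A \<omega>)"
    if a: "a \<in> subbundle_sections A (form_graph A \<omega>)" and b: "b \<in> subbundle_sections A (form_graph A \<omega>)" for a b
  proof -
    obtain X \<xi> Y \<eta> where eq: "a = (X, \<xi>)" "b = (Y, \<eta>)" by fastforce
    have X: "X \<in> sections A" "\<xi> = (\<lambda>p. flat \<omega> p (X p))" and Y: "Y \<in> sections A" "\<eta> = (\<lambda>p. flat \<omega> p (Y p))"
      using a b sections_form_graph[OF \<omega>] by (simp_all add: eq)
    show ?thesis
      unfolding eq X(2) Y(2) dorfman_bracket_form_graph[OF assms X(1) Y(1)] sections_form_graph[OF \<omega>]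
      using bracket_section[OF X(1) Y(1)] by simp
  qed
  then show ?thesis
    unfolding dirac_structure_def
    using subbundle_form_graph[OF \<omega>] maximally_isotropic_form_graph[OF \<omega>] by blast
qed

text \<open>A Poisson pair says nothing about Dirac structures; that both graphs are Dirac is
  recovered from the closedness of the forms.\<close>

lemma symplectic_pairs_iff:
  assumes \<omega>: "\<omega> \<in> two_forms A" "nondegenerate_form A \<omega>"
    and \<omega>': "\<omega>' \<in> two_forms A" "nondegenerate_form A \<omega>'"
  shows "(inverse_bivector A \<omega>, inverse_bivector A \<omega>') \<in> nondegenerate_poisson_pairs A \<longleftrightarrow>
    (\<omega>, \<omega>') \<in> symplectic_pairs A"
  using poisson_inverse_bivector_iff[OF \<omega>] poisson_inverse_bivector_iff[OF \<omega>'] \<omega> \<omega>'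
    nondegenerate_inverse_bivector[OF \<omega>] nondegenerate_inverse_bivector[OF \<omega>']
    dirac_structure_form_graph[of \<omega>] dirac_structure_form_graph[of \<omega>']
    dirac_relation_eq_poisson_relation[OF \<omega> \<omega>']
  by (auto simp: nondegenerate_poisson_pairs_def symplectic_pairs_def presymplectic_pair_def dirac_pair_def)

end

theorem theorem3p4:
  fixes A :: "('m::{t2_space, second_countable_topology}, 'e::real_inner, 'v::real_vector) algebroid_data"
  assumes "lie_algebroid A"
  shows "bij_betw (\<lambda>(\<omega>, \<omega>'). (inverse_bivector A \<omega>, inverse_bivector A \<omega>'))
           (symplectic_pairs A) (nondegenerate_poisson_pairs A)"
proof -
  interpret lie_algebroid_bundle A using assms by unfold_locales
  let ?f = "\<lambda>(\<omega>, \<omega>'). (inverse_bivector A \<omega>, inverse_bivector A \<omega>')"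
  have sp: "\<omega> \<in> two_forms A" "nondegenerate_form A \<omega>" "\<omega>' \<in> two_forms A" "nondegenerate_form A \<omega>'"
    if "(\<omega>, \<omega>') \<in> symplectic_pairs A" for \<omega> \<omega>'
    using that by (simp_all add: symplectic_pairs_def presymplectic_pair_def presymplectic_def)
  have "inj_on ?f (symplectic_pairs A)"
  proof (rule inj_onI, clarify)
    fix \<omega>1 \<omega>1' \<omega>2 \<omega>2'
    assume 1: "(\<omega>1, \<omega>1') \<in> symplectic_pairs A" and 2: "(\<omega>2, \<omega>2') \<in> symplectic_pairs A"
      and eq: "inverse_bivector A \<omega>1 = inverse_bivector A \<omega>2" "inverse_bivector A \<omega>1' = inverse_bivector A \<omega>2'"
    show "\<omega>1 = \<omega>2 \<and> \<omega>1' = \<omega>2'"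
      using inverse_bivector_inj[OF sp(1,2)[OF 1] sp(1,2)[OF 2] eq(1)]
        inverse_bivector_inj[OF sp(3,4)[OF 1] sp(3,4)[OF 2] eq(2)] ..
  qed
  moreover have "?f ` symplectic_pairs A = nondegenerate_poisson_pairs A"
  proof (intro equalityI subsetI)
    fix Q assume "Q \<in> ?f ` symplectic_pairs A"
    then obtain \<omega> \<omega>' where "(\<omega>, \<omega>') \<in> symplectic_pairs A" "Q = (inverse_bivector A \<omega>, inverse_bivector A \<omega>')"
      by auto
    then show "Q \<in> nondegenerate_poisson_pairs A"
      using symplectic_pairs_iff[OF sp] by simp
  next
    fix Q assume Q: "Q \<in> nondegenerate_poisson_pairs A"
    obtain P P' where PP': "Q = (P, P')" by fastforce
    with Q have P: "P \<in> bivectors A" "nondegenerate_bivector A P"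
      and P': "P' \<in> bivectors A" "nondegenerate_bivector A P'"
      by (simp_all add: nondegenerate_poisson_pairs_def poisson_bivector_def)
    \<comment> \<open>With the inverse forms as preimage, their closedness and the Nijenhuis
      condition are read off from \<open>Q\<close> through
      \<open>symplectic_pairs_iff\<close>.\<close>
    have eq: "Q = ?f (inverse_form A P, inverse_form A P')"
      by (simp add: PP' inverse_bivector_inverse_form P P')
    moreover have "(inverse_form A P, inverse_form A P') \<in> symplectic_pairs A"
      using symplectic_pairs_iff[OF inverse_form_in_two_forms[OF P] nondegenerate_inverse_form[OF P]
          inverse_form_in_two_forms[OF P'] nondegenerate_inverse_form[OF P']] Q eq by simp
    ultimately show "Q \<in> ?f ` symplectic_pairs A" by (rule image_eqI)
  qed
  ultimately show ?thesis by (simp add: bij_betw_def)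
qed

end
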